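(* Let $T>0$, let $U$ satisfy the standing assumptions in the context, let $c:\mathbb{R}\to\mathbb{R}_{\ge0}$ be strictly convex, and for probability measures $Q,P$ on $\Omega_{-T,T}$ set $$C(Q,P)=\begin{cases}E_P\big(c\big(\tfrac{dQ}{dP}\big)\big),&\text{if }Q\ll P,\\ +\infty,&\text{otherwise.}\end{cases}$$ Let $\mu,\nu$ be probability measures on $\mathbb{R}^d$ and let $P^\mu_{-T}$ be the Langevin dynamics for $U$ over $[-T,T]$ with initial distribution $\mu$. Consider the problem $$\min\ C(Q,P^\mu_{-T}),\qquad Q\in\mathcal{P}(\Omega_{-T,T}),\quad \omega_{-T}\#Q=\mu,\quad \omega_T\#Q=\nu.$$ Then, if a solution $\hat Q$ exists, it is in $\mathfrak{R}_T(U)$.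
   Context: For a potential $U:[-T,T]\times\mathbb{R}^d\to\mathbb{R}$ define $\mathscr{U}(t,z)=\frac12|\nabla U|^2(t,z)-\frac12\Delta U(t,z)-\partial_tU(t,z)$ (derivatives $\nabla,\Delta$ in space). Standing assumptions: $U$ is four times continuously differentiable in space and continuously differentiable in time, $\lim_{|z|\to\infty}|U(-T,z)|=\lim_{|z|\to\infty}|U(T,z)|=+\infty$, and $\inf_{t\in[-T,T],z\in\mathbb{R}^d}\mathscr{U}(t,z)>-\infty$. $\Omega_{-T,T}=C([-T,T];\mathbb{R}^d)$, $\mathcal{P}(\cdot)$ is the set of probability measures, $\omega$ the canonical path, and $Y\#Q$ the image of $Q$ under $Y$. $P^x_{-T}$ is the law of the solution of $dX_t=-\nabla U(t,X_t)\,dt+dB_t$, $X_{-T}=x$, with $B$ a Brownian motion; $P^\mu_{-T}$ is the law of the solution of the same equation with $X_{-T}$ distributed as $\mu$ (independent of $B$). $P^{x,y}_{-T,T}$ is the bridge, i.e. $P^x_{-T}$ conditioned on $\{\omega_T=y\}$ (defined for every $x,y$ since the transition density is everywhere positive). For $\pi\in\mathcal{P}(\mathbb{R}^d\times\mathbb{R}^d)$, $P^\pi_{-T,T}(A)=\int P^{x,y}_{-T,T}(A\cap\{\omega_{-T}=x,\omega_T=y\})\,\pi(dx\,dy)$. The reciprocal class is $\mathfrak{R}_T(U)=\{Q\in\mathcal{P}(\Omega_{-T,T}):Q=P^\pi_{-T,T}\text{ for some }\pi\in\mathcal{P}(\mathbb{R}^d\times\mathbb{R}^d)\}$.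
   Formalization: A solution is required to have finite cost C(Q,P^μ) < ∞; if every feasible Q has infinite cost (e.g. μ=ν=δ_0), every feasible Q would be a minimizer and the claim would fail. *)

theory Defs
  imports "HOL-Probability.Probability"
begin

text \<open>
  Throughout, \<open>\<real>\<^sup>d\<close> is rendered by a type \<open>'a::euclidean_space\<close>, and a potential is a total function
  \<open>U :: real \<Rightarrow> 'a \<Rightarrow> real\<close> (time first) of which only the values at times in \<open>{-T..T}\<close> matter.
\<close>

section \<open>Potentials\<close>

definition partial :: "'a::euclidean_space \<Rightarrow> ('a \<Rightarrow> real) \<Rightarrow> 'a \<Rightarrow> real" where
  "partial b f z = frechet_derivative f (at z) b"

definition grad :: "('a::euclidean_space \<Rightarrow> real) \<Rightarrow> 'a \<Rightarrow> 'a" where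
  "grad f z = (\<Sum>b\<in>Basis. partial b f z *\<^sub>R b)"

definition laplacian :: "('a::euclidean_space \<Rightarrow> real) \<Rightarrow> 'a \<Rightarrow> real" where
  "laplacian f z = (\<Sum>b\<in>Basis. partial b (partial b f) z)"

text \<open>One-sided at the end points of the time interval.\<close>

definition time_deriv :: "real \<Rightarrow> (real \<Rightarrow> 'a \<Rightarrow> real) \<Rightarrow> real \<Rightarrow> 'a \<Rightarrow> real" where
  "time_deriv T f t z = vector_derivative (\<lambda>s. f s z) (at t within {-T..T})"

text \<open>As usual for time-dependent functions, the space derivatives up to order \<open>k\<close> (and the time
  derivative below) are required to be jointly continuous in time and space.\<close>

primrec Ck_space :: "nat \<Rightarrow> real \<Rightarrow> (real \<Rightarrow> 'a::euclidean_space \<Rightarrow> real) \<Rightarrow> bool" where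
  "Ck_space 0 T f \<longleftrightarrow> continuous_on ({-T..T} \<times> UNIV) (\<lambda>(t, z). f t z)"
| "Ck_space (Suc k) T f \<longleftrightarrow>
     continuous_on ({-T..T} \<times> UNIV) (\<lambda>(t, z). f t z) \<and>
     (\<forall>t\<in>{-T..T}. \<forall>z. f t differentiable (at z)) \<and>
     (\<forall>b\<in>Basis. Ck_space k T (\<lambda>t. partial b (f t)))"

definition C1_time :: "real \<Rightarrow> (real \<Rightarrow> 'a::euclidean_space \<Rightarrow> real) \<Rightarrow> bool" where
  "C1_time T f \<longleftrightarrow>
     (\<forall>t\<in>{-T..T}. \<forall>z. (\<lambda>s. f s z) differentiable (at t within {-T..T})) \<and>
     continuous_on ({-T..T} \<times> UNIV) (\<lambda>(t, z). time_deriv T f t z)"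

definition scrU :: "real \<Rightarrow> (real \<Rightarrow> 'a::euclidean_space \<Rightarrow> real) \<Rightarrow> real \<Rightarrow> 'a \<Rightarrow> real" where
  "scrU T U t z = 1/2 * (norm (grad (U t) z))\<^sup>2 - 1/2 * laplacian (U t) z - time_deriv T U t z"

definition admissible_potential :: "real \<Rightarrow> (real \<Rightarrow> 'a::euclidean_space \<Rightarrow> real) \<Rightarrow> bool" where
  "admissible_potential T U \<longleftrightarrow>
     Ck_space 4 T U \<and> C1_time T U \<and>
     filterlim (\<lambda>z. \<bar>U (-T) z\<bar>) at_top at_infinity \<and>
     filterlim (\<lambda>z. \<bar>U T z\<bar>) at_top at_infinity \<and>
     bdd_below ((\<lambda>(t, z). scrU T U t z) ` ({-T..T} \<times> UNIV))"

section \<open>Path space\<close>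

text \<open>The set \<open>C([-T,T]; \<real>\<^sup>d)\<close> (paths are \<^const>\<open>undefined\<close> off \<open>{-T..T}\<close>) with the \<open>\<sigma>\<close>-algebra generated
  by the evaluations, which is the Borel \<open>\<sigma>\<close>-algebra of uniform convergence. It is used only as a
  measurable space, i.e. for its \<^const>\<open>space\<close> and \<^const>\<open>sets\<close>. The set of probability measures on a
  measurable space \<open>M\<close> is \<^term>\<open>space (prob_algebra M)\<close>.\<close>

definition path_space :: "real \<Rightarrow> (real \<Rightarrow> 'a::euclidean_space) measure" where
  "path_space T = restrict_space (\<Pi>\<^sub>M t\<in>{-T..T}. borel) {\<omega>. continuous_on {-T..T} \<omega>}"

text \<open>Weak convergence of measures on path space. Uniform convergence is metrizable, so continuity of
  the test functionals can be expressed by sequences; their measurability follows from continuity.\<close>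

definition path_test_functional :: "real \<Rightarrow> ((real \<Rightarrow> 'a::euclidean_space) \<Rightarrow> real) \<Rightarrow> bool" where
  "path_test_functional T F \<longleftrightarrow>
     F \<in> borel_measurable (path_space T) \<and>
     bounded (F ` space (path_space T)) \<and>
     (\<forall>w \<omega>. (\<forall>n. w n \<in> space (path_space T)) \<and> \<omega> \<in> space (path_space T) \<and>
        uniform_limit {-T..T} w \<omega> sequentially \<longrightarrow> (\<lambda>n. F (w n)) \<longlonglongrightarrow> F \<omega>)"

definition weakly_converges ::
    "real \<Rightarrow> ('b \<Rightarrow> (real \<Rightarrow> 'a::euclidean_space) measure) \<Rightarrow> (real \<Rightarrow> 'a) measure \<Rightarrow> 'b filter \<Rightarrow> bool" where
  "weakly_converges T R R0 \<F> \<longleftrightarrow>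
     (\<forall>F. path_test_functional T F \<longrightarrow>
        ((\<lambda>e. \<integral>\<omega>. F \<omega> \<partial>R e) \<longlongrightarrow> (\<integral>\<omega>. F \<omega> \<partial>R0)) \<F>)"

section \<open>Langevin dynamics\<close>

definition brownian_motion ::
    "'w measure \<Rightarrow> real \<Rightarrow> ('w \<Rightarrow> real \<Rightarrow> 'a::euclidean_space) \<Rightarrow> bool" where
  "brownian_motion M T B \<longleftrightarrow>
     prob_space M \<and> B \<in> M \<rightarrow>\<^sub>M path_space T \<and>
     (AE w in M. B w (-T) = 0) \<and>
     (\<forall>s t. -T \<le> s \<and> s < t \<and> t \<le> T \<longrightarrow>
        distributed M lborel (\<lambda>w. B w t - B w s)
          (\<lambda>z. ennreal (\<Prod>b\<in>Basis. normal_density 0 (sqrt (t - s)) (z \<bullet> b)))) \<and>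
     (\<forall>(n::nat) \<tau>. (\<forall>i\<le>n. \<tau> i \<in> {-T..T}) \<and> (\<forall>i<n. \<tau> i < \<tau> (Suc i)) \<longrightarrow>
        prob_space.indep_vars M (\<lambda>_. borel) (\<lambda>i w. B w (\<tau> (Suc i)) - B w (\<tau> i)) {..<n})"

text \<open>The noise is additive, so the stochastic differential equation
  \<open>dX\<^sub>t = - \<nabla>U(t, X\<^sub>t) dt + dB\<^sub>t\<close> is, by definition, a pathwise integral equation.\<close>

definition langevin_solution ::
    "'w measure \<Rightarrow> real \<Rightarrow> (real \<Rightarrow> 'a::euclidean_space \<Rightarrow> real) \<Rightarrow> 'a measure \<Rightarrow>
     ('w \<Rightarrow> real \<Rightarrow> 'a) \<Rightarrow> ('w \<Rightarrow> real \<Rightarrow> 'a) \<Rightarrow> bool" where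
  "langevin_solution M T U \<mu> B X \<longleftrightarrow>
     brownian_motion M T B \<and> X \<in> M \<rightarrow>\<^sub>M path_space T \<and>
     distr M borel (\<lambda>w. X w (-T)) = \<mu> \<and>
     prob_space.indep_set M
       {(\<lambda>w. X w (-T)) -` A \<inter> space M | A. A \<in> sets borel}
       {B -` A \<inter> space M | A. A \<in> sets (path_space T)} \<and>
     (AE w in M. \<forall>t\<in>{-T..T}.
        X w t = X w (-T) - integral {-T..t} (\<lambda>s. grad (U s) (X w s)) + B w t)"

text \<open>\<open>P\<close> is the law \<open>P\<^sup>\<mu>\<close> of the solution with initial distribution \<open>\<mu>\<close>. The probability space may be taken
  over the type of paths: for a solution \<open>X\<close> on any probability space, its law, the canonical process and
  the Brownian motion recovered from the equation provide a solution on path space with the same law.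
  The law is unique since \<open>\<nabla>U\<close> is locally Lipschitz in space.\<close>

definition is_langevin_law ::
    "real \<Rightarrow> (real \<Rightarrow> 'a::euclidean_space \<Rightarrow> real) \<Rightarrow> 'a measure \<Rightarrow> (real \<Rightarrow> 'a) measure \<Rightarrow> bool" where
  "is_langevin_law T U \<mu> P \<longleftrightarrow>
     (\<exists>(M :: (real \<Rightarrow> 'a) measure) B X.
        langevin_solution M T U \<mu> B X \<and> P = distr M (path_space T) X)"

text \<open>The law \<open>P\<^sup>x\<close>.\<close>

definition langevin_from ::
    "real \<Rightarrow> (real \<Rightarrow> 'a::euclidean_space \<Rightarrow> real) \<Rightarrow> 'a \<Rightarrow> (real \<Rightarrow> 'a) measure" where
  "langevin_from T U x = (THE P. is_langevin_law T U (return borel x) P)"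

section \<open>Bridges and the reciprocal class\<close>

text \<open>The bridge \<open>P\<^sup>x\<^sup>,\<^sup>y\<close> is \<open>P\<^sup>x\<close> conditioned on \<open>{\<omega>\<^sub>T = y}\<close>. As this is a null event, the conditioning is
  the weak limit, as \<open>\<epsilon>\<close> decreases to 0, of conditioning on \<open>{\<bar>\<omega>\<^sub>T - y\<bar> < \<epsilon>}\<close>, which has positive
  probability. This fixes the measure for every \<open>y\<close> and not only almost every \<open>y\<close>.\<close>

definition bridge ::
    "real \<Rightarrow> (real \<Rightarrow> 'a::euclidean_space \<Rightarrow> real) \<Rightarrow> 'a \<Rightarrow> 'a \<Rightarrow> (real \<Rightarrow> 'a) measure" where
  "bridge T U x y = (THE R. R \<in> space (prob_algebra (path_space T)) \<and>
     weakly_converges T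
       (\<lambda>\<epsilon>. uniform_measure (langevin_from T U x) {\<omega> \<in> space (path_space T). dist (\<omega> T) y < \<epsilon>})
       R (at_right 0))"

text \<open>The measure \<open>P\<^sup>\<pi>\<close>.\<close>

definition bridge_mixture ::
    "real \<Rightarrow> (real \<Rightarrow> 'a::euclidean_space \<Rightarrow> real) \<Rightarrow> ('a \<times> 'a) measure \<Rightarrow> (real \<Rightarrow> 'a) measure" where
  "bridge_mixture T U \<pi> =
     measure_of (space (path_space T)) (sets (path_space T))
       (\<lambda>A. \<integral>\<^sup>+(x, y). emeasure (bridge T U x y)
              (A \<inter> {\<omega> \<in> space (path_space T). \<omega> (-T) = x \<and> \<omega> T = y}) \<partial>\<pi>)"

definition reciprocal_class ::
    "real \<Rightarrow> (real \<Rightarrow> 'a::euclidean_space \<Rightarrow> real) \<Rightarrow> (real \<Rightarrow> 'a) measure set" where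
  "reciprocal_class T U =
     {Q \<in> space (prob_algebra (path_space T)).
        \<exists>\<pi> \<in> space (prob_algebra (borel :: ('a \<times> 'a) measure)). Q = bridge_mixture T U \<pi>}"

section \<open>The minimization problem\<close>

definition strictly_convex :: "(real \<Rightarrow> real) \<Rightarrow> bool" where
  "strictly_convex c \<longleftrightarrow>
     (\<forall>x y u. x \<noteq> y \<and> 0 < u \<and> u < 1 \<longrightarrow>
        c ((1 - u) * x + u * y) < (1 - u) * c x + u * c y)"

text \<open>\<^term>\<open>absolutely_continuous P Q\<close> means \<open>Q \<lless> P\<close>, and \<^term>\<open>RN_deriv P Q\<close> is \<open>dQ/dP\<close>.\<close>

definition cost :: "(real \<Rightarrow> real) \<Rightarrow> 'w measure \<Rightarrow> 'w measure \<Rightarrow> ennreal" where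
  "cost c Q P =
     (if absolutely_continuous P Q
      then \<integral>\<^sup>+\<omega>. ennreal (c (enn2real (RN_deriv P Q \<omega>))) \<partial>P
      else \<infinity>)"

definition feasible ::
    "real \<Rightarrow> 'a::euclidean_space measure \<Rightarrow> 'a measure \<Rightarrow> (real \<Rightarrow> 'a) measure set" where
  "feasible T \<mu> \<nu> =
     {Q \<in> space (prob_algebra (path_space T)).
        distr Q borel (\<lambda>\<omega>. \<omega> (-T)) = \<mu> \<and> distr Q borel (\<lambda>\<omega>. \<omega> T) = \<nu>}"

text \<open>As is customary in minimization with extended-valued costs, a solution has finite cost: if the
  cost is infinite on the whole feasible set, the problem has no solution.\<close>

definition is_solution ::
    "real \<Rightarrow> (real \<Rightarrow> real) \<Rightarrow> 'a::euclidean_space measure \<Rightarrow> 'a measure \<Rightarrow>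
     (real \<Rightarrow> 'a) measure \<Rightarrow> (real \<Rightarrow> 'a) measure \<Rightarrow> bool" where
  "is_solution T c \<mu> \<nu> P Q \<longleftrightarrow>
     Q \<in> feasible T \<mu> \<nu> \<and> cost c Q P < \<infinity> \<and> (\<forall>Q'\<in>feasible T \<mu> \<nu>. cost c Q P \<le> cost c Q' P)"

end

theory Submission
  imports Defs
begin

text \<open>
  A finite cost forces \<open>Q \<lless> P\<close>. Let \<open>e \<omega> = (\<omega> (-T), \<omega> T)\<close> and let \<open>\<kappa>\<close> be a regular conditional
  probability of \<open>P\<close> given \<open>e\<close>. Replacing \<open>dQ/dP\<close> by its conditional expectation given \<open>e\<close> keeps both
  marginals and, by Jensen's inequality, does not increase the cost; strict convexity then forces \<open>dQ/dP\<close> to be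
  a function of \<open>e\<close>, so that \<open>Q\<close> is the mixture of the kernels \<open>\<kappa> (x, y)\<close> under its own end point law.

  It remains to see that \<open>\<kappa> (x, y)\<close> is the bridge, and since \<open>Q \<lless> P\<close> this is only needed for almost
  every \<open>(x, y)\<close>. For almost every \<open>x\<close> the conditional law of \<open>P\<close> given \<open>\<omega> (-T) = x\<close> solves the equation
  started at \<open>x\<close>, hence equals \<open>P\<^sup>x\<close> by pathwise uniqueness and the Yamada-Watanabe argument. For fixed
  \<open>x\<close> the differentiation theorem for arbitrary finite measures (a Besicovitch-type maximal inequality)
  shows that, for almost every \<open>y\<close>, conditioning \<open>P\<^sup>x\<close> on \<open>dist (\<omega> T) y < \<epsilon>\<close> converges to
  \<open>\<kappa> (x, y)\<close> on a countable family of events that determines weak convergence. No transition densities are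
  involved.
\<close>

section \<open>Disintegration\<close>

text \<open>The bridge is a limit over shrinking balls around the end point, under the law started
  at one fixed point, whereas \<kappa> conditions \<open>P\<close> on both end points at once. The
  two are joined by conditioning twice: given the start, the tower property exhibits
  \<open>\<kappa> (x, y)\<close> as a density, in \<open>y\<close>, of the very measures that the
  limit differentiates. The end point law being differentiated is treated as an arbitrary finite
  Borel measure, possibly without any doubling property, so Vitali-type coverings do not apply and
  the bounded overlap of separated balls takes their place. All exceptional sets have to be null
  simultaneously; this is why every limiting statement is tested on countable data: rational levels,
  rational times, rational radii, a countable family of events. In the minimization the equality
  case of Jensen's inequality is never analysed: the competitor is the midpoint of
  \<open>dQ/dP\<close> and its conditional expectation, so strict convexity is used at midpoints
  only.\<close>

lemma AE_le_if_set_integrals_le: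
  assumes [measurable]: "f \<in> borel_measurable M" "g \<in> borel_measurable M"
    and fin: "(\<integral>\<^sup>+x. g x \<partial>M) < \<infinity>"
    and le: "\<And>C. C \<in> sets M \<Longrightarrow> (\<integral>\<^sup>+x. f x * indicator C x \<partial>M) \<le> (\<integral>\<^sup>+x. g x * indicator C x \<partial>M)"
  shows "AE x in M. f x \<le> (g x :: ennreal)"
proof -
  define C where "C = {x\<in>space M. g x < f x}"
  have [measurable]: "C \<in> sets M" unfolding C_def by measurable
  have gC: "(\<integral>\<^sup>+x. g x * indicator C x \<partial>M) < \<infinity>"
    by (rule le_less_trans[OF _ fin]) (auto intro!: nn_integral_mono simp: indicator_def)
  have "(\<integral>\<^sup>+x. f x * indicator C x - g x * indicator C x \<partial>M)
      = (\<integral>\<^sup>+x. f x * indicator C x \<partial>M) - (\<integral>\<^sup>+x. g x * indicator C x \<partial>M)"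
    using gC by (intro nn_integral_diff) (auto simp: C_def indicator_def)
  also have "\<dots> = 0"
    using le[of C] gC by (simp add: diff_eq_0_iff_ennreal)
  finally have "AE x in M. f x * indicator C x - g x * indicator C x = 0"
    by (subst (asm) nn_integral_0_iff_AE) auto
  moreover have "AE x in M. g x < \<infinity>"
    using nn_integral_PInf_AE[of g M] fin by (auto simp: less_top)
  ultimately show ?thesis
    using AE_space
  proof eventually_elim
    case (elim x)
    then show ?case
      by (cases "x \<in> C") (auto simp: C_def not_less diff_eq_0_iff_ennreal)
  qed
qed

text \<open>The classical construction of a regular conditional distribution: conditional
  distribution functions at single levels are Radon-Nikodym derivatives, countably many almost sure
  relations make them monotone and normalized at all rational levels at once, and right limits turn
  them into a distribution function. Values in [0,1] make the behaviour at both infinities explicit: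
  0 below 0, and 1 from 1 on.\<close>

lemma conditional_cdf_kernel:
  fixes X :: "'w \<Rightarrow> real"
  assumes "prob_space P" and f[measurable]: "f \<in> P \<rightarrow>\<^sub>M S"
    and X[measurable]: "X \<in> borel_measurable P" and X01: "\<And>w. w \<in> space P \<Longrightarrow> 0 \<le> X w \<and> X w \<le> 1"
  obtains k where "k \<in> S \<rightarrow>\<^sub>M prob_algebra borel"
    "\<And>x C. C \<in> sets S \<Longrightarrow> emeasure P {w\<in>space P. X w \<le> x \<and> f w \<in> C}
       = (\<integral>\<^sup>+s. emeasure (k s) {..x} * indicator C s \<partial>distr P S f)"
proof -
  interpret P: prob_space P by fact
  define D where "D = distr P S f"
  interpret D: prob_space D unfolding D_def by (rule P.prob_space_distr) fact
  have sD[measurable_cong]: "sets D = sets S" by (simp add: D_def)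
  have spD: "space D = space S" by (simp add: D_def)
  define Dq where "Dq q = distr (density P (indicator {w\<in>space P. X w \<le> q})) S f" for q
  have eDq: "emeasure (Dq q) C = emeasure P {w\<in>space P. X w \<le> q \<and> f w \<in> C}" if C[measurable]: "C \<in> sets S" for q C
  proof -
    have "emeasure (Dq q) C = (\<integral>\<^sup>+ w. indicator {w\<in>space P. X w \<le> q} w * indicator (f -` C \<inter> space P) w \<partial>P)"
      unfolding Dq_def by (subst emeasure_distr) (auto simp: emeasure_density)
    also have "\<dots> = (\<integral>\<^sup>+ w. indicator {w\<in>space P. X w \<le> q \<and> f w \<in> C} w \<partial>P)"
      by (intro nn_integral_cong) (auto simp: indicator_def)
    finally show ?thesis by simp
  qed
  have sDq: "sets (Dq q) = sets D" for q by (simp add: Dq_def D_def)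
  have ac: "absolutely_continuous D (Dq q)" for q
    unfolding absolutely_continuous_def
  proof
    fix N assume N: "N \<in> null_sets D"
    then have NS[measurable]: "N \<in> sets S" and "emeasure P (f -` N \<inter> space P) = 0"
      by (auto simp: null_sets_def D_def emeasure_distr)
    moreover have "emeasure (Dq q) N \<le> emeasure P (f -` N \<inter> space P)"
      by (subst eDq[OF NS], rule emeasure_mono) auto
    ultimately show "N \<in> null_sets (Dq q)" by (auto simp: null_sets_def sDq sD)
  qed
  \<comment> \<open>\<open>G q\<close> is a version of the conditional probability of
    \<open>X \<le> q\<close> given \<open>f\<close>; different levels have unrelated null
    sets.\<close>
  define G where "G q = RN_deriv D (Dq q)" for q
  have G[measurable]: "G q \<in> borel_measurable S" for q
    unfolding G_def by (subst measurable_cong_sets[OF sD[symmetric] refl]) simp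
  have iG: "(\<integral>\<^sup>+s. G q s * indicator C s \<partial>D) = emeasure P {w\<in>space P. X w \<le> q \<and> f w \<in> C}"
    if [measurable]: "C \<in> sets S" for q C
  proof -
    have "emeasure (density D (G q)) C = emeasure (Dq q) C"
      unfolding G_def using D.density_RN_deriv[OF ac sDq] by simp
    then show ?thesis by (simp add: emeasure_density eDq)
  qed
  have iD: "(\<integral>\<^sup>+s. indicator C s \<partial>D) = emeasure P {w\<in>space P. f w \<in> C}" if [measurable]: "C \<in> sets S" for C
    by (auto simp: D_def emeasure_distr intro!: arg_cong[where f="emeasure P"])
  have Gfin: "(\<integral>\<^sup>+s. G q s \<partial>D) < \<infinity>" for q
  proof -
    have "(\<integral>\<^sup>+s. G q s \<partial>D) = (\<integral>\<^sup>+s. G q s * indicator (space S) s \<partial>D)"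
      by (intro nn_integral_cong) (auto simp: spD)
    then show ?thesis by (simp add: iG less_top[symmetric])
  qed
  have mono: "AE s in D. G p s \<le> G q s" if "p \<le> q" for p q
    using that by (intro AE_le_if_set_integrals_le Gfin) (auto simp: iG sD intro!: emeasure_mono)
  have G0: "AE s in D. G q s \<le> 0" if "q < 0" for q
  proof (intro AE_le_if_set_integrals_le)
    fix C assume "C \<in> sets D"
    then have [measurable]: "C \<in> sets S" by (simp add: sD)
    have "{w\<in>space P. X w \<le> q \<and> f w \<in> C} = {}"
      using X01 that by fastforce
    then show "(\<integral>\<^sup>+s. G q s * indicator C s \<partial>D) \<le> (\<integral>\<^sup>+s. 0 * indicator C s \<partial>D)"
      using iG[of C q] by (simp only: emeasure_empty \<open>C \<in> sets S\<close>) simp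
  qed auto
  have eq1: "{w\<in>space P. X w \<le> q \<and> f w \<in> C} = {w\<in>space P. f w \<in> C}" if "1 \<le> q" for q C
    using X01 that by fastforce
  have G1: "AE s in D. G q s \<le> 1" if "1 \<le> q" for q
    using that by (intro AE_le_if_set_integrals_le) (auto simp: iG iD[symmetric] sD eq1 D.emeasure_space_1)
  have G1': "AE s in D. 1 \<le> G q s" if "1 \<le> q" for q
    using that by (intro AE_le_if_set_integrals_le Gfin) (auto simp: iG iD[symmetric] sD eq1)
  \<comment> \<open>Restricting the relations to rational levels leaves a countable conjunction, so
    \<open>good\<close> is measurable and holds almost everywhere.\<close>
  define good where "good s \<longleftrightarrow> (\<forall>p\<in>\<rat>. \<forall>q\<in>\<rat>. p \<le> q \<longrightarrow> G p s \<le> G q s) \<and>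
    (\<forall>q\<in>\<rat>. q < 0 \<longrightarrow> G q s = 0) \<and> (\<forall>q\<in>\<rat>. 1 \<le> q \<longrightarrow> G q s = 1)" for s
  have cQ: "countable (\<rat> :: real set)" by (rule countable_rat)
  have [measurable]: "Measurable.pred S good"
    unfolding good_def using cQ by (intro pred_intros_logic pred_intros_countable_bounded) measurable
  have AEgood: "AE s in D. good s"
    unfolding good_def AE_conj_iff
  proof (intro conjI)
    show "AE s in D. \<forall>p\<in>\<rat>. \<forall>q\<in>\<rat>. p \<le> q \<longrightarrow> G p s \<le> G q s"
      unfolding AE_ball_countable[OF cQ]     proof (intro ballI)
      fix p q :: real
      show "AE s in D. p \<le> q \<longrightarrow> G p s \<le> G q s"
        using mono[of p q] by (cases "p \<le> q") auto
    qed
    show "AE s in D. \<forall>q\<in>\<rat>. q < 0 \<longrightarrow> G q s = 0"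
      unfolding AE_ball_countable[OF cQ]
    proof
      fix q :: real
      show "AE s in D. q < 0 \<longrightarrow> G q s = 0"
        using G0[of q] by (cases "q < 0") auto
    qed
    show "AE s in D. \<forall>q\<in>\<rat>. 1 \<le> q \<longrightarrow> G q s = 1"
      unfolding AE_ball_countable[OF cQ]
    proof
      fix q :: real
      show "AE s in D. 1 \<le> q \<longrightarrow> G q s = 1"
        using G1[of q] G1'[of q] by (cases "1 \<le> q") (auto elim: AE_mp)
    qed
  qed
  \<comment> \<open>The strict inequality \<open>x < q\<close> builds in right continuity.\<close>
  define Fe where "Fe s x = (INF q\<in>{q\<in>\<rat>. x < q}. G q s)" for s x
  have Fe[measurable]: "(\<lambda>s. Fe s x) \<in> borel_measurable S" for x
    unfolding Fe_def by (intro borel_measurable_INF countable_subset[OF _ cQ]) auto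
  \<comment> \<open>Outside \<open>good\<close> the default is the distribution function of the
    point mass at 0, so that \<open>k s\<close> is a probability measure for every
    \<open>s\<close>.\<close>
  define F where "F s x = (if good s then enn2real (Fe s x) else of_bool (0 \<le> x))" for s x
  have F[measurable]: "(\<lambda>s. F s x) \<in> borel_measurable S" for x
    unfolding F_def by measurable
  have Fe_mono: "Fe s x \<le> Fe s y" if "x \<le> y" for s x y
    unfolding Fe_def using that by (intro INF_superset_mono) auto
  have Fe_neg: "Fe s x = 0" if s: "good s" and x: "x < 0" for s x
  proof -
    obtain q where "q \<in> \<rat>" "x < q" "q < 0" using Rats_dense_in_real[OF x] by blast
    then have "Fe s x \<le> 0" unfolding Fe_def using s
      by (intro INF_lower2[of q]) (auto simp: good_def)
    then show ?thesis by simp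
  qed
  have Fe_one: "Fe s x = 1" if s: "good s" and x: "1 \<le> x" for s x
  proof -
    obtain q where "q \<in> \<rat>" "x < q" using Rats_dense_in_real[of x "x+1"] by auto
    then have "Fe s x = (INF q\<in>{q\<in>\<rat>. x < q}. 1)" unfolding Fe_def using s x
      by (intro INF_cong) (auto simp: good_def)
    then show ?thesis using \<open>q \<in> \<rat>\<close> \<open>x < q\<close> by (subst (asm) INF_const) auto
  qed
  have Fe_le: "Fe s x \<le> 1" if "good s" for s x
    using Fe_mono[of x "max x 1" s] Fe_one[OF that, of "max x 1"] by auto
  have enF: "ennreal (F s x) = Fe s x" if "good s" for s x
    using Fe_le[OF that, of x] that by (simp add: F_def le_less_trans[OF _ ennreal_one_less_top])
  have Fmono: "F s x \<le> F s y" if "x \<le> y" for s x y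
    using that Fe_mono[OF that, of s] Fe_le[of s y]
    by (auto simp: F_def intro!: enn2real_mono le_less_trans[OF _ ennreal_one_less_top])
  have Fcont: "continuous (at_right a) (F s)" for a s
  proof (subst continuous_at_right_real_increasing)
    show "\<forall>e>0. \<exists>d>0. F s (a + d) - F s a < e"
    proof (intro allI impI)
      fix e :: real assume e: "0 < e"
      show "\<exists>d>0. F s (a + d) - F s a < e"
      proof (cases "good s")
        case True
        have "Fe s a < ennreal (F s a + e)"
          unfolding enF[OF True, symmetric] using e True by (subst ennreal_less_iff) (auto simp: F_def)
        then obtain q where q: "q \<in> \<rat>" "a < q" "G q s < ennreal (F s a + e)"
          unfolding Fe_def by (auto simp: INF_less_iff)
        have "Fe s ((a+q)/2) \<le> G q s" unfolding Fe_def using q by (intro INF_lower) auto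
        then have "ennreal (F s ((a+q)/2)) < ennreal (F s a + e)" using q by (simp add: enF True)
        then have "F s ((a+q)/2) < F s a + e"
          using e True by (subst (asm) ennreal_less_iff) (auto simp: F_def)
        moreover have "a + (q - a)/2 = (a+q)/2" by (simp add: field_simps)
        ultimately have "F s (a + (q - a)/2) - F s a < e" by (simp only: diff_less_eq add.commute)
        then show ?thesis using q by (intro exI[of _ "(q - a)/2"]) auto
      next
        case False
        \<comment> \<open>To the right of a negative \<open>a\<close>, a step of size
          \<open>-a/2\<close> stays negative, where the default function is still 0.\<close>
        then show ?thesis using e
          by (intro exI[of _ "if a < 0 then -a/2 else 1"]) (auto simp: F_def)
      qed
    qed
  qed (rule Fmono)
  have Fbot: "(F s \<longlongrightarrow> 0) at_bot" for s
    by (rule tendsto_eventually)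
      (auto simp: eventually_at_bot_linorder F_def Fe_neg intro!: exI[of _ "-1"])
  have Ftop: "(F s \<longlongrightarrow> 1) at_top" for s
    by (rule tendsto_eventually)
      (auto simp: eventually_at_top_linorder F_def Fe_one intro!: exI[of _ 1])
  define k where "k s = interval_measure (F s)" for s
  have k_rd: "real_distribution (k s)" for s
    unfolding k_def by (intro real_distribution_interval_measure Fmono Fcont Fbot Ftop)
  have ek: "emeasure (k s) {..x} = ennreal (F s x)" for s x
    unfolding k_def by (intro emeasure_interval_measure_Iic Fmono Fcont Fbot)
  show ?thesis
  proof
    have gen: "sets (borel::real measure) = sigma_sets UNIV (range (\<lambda>x. {..x}))"
      by (subst borel_eq_atMost) (simp add: sets_measure_of)
    show "k \<in> S \<rightarrow>\<^sub>M prob_algebra borel"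
    proof (rule measurable_prob_algebra_generated[OF gen])
      show "Int_stable (range (\<lambda>x::real. {..x}))" by (auto simp: Int_stable_def)
      show "prob_space (k s)" "sets (k s) = sets borel" for s
        using k_rd[of s] by (auto simp: real_distribution_def real_distribution_axioms_def)
      show "(\<lambda>a. emeasure (k a) A) \<in> borel_measurable S" if "A \<in> range (\<lambda>x. {..x})" for A
        using that by (auto simp: ek)
    qed auto
    fix x C assume C[measurable]: "C \<in> sets S"
    have eqF: "(\<integral>\<^sup>+s. emeasure (k s) {..x} * indicator C s \<partial>distr P S f) = (\<integral>\<^sup>+s. Fe s x * indicator C s \<partial>D)"
      unfolding D_def[symmetric] using AEgood by (intro nn_integral_cong_AE) (auto simp: ek enF)
    \<comment> \<open>The regularization does not change the conditional probability: monotonicity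
      gives one inequality; rational levels \<open>q n\<close> within \<open>1/Suc n\<close> above
      \<open>x\<close>, with continuity of \<open>P\<close> from above, give the other.\<close>
    have "AE s in D. \<forall>q\<in>{q\<in>\<rat>. x < q}. G x s \<le> G q s"
      by (subst AE_ball_countable) (auto intro!: mono countable_subset[OF _ cQ])
    then have "AE s in D. G x s \<le> Fe s x"
      by eventually_elim (auto simp: Fe_def intro!: INF_greatest)
    then have "(\<integral>\<^sup>+s. G x s * indicator C s \<partial>D) \<le> (\<integral>\<^sup>+s. Fe s x * indicator C s \<partial>D)"
      by (intro nn_integral_mono_AE) (auto simp: mult_right_mono)
    then have ge: "emeasure P {w\<in>space P. X w \<le> x \<and> f w \<in> C} \<le> (\<integral>\<^sup>+s. Fe s x * indicator C s \<partial>D)"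
      by (simp add: iG)
    have "\<forall>n. \<exists>q\<in>\<rat>. x < q \<and> q < x + 1/Suc n"
      using Rats_dense_in_real[of x] by (auto simp del: of_nat_Suc)
    then obtain q :: "nat \<Rightarrow> real" where q: "\<And>n. q n \<in> \<rat>" "\<And>n. x < q n" "\<And>n. q n < x + 1/Suc n"
      by metis
    have "(\<lambda>n. emeasure P {w\<in>space P. X w \<le> x + 1/Suc n \<and> f w \<in> C}) \<longlonglongrightarrow>
        emeasure P (\<Inter>n. {w\<in>space P. X w \<le> x + 1/Suc n \<and> f w \<in> C})"
    proof (rule Lim_emeasure_decseq)
      show "decseq (\<lambda>n. {w\<in>space P. X w \<le> x + 1/Suc n \<and> f w \<in> C})"
      proof (rule decseq_SucI, rule subsetI)
        fix n w assume w: "w \<in> {w\<in>space P. X w \<le> x + 1/Suc (Suc n) \<and> f w \<in> C}"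
        have "1 / real (Suc (Suc n)) \<le> 1 / real (Suc n)" by (intro divide_left_mono) auto
        then show "w \<in> {w\<in>space P. X w \<le> x + 1/Suc n \<and> f w \<in> C}" using w by simp
      qed
    qed auto
    also have "(\<Inter>n. {w\<in>space P. X w \<le> x + 1/Suc n \<and> f w \<in> C}) = {w\<in>space P. X w \<le> x \<and> f w \<in> C}"
    proof -
      have "a \<le> x" if "\<And>n. a \<le> x + 1/Suc n" for a :: real
        by (rule LIMSEQ_le_const[OF LIMSEQ_inverse_real_of_nat_add[of x]])
          (use that in \<open>auto simp: inverse_eq_divide\<close>)
      moreover have "a \<le> x + 1/Suc n" if "a \<le> x" for a n
        by (rule order_trans[OF that]) simp
      ultimately show ?thesis by auto
    qed
    finally have lim: "(\<lambda>n. emeasure P {w\<in>space P. X w \<le> x + 1/Suc n \<and> f w \<in> C}) \<longlonglongrightarrow>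
        emeasure P {w\<in>space P. X w \<le> x \<and> f w \<in> C}" .
    have "(\<integral>\<^sup>+s. Fe s x * indicator C s \<partial>D) \<le> emeasure P {w\<in>space P. X w \<le> x + 1/Suc n \<and> f w \<in> C}" for n
    proof -
      have "(\<integral>\<^sup>+s. Fe s x * indicator C s \<partial>D) \<le> (\<integral>\<^sup>+s. G (q n) s * indicator C s \<partial>D)"
        using q by (intro nn_integral_mono mult_right_mono) (auto simp: Fe_def intro!: INF_lower)
      also have "\<dots> = emeasure P {w\<in>space P. X w \<le> q n \<and> f w \<in> C}" by (simp add: iG)
      also have "\<dots> \<le> emeasure P {w\<in>space P. X w \<le> x + 1/Suc n \<and> f w \<in> C}"
        using q(3)[of n] by (intro emeasure_mono) auto
      finally show ?thesis .
    qed
    then have "(\<integral>\<^sup>+s. Fe s x * indicator C s \<partial>D) \<le> emeasure P {w\<in>space P. X w \<le> x \<and> f w \<in> C}"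
      by (intro LIMSEQ_le_const[OF lim]) auto
    with ge show "emeasure P {w\<in>space P. X w \<le> x \<and> f w \<in> C}
       = (\<integral>\<^sup>+s. emeasure (k s) {..x} * indicator C s \<partial>distr P S f)"
      by (simp add: eqF)
  qed
qed

text \<open>The form in which standard Borel spaces are used.\<close>

definition retract_of_unit_interval :: "'w measure \<Rightarrow> bool" where
  "retract_of_unit_interval M \<longleftrightarrow> (\<exists>c\<in>M \<rightarrow>\<^sub>M (borel :: real measure). \<exists>d\<in>borel \<rightarrow>\<^sub>M M.
     \<forall>w\<in>space M. d (c w) = w \<and> 0 \<le> c w \<and> c w \<le> 1)"

text \<open>The identity is imposed on rectangles, while \<open>k\<close> takes probability measures
  as values at every point. That \<open>k s\<close> sits on the fibre of \<open>f\<close> over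
  \<open>s\<close> is a consequence, obtained from \<open>disintegration_AE\<close> once the graph
  of \<open>f\<close> is measurable.\<close>

definition disintegration :: "'w measure \<Rightarrow> ('w \<Rightarrow> 's) \<Rightarrow> 's measure \<Rightarrow> ('s \<Rightarrow> 'w measure) \<Rightarrow> bool" where
  "disintegration P f S k \<longleftrightarrow> k \<in> S \<rightarrow>\<^sub>M prob_algebra P \<and>
     (\<forall>A\<in>sets P. \<forall>C\<in>sets S. emeasure P {w\<in>space P. w \<in> A \<and> f w \<in> C}
        = (\<integral>\<^sup>+s. emeasure (k s) A * indicator C s \<partial>distr P S f))"

text \<open>With \<open>C\<close> fixed, both sides are finite measures in \<open>A\<close>, so
  agreement on an intersection-stable generator suffices; \<open>space N \<in> E\<close> supplies
  the total mass. The map \<open>X\<close> lets the argument run for the real code of a point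
  instead of the point itself.\<close>

lemma kernel_nn_integral_eqI:
  assumes P: "prob_space P" and f[measurable]: "f \<in> P \<rightarrow>\<^sub>M S" and X[measurable]: "X \<in> P \<rightarrow>\<^sub>M N"
    and k[measurable]: "k \<in> S \<rightarrow>\<^sub>M prob_algebra N"
    and gen: "sets N = sigma_sets (space N) E" "Int_stable E" "E \<subseteq> Pow (space N)" "space N \<in> E"
    and eq: "\<And>A. A \<in> E \<Longrightarrow> emeasure P {w\<in>space P. X w \<in> A \<and> f w \<in> C}
        = (\<integral>\<^sup>+s. emeasure (k s) A * indicator C s \<partial>distr P S f)"
    and C[measurable]: "C \<in> sets S" and A: "A \<in> sets N"
  shows "emeasure P {w\<in>space P. X w \<in> A \<and> f w \<in> C}
        = (\<integral>\<^sup>+s. emeasure (k s) A * indicator C s \<partial>distr P S f)"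
proof -
  interpret P: prob_space P by fact
  define D where "D = distr P S f"
  have sD[measurable_cong]: "sets D = sets S" by (simp add: D_def)
  have spD: "space D = space S" by (simp add: D_def)
  define N1 where "N1 = distr (density P (indicator {w\<in>space P. f w \<in> C})) N X"
  define N2 where "N2 = density D (indicator C) \<bind> k"
  have ne: "space D \<noteq> {}" unfolding spD using P.not_empty measurable_space[OF f] by auto
  have k': "k \<in> density D (indicator C) \<rightarrow>\<^sub>M subprob_algebra N"
    using measurable_prob_algebraD[OF k] by (simp cong: measurable_cong_sets add: sD)
  have N1: "emeasure N1 A = emeasure P {w\<in>space P. X w \<in> A \<and> f w \<in> C}" if [measurable]: "A \<in> sets N" for A
  proof -
    have "emeasure N1 A = (\<integral>\<^sup>+w. indicator {w\<in>space P. f w \<in> C} w * indicator (X -` A \<inter> space P) w \<partial>P)"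
      unfolding N1_def by (subst emeasure_distr) (auto simp: emeasure_density)
    also have "\<dots> = (\<integral>\<^sup>+w. indicator {w\<in>space P. X w \<in> A \<and> f w \<in> C} w \<partial>P)"
      by (intro nn_integral_cong) (auto simp: indicator_def)
    finally show ?thesis by simp
  qed
  have N2: "emeasure N2 A = (\<integral>\<^sup>+s. emeasure (k s) A * indicator C s \<partial>D)" if A[measurable]: "A \<in> sets N" for A
  proof -
    have [measurable]: "(\<lambda>s. emeasure (k s) A) \<in> borel_measurable S"
      using measurable_emeasure_kernel[OF measurable_prob_algebraD[OF k] A] .
    have "emeasure N2 A = (\<integral>\<^sup>+s. emeasure (k s) A \<partial>density D (indicator C))"
      unfolding N2_def by (rule emeasure_bind[OF _ k' A]) (simp add: ne)
    then show ?thesis by (simp add: nn_integral_density mult.commute)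
  qed
  have "N1 = N2"
  proof (rule measure_eqI_generator_eq[OF gen(2,3), where A="\<lambda>_. space N"])
    show "sets N2 = sigma_sets (space N) E"
      unfolding N2_def by (subst sets_bind[OF sets_kernel[OF k']]) (auto simp: gen(1)[symmetric] ne)
    show "emeasure N1 A = emeasure N2 A" if "A \<in> E" for A
    proof -
      have "A \<in> sets N" using that by (simp add: gen)
      then show ?thesis using eq[OF that] by (simp add: N1 N2 D_def)
    qed
    show "emeasure N1 (space N) \<noteq> \<infinity>" by (simp add: N1)
  qed (auto simp: N1_def gen)
  then show ?thesis using N1[OF A] N2[OF A] by (simp add: D_def)
qed

lemma sets_borel_eq_sigma_atMost: "sets (borel :: real measure) = sigma_sets UNIV (insert UNIV (range (\<lambda>x. {..x})))"
proof -
  have "sets (borel :: real measure) = sigma_sets UNIV (range (\<lambda>x. {..x}))"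
    by (subst borel_eq_atMost) (simp add: sets_measure_of)
  also have "\<dots> = sigma_sets UNIV (insert UNIV (range (\<lambda>x. {..x})))"
    by (intro sigma_sets_eqI) (auto intro: sigma_sets_top)
  finally show ?thesis .
qed

text \<open>The conditional law is formed for the real code \<open>c\<close> and pushed back by the
  retraction \<open>d\<close>. As \<open>d\<close> maps the whole real line into \<open>M\<close>,
  the result is a probability kernel even where the kernel of the codes charges reals that code
  nothing.\<close>

theorem exists_disintegration:
  assumes M: "retract_of_unit_interval M" and P: "P \<in> space (prob_algebra M)" and f: "f \<in> M \<rightarrow>\<^sub>M S"
  obtains k where "disintegration P f S k"
proof -
  obtain c d where c[measurable]: "c \<in> M \<rightarrow>\<^sub>M (borel :: real measure)" and d[measurable]: "d \<in> borel \<rightarrow>\<^sub>M M"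
    and dc: "\<And>w. w \<in> space M \<Longrightarrow> d (c w) = w \<and> 0 \<le> c w \<and> c w \<le> 1"
    using M unfolding retract_of_unit_interval_def by auto
  interpret P: prob_space P using P by (simp add: space_prob_algebra)
  have sP[measurable_cong]: "sets P = sets M" using P by (simp add: space_prob_algebra)
  have spP: "space P = space M" by (rule sets_eq_imp_space_eq[OF sP])
  have f'[measurable]: "f \<in> P \<rightarrow>\<^sub>M S" using f by (simp cong: measurable_cong_sets add: sP)
  have c': "c \<in> P \<rightarrow>\<^sub>M borel" by measurable
  obtain k0 where k0[measurable]: "k0 \<in> S \<rightarrow>\<^sub>M prob_algebra (borel :: real measure)"
    and k0eq: "\<And>x C. C \<in> sets S \<Longrightarrow> emeasure P {w\<in>space P. c w \<le> x \<and> f w \<in> C}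
       = (\<integral>\<^sup>+s. emeasure (k0 s) {..x} * indicator C s \<partial>distr P S f)"
    using conditional_cdf_kernel[OF P.prob_space_axioms f' c'] dc[folded spP] by blast
  have k0p: "prob_space (k0 s)" "sets (k0 s) = sets borel" if "s \<in> space S" for s
    using measurable_space[OF k0 that] by (auto simp: space_prob_algebra)
  have eq: "emeasure P {w\<in>space P. c w \<in> A \<and> f w \<in> C}
        = (\<integral>\<^sup>+s. emeasure (k0 s) A * indicator C s \<partial>distr P S f)"
    if C[measurable]: "C \<in> sets S" and A: "A \<in> sets borel" for A C
  proof (rule kernel_nn_integral_eqI[OF P.prob_space_axioms f' c' k0 _ _ _ _ _ C A])
    show "sets (borel :: real measure) = sigma_sets (space borel) (insert UNIV (range (\<lambda>x. {..x})))"
      using sets_borel_eq_sigma_atMost by simp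
    show "Int_stable (insert UNIV (range (\<lambda>x::real. {..x})))" by (auto simp: Int_stable_def)
    fix A assume "A \<in> insert UNIV (range (\<lambda>x::real. {..x}))"
    then consider "A = UNIV" | x where "A = {..x}" by auto
    then show "emeasure P {w\<in>space P. c w \<in> A \<and> f w \<in> C}
        = (\<integral>\<^sup>+s. emeasure (k0 s) A * indicator C s \<partial>distr P S f)"
    proof cases
      case 1
      have "(\<integral>\<^sup>+s. emeasure (k0 s) UNIV * indicator C s \<partial>distr P S f) = (\<integral>\<^sup>+s. indicator C s \<partial>distr P S f)"
        using prob_space.emeasure_space_1[OF k0p(1)] sets_eq_imp_space_eq[OF k0p(2)]
        by (intro nn_integral_cong) simp
      also have "\<dots> = emeasure P {w\<in>space P. f w \<in> C}"
        by (auto simp: emeasure_distr intro!: arg_cong[where f="emeasure P"])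
      finally show ?thesis by (simp add: 1)
    next
      case 2
      then show ?thesis using k0eq[OF C] by simp
    qed
  qed auto
  have "disintegration P f S (\<lambda>s. distr (k0 s) M d)"
    unfolding disintegration_def
  proof (intro conjI ballI)
    show "(\<lambda>s. distr (k0 s) M d) \<in> S \<rightarrow>\<^sub>M prob_algebra P"
    proof -
      have "prob_algebra P = prob_algebra M"
        by (simp add: prob_algebra_def subprob_algebra_cong[OF sP])
      then show ?thesis by simp
    qed
    fix A C assume [measurable]: "A \<in> sets P" and C[measurable]: "C \<in> sets S"
    have A[measurable]: "A \<in> sets M" using \<open>A \<in> sets P\<close> sP by simp
    have "{w\<in>space P. w \<in> A \<and> f w \<in> C} = {w\<in>space P. c w \<in> d -` A \<and> f w \<in> C}"
      using dc spP by auto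
    also have "emeasure P \<dots> = (\<integral>\<^sup>+s. emeasure (k0 s) (d -` A) * indicator C s \<partial>distr P S f)"
      using measurable_sets[OF d A] by (intro eq[OF C]) simp
    also have "\<dots> = (\<integral>\<^sup>+s. emeasure (distr (k0 s) M d) A * indicator C s \<partial>distr P S f)"
    proof (intro nn_integral_cong)
      fix s assume "s \<in> space (distr P S f)"
      then have s: "s \<in> space S" by simp
      have "d \<in> k0 s \<rightarrow>\<^sub>M M" using d by (simp cong: measurable_cong_sets add: k0p(2)[OF s])
      then show "emeasure (k0 s) (d -` A) * indicator C s = emeasure (distr (k0 s) M d) A * indicator C s"
        using sets_eq_imp_space_eq[OF k0p(2)[OF s]] by (simp add: emeasure_distr)
    qed
    finally show "emeasure P {w\<in>space P. w \<in> A \<and> f w \<in> C}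
      = (\<integral>\<^sup>+s. emeasure (distr (k0 s) M d) A * indicator C s \<partial>distr P S f)" .
  qed
  then show ?thesis by (rule that)
qed

text \<open>The law of \<open>(f w, w)\<close> under \<open>P\<close> and the mixture over
  \<open>s\<close> of the laws of \<open>(s, w)\<close>, with \<open>w\<close> drawn from
  \<open>k s\<close>, agree on rectangles, hence everywhere; integrating \<open>h\<close> against
  both gives the two sides.\<close>

lemma disintegration_nn_integral:
  assumes P: "prob_space P" and f[measurable]: "f \<in> P \<rightarrow>\<^sub>M S" and k: "disintegration P f S k"
    and h[measurable]: "h \<in> borel_measurable (S \<Otimes>\<^sub>M P)"
  shows "(\<integral>\<^sup>+w. h (f w, w) \<partial>P) = (\<integral>\<^sup>+s. \<integral>\<^sup>+w. h (s, w) \<partial>k s \<partial>distr P S f)"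
proof -
  interpret P: prob_space P by fact
  have k1[measurable]: "k \<in> S \<rightarrow>\<^sub>M prob_algebra P" using k by (simp add: disintegration_def)
  have kp: "prob_space (k s)" "sets (k s) = sets P" if "s \<in> space S" for s
    using measurable_space[OF k1 that] by (auto simp: space_prob_algebra)
  define D where "D = distr P S f"
  have sD[measurable_cong]: "sets D = sets S" by (simp add: D_def)
  have spD: "space D = space S" by (simp add: D_def)
  have ne: "space D \<noteq> {}" unfolding spD using P.not_empty measurable_space[OF f] by auto
  define N1 where "N1 = distr P (S \<Otimes>\<^sub>M P) (\<lambda>w. (f w, w))"
  define K where "K s = distr (k s) (S \<Otimes>\<^sub>M P) (Pair s)" for s
  have K: "K \<in> S \<rightarrow>\<^sub>M prob_algebra (S \<Otimes>\<^sub>M P)"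
    unfolding K_def[abs_def] by (rule measurable_distr_prob_space2[OF k1]) measurable
  have K': "K \<in> D \<rightarrow>\<^sub>M subprob_algebra (S \<Otimes>\<^sub>M P)"
    using measurable_prob_algebraD[OF K] by (simp cong: measurable_cong_sets add: sD)
  define N2 where "N2 = D \<bind> K"
  have Pair: "Pair s \<in> k s \<rightarrow>\<^sub>M S \<Otimes>\<^sub>M P" if "s \<in> space S" for s
    using that by (simp cong: measurable_cong_sets add: kp(2))
  have "N1 = N2"
  proof (rule measure_eqI_generator_eq[OF Int_stable_pair_measure_generator pair_measure_closed, where A="\<lambda>_. space S \<times> space P"])
    show "sets N1 = sigma_sets (space S \<times> space P) {a \<times> b |a b. a \<in> sets S \<and> b \<in> sets P}"
      by (simp add: N1_def sets_pair_measure)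
    show "sets N2 = sigma_sets (space S \<times> space P) {a \<times> b |a b. a \<in> sets S \<and> b \<in> sets P}"
      unfolding N2_def by (subst sets_bind[OF sets_kernel[OF K']]) (auto simp: ne sets_pair_measure)
    show "range (\<lambda>_. space S \<times> space P) \<subseteq> {a \<times> b |a b. a \<in> sets S \<and> b \<in> sets P}" by auto
    show "emeasure N1 (space S \<times> space P) \<noteq> \<infinity>" for i :: nat
      unfolding N1_def by (simp add: emeasure_distr)
    fix X assume "X \<in> {a \<times> b |a b. a \<in> sets S \<and> b \<in> sets P}"
    then obtain C A where X: "X = C \<times> A" and [measurable]: "C \<in> sets S" "A \<in> sets P" by auto
    have "emeasure N1 X = emeasure P {w\<in>space P. w \<in> A \<and> f w \<in> C}"
      unfolding N1_def X by (subst emeasure_distr) (auto intro!: arg_cong[where f="emeasure P"])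
    also have "\<dots> = (\<integral>\<^sup>+s. emeasure (k s) A * indicator C s \<partial>D)"
      using k by (simp add: disintegration_def D_def)
    also have "\<dots> = (\<integral>\<^sup>+s. emeasure (K s) X \<partial>D)"
    proof (intro nn_integral_cong)
      fix s assume "s \<in> space D" then have s: "s \<in> space S" by (simp add: spD)
      have "Pair s -` (C \<times> A) \<inter> space (k s) = (if s \<in> C then A else {})"
        using sets_eq_imp_space_eq[OF kp(2)[OF s]] sets.sets_into_space[of A P] by auto
      then show "emeasure (k s) A * indicator C s = emeasure (K s) X"
        unfolding K_def X by (subst emeasure_distr[OF Pair[OF s]]) auto
    qed
    also have "\<dots> = emeasure N2 X"
      unfolding N2_def X by (rule emeasure_bind[OF ne K', symmetric]) measurable
    finally show "emeasure N1 X = emeasure N2 X" .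
  qed auto
  have "(\<integral>\<^sup>+w. h (f w, w) \<partial>P) = (\<integral>\<^sup>+z. h z \<partial>N1)"
    unfolding N1_def by (simp add: nn_integral_distr)
  also have "\<dots> = (\<integral>\<^sup>+s. \<integral>\<^sup>+z. h z \<partial>K s \<partial>D)"
    unfolding \<open>N1 = N2\<close> N2_def by (rule nn_integral_bind[OF h K'])
  also have "\<dots> = (\<integral>\<^sup>+s. \<integral>\<^sup>+w. h (s, w) \<partial>k s \<partial>D)"
    by (intro nn_integral_cong) (simp add: K_def nn_integral_distr Pair spD)
  finally show ?thesis by (simp add: D_def)
qed

text \<open>The exceptional set has measure 0 under the joint law, and
  \<open>disintegration_nn_integral\<close> spreads this 0 over the kernels. With
  \<open>f w = s\<close> as \<open>E (s, w)\<close> this is the concentration of \<open>k s\<close>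
  on its fibre.\<close>

lemma disintegration_AE:
  assumes P: "prob_space P" and f[measurable]: "f \<in> P \<rightarrow>\<^sub>M S" and k: "disintegration P f S k"
    and E[measurable]: "Measurable.pred (S \<Otimes>\<^sub>M P) E" and AE: "AE w in P. E (f w, w)"
  shows "AE s in distr P S f. AE w in k s. E (s, w)"
proof -
  have k1: "k \<in> S \<rightarrow>\<^sub>M prob_algebra P" using k by (simp add: disintegration_def)
  have kp: "sets (k s) = sets P" if "s \<in> space S" for s
    using measurable_space[OF k1 that] by (auto simp: space_prob_algebra)
  have [measurable]: "k \<in> S \<rightarrow>\<^sub>M subprob_algebra P" by (rule measurable_prob_algebraD[OF k1])
  have "(\<integral>\<^sup>+s. \<integral>\<^sup>+w. indicator {z\<in>space (S \<Otimes>\<^sub>M P). \<not> E z} (s, w) \<partial>k s \<partial>distr P S f)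
      = (\<integral>\<^sup>+w. indicator {z\<in>space (S \<Otimes>\<^sub>M P). \<not> E z} (f w, w) \<partial>P)"
    by (rule disintegration_nn_integral[OF P f k, symmetric]) measurable
  also have "\<dots> = 0" using AE by (subst nn_integral_0_iff_AE) (auto elim!: AE_mp)
  finally have *: "(\<integral>\<^sup>+s. \<integral>\<^sup>+w. indicator {z\<in>space (S \<Otimes>\<^sub>M P). \<not> E z} (s, w) \<partial>k s \<partial>distr P S f) = 0" .
  have [measurable]: "(\<lambda>s. \<integral>\<^sup>+w. indicator {z\<in>space (S \<Otimes>\<^sub>M P). \<not> E z} (s, w) \<partial>k s) \<in> borel_measurable S"
    by (rule nn_integral_measurable_subprob_algebra2[where N=P]) measurable
  from * have "AE s in distr P S f. (\<integral>\<^sup>+w. indicator {z\<in>space (S \<Otimes>\<^sub>M P). \<not> E z} (s, w) \<partial>k s) = 0"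
    by (subst (asm) nn_integral_0_iff_AE) auto
  then show ?thesis
    using AE_space
  proof eventually_elim
    case (elim s)
    then have s: "s \<in> space S" by simp
    have [measurable_cong]: "sets (k s) = sets P" by (rule kp[OF s])
    have "AE w in k s. (indicator {z\<in>space (S \<Otimes>\<^sub>M P). \<not> E z} (s, w) :: ennreal) = 0"
      using elim(1) s by (subst (asm) nn_integral_0_iff_AE) auto
    then show ?case using AE_space
      by eventually_elim (use s sets_eq_imp_space_eq[OF kp[OF s]] in \<open>auto simp: indicator_def space_pair_measure split: if_splits\<close>)
  qed
qed

section \<open>Countable generation and almost sure uniqueness of kernels\<close>

lemma rational_sequence_decreasing_to:
  obtains q :: "nat \<Rightarrow> real" where "\<And>n. q n \<in> \<rat>" "\<And>n. x < q n" "q \<longlonglongrightarrow> x"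
proof -
  have "\<forall>n. \<exists>q\<in>\<rat>. x < q \<and> q < x + 1/Suc n"
    using Rats_dense_in_real[of x] by (auto simp del: of_nat_Suc)
  then obtain q :: "nat \<Rightarrow> real" where q: "\<And>n. q n \<in> \<rat>" "\<And>n. x < q n" "\<And>n. q n < x + 1/Suc n"
    by metis
  have "q \<longlonglongrightarrow> x"
  proof (rule tendsto_sandwich[of "\<lambda>_. x" q sequentially "\<lambda>n. x + 1/Suc n"])
    show "(\<lambda>n. x + 1/Suc n) \<longlonglongrightarrow> x"
      using LIMSEQ_inverse_real_of_nat_add[of x] by (simp add: inverse_eq_divide)
    show "(\<lambda>n. x) \<longlonglongrightarrow> x" by simp
  qed (use q in \<open>auto intro!: always_eventually less_imp_le\<close>)
  then show ?thesis using q that by blast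
qed

text \<open>A countable generator, so that almost sure statements about half-lines can be collected
  on the complement of one null set.\<close>

lemma sets_borel_eq_sigma_rat_atMost:
  "sets (borel :: real measure) = sigma_sets UNIV (insert UNIV ((\<lambda>x. {..x}) ` \<rat>))"
  unfolding sets_borel_eq_sigma_atMost
proof (rule sigma_sets_eqI)
  fix A assume "A \<in> insert UNIV (range (\<lambda>x::real. {..x}))"
  then consider "A = UNIV" | x where "A = {..x}" by auto
  then show "A \<in> sigma_sets UNIV (insert UNIV ((\<lambda>x. {..x}) ` \<rat>))"
  proof cases
    case 2
    obtain q :: "nat \<Rightarrow> real" where q: "\<And>n. q n \<in> \<rat>" "\<And>n. x < q n" "q \<longlonglongrightarrow> x"
      by (rule rational_sequence_decreasing_to[of x]) blast
    have "A = (\<Inter>n. {..q n})"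
      using order_trans[OF _ less_imp_le[OF q(2)]] LIMSEQ_le_const[OF q(3)] by (fastforce simp: 2)
    also have "\<dots> \<in> sigma_sets UNIV (insert UNIV ((\<lambda>x. {..x}) ` \<rat>))"
      using q(1) by (intro sigma_sets_INTER) auto
    finally show ?thesis .
  qed (auto intro: sigma_sets_top)
qed auto

text \<open>Each event gives agreement off a null set of its own. Testing the real codes on rational
  half-lines leaves a single null set, off which the laws of the codes coincide; pushing these laws
  forward by \<open>d\<close> recovers the kernels.\<close>

lemma kernels_AE_eq:
  assumes M: "retract_of_unit_interval M" and D: "finite_measure D"
    and k1: "k1 \<in> D \<rightarrow>\<^sub>M prob_algebra M" and k2: "k2 \<in> D \<rightarrow>\<^sub>M prob_algebra M"
    and eq: "\<And>A C. A \<in> sets M \<Longrightarrow> C \<in> sets D \<Longrightarrow>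
       (\<integral>\<^sup>+s. emeasure (k1 s) A * indicator C s \<partial>D) = (\<integral>\<^sup>+s. emeasure (k2 s) A * indicator C s \<partial>D)"
  shows "AE s in D. k1 s = k2 s"
proof -
  interpret D: finite_measure D by fact
  obtain c d where c[measurable]: "c \<in> M \<rightarrow>\<^sub>M (borel :: real measure)" and d[measurable]: "d \<in> borel \<rightarrow>\<^sub>M M"
    and dc: "\<And>w. w \<in> space M \<Longrightarrow> d (c w) = w"
    using M unfolding retract_of_unit_interval_def by auto
  have kp1: "prob_space (k1 s)" "sets (k1 s) = sets M" if "s \<in> space D" for s
    using measurable_space[OF k1 that] by (auto simp: space_prob_algebra)
  have kp2: "prob_space (k2 s)" "sets (k2 s) = sets M" if "s \<in> space D" for s
    using measurable_space[OF k2 that] by (auto simp: space_prob_algebra)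
  have AEq: "AE s in D. emeasure (k1 s) A = emeasure (k2 s) A" if A[measurable]: "A \<in> sets M" for A
  proof -
    have [measurable]: "(\<lambda>s. emeasure (k1 s) A) \<in> borel_measurable D" "(\<lambda>s. emeasure (k2 s) A) \<in> borel_measurable D"
      using measurable_emeasure_kernel[OF measurable_prob_algebraD[OF k1] A]
        measurable_emeasure_kernel[OF measurable_prob_algebraD[OF k2] A] by auto
    have fin: "(\<integral>\<^sup>+s. emeasure (k s) A \<partial>D) < \<infinity>" if "\<And>s. s \<in> space D \<Longrightarrow> prob_space (k s)" for k :: "_ \<Rightarrow> _ measure"
    proof -
      have "(\<integral>\<^sup>+s. emeasure (k s) A \<partial>D) \<le> (\<integral>\<^sup>+s. 1 \<partial>D)"
        by (intro nn_integral_mono prob_space.emeasure_le_1 that)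
      also have "\<dots> < \<infinity>" by (simp add: less_top[symmetric])
      finally show ?thesis .
    qed
    have "AE s in D. emeasure (k1 s) A \<le> emeasure (k2 s) A" "AE s in D. emeasure (k2 s) A \<le> emeasure (k1 s) A"
      by (intro AE_le_if_set_integrals_le fin kp1 kp2; simp add: eq)+
    then show ?thesis by eventually_elim auto
  qed
  have "AE s in D. \<forall>q\<in>\<rat>. emeasure (k1 s) (c -` {..q} \<inter> space M) = emeasure (k2 s) (c -` {..q} \<inter> space M)"
    unfolding AE_ball_countable[OF countable_rat] by (auto intro!: AEq)
  then show ?thesis using AE_space
  proof eventually_elim
    case (elim s)
    note s1 = kp1[OF elim(2)] and s2 = kp2[OF elim(2)]
    have c1: "c \<in> k1 s \<rightarrow>\<^sub>M borel" and c2: "c \<in> k2 s \<rightarrow>\<^sub>M borel"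
      using c by (simp_all cong: measurable_cong_sets add: s1 s2)
    have sp: "space (k1 s) = space M" "space (k2 s) = space M"
      using s1(2) s2(2) by (auto dest: sets_eq_imp_space_eq)
    have "distr (k1 s) borel c = distr (k2 s) borel c"
    proof (rule measure_eqI_generator_eq[where E="insert UNIV ((\<lambda>x::real. {..x}) ` \<rat>)" and \<Omega>=UNIV and A="\<lambda>_. UNIV"])
      show "Int_stable (insert UNIV ((\<lambda>x::real. {..x}) ` \<rat>))" by (auto simp: Int_stable_def min_def)
      fix X assume "X \<in> insert UNIV ((\<lambda>x::real. {..x}) ` \<rat>)"
      then show "emeasure (distr (k1 s) borel c) X = emeasure (distr (k2 s) borel c) X"
        using elim(1) prob_space.emeasure_space_1[OF s1(1)] prob_space.emeasure_space_1[OF s2(1)]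
        by (auto simp: emeasure_distr c1 c2 sp)
    next
      show "emeasure (distr (k1 s) borel c) UNIV \<noteq> \<infinity>"
        using prob_space.emeasure_space_1[OF s1(1)] by (simp add: emeasure_distr c1)
    qed (auto simp: sets_borel_eq_sigma_rat_atMost)
    then have "distr (distr (k1 s) borel c) M d = distr (distr (k2 s) borel c) M d" by simp
    moreover have "distr (distr k borel c) M d = k" if "sets k = sets M" for k
    proof -
      have ck: "c \<in> k \<rightarrow>\<^sub>M borel" using c by (simp cong: measurable_cong_sets add: that)
      have "distr (distr k borel c) M d = distr k M (d \<circ> c)" by (rule distr_distr[OF d ck])
      also have "\<dots> = distr k k (\<lambda>x. x)"
        using dc sets_eq_imp_space_eq[OF that] by (intro distr_cong) (auto simp: that)
      finally show ?thesis by (simp add: distr_id)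
    qed
    ultimately show ?case using s1(2) s2(2) by metis
  qed
qed

section \<open>Path space\<close>

lemma space_path_space: "space (path_space T) = {\<omega>\<in>extensional {-T..T}. continuous_on {-T..T} \<omega>}"
  by (auto simp: path_space_def space_restrict_space space_PiM PiE_def)

lemma path_eq_iff:
  "\<omega> \<in> space (path_space T) \<Longrightarrow> \<omega>' \<in> space (path_space T) \<Longrightarrow> \<omega> = \<omega>' \<longleftrightarrow> (\<forall>t\<in>{-T..T}. \<omega> t = \<omega>' t)"
  by (auto simp: space_path_space intro: extensionalityI)

lemma measurable_path_eval[measurable (raw)]:
  assumes "t \<in> {-T..T}"
  shows "(\<lambda>\<omega>. \<omega> t) \<in> path_space T \<rightarrow>\<^sub>M borel"
  unfolding path_space_def using assms by (intro measurable_restrict_space1) simp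

lemma measurable_path_spaceI:
  assumes "\<And>t. t \<in> {-T..T} \<Longrightarrow> (\<lambda>w. f w t) \<in> M \<rightarrow>\<^sub>M borel"
    and "\<And>w. w \<in> space M \<Longrightarrow> f w \<in> space (path_space T)"
  shows "f \<in> M \<rightarrow>\<^sub>M path_space T"
  unfolding path_space_def
proof (rule measurable_restrict_space2)
  show "f \<in> space M \<rightarrow> {\<omega>. continuous_on {-T..T} \<omega>}"
    using assms(2) by (auto simp: space_path_space)
  show "f \<in> M \<rightarrow>\<^sub>M Pi\<^sub>M {-T..T} (\<lambda>t. borel)"
    by (rule measurable_PiM_single') (use assms in \<open>auto simp: space_path_space PiE_def Pi_def\<close>)
qed

lemma rational_times_dense:
  fixes T :: real
  assumes "0 < T" "t \<in> {-T..T}"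
  obtains q :: "nat \<Rightarrow> real" where "\<And>n. q n \<in> \<rat> \<inter> {-T..T}" "q \<longlonglongrightarrow> t"
proof -
  have "\<exists>q\<in>\<rat>. max (-T) (t - 1/Suc n) < q \<and> q < min T (t + 1/Suc n)" for n
  proof (rule Rats_dense_in_real)
    have "0 < 1 / real (Suc n)" by simp
    then show "max (-T) (t - 1/Suc n) < min T (t + 1/Suc n)" using assms by (simp only: max_less_iff_conj min_less_iff_conj atLeastAtMost_iff) linarith
  qed
  then obtain q :: "nat \<Rightarrow> real" where q: "\<And>n. q n \<in> \<rat>" "\<And>n. max (-T) (t - 1/Suc n) < q n" "\<And>n. q n < min T (t + 1/Suc n)"
    by metis
  have 1: "(\<lambda>n. t + 1/Suc n) \<longlonglongrightarrow> t" and 2: "(\<lambda>n. t - 1/Suc n) \<longlonglongrightarrow> t"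
    using LIMSEQ_inverse_real_of_nat_add[of t] LIMSEQ_inverse_real_of_nat_add_minus[of t]
    by (simp_all add: inverse_eq_divide)
  have "q \<longlonglongrightarrow> t"
    by (rule tendsto_sandwich[OF _ _ 2 1]) (use q in \<open>auto intro!: always_eventually less_imp_le\<close>)
  moreover have "q n \<in> \<rat> \<inter> {-T..T}" for n using q(1)[of n] q(2,3)[of n] by auto
  ultimately show ?thesis using that by blast
qed

section \<open>Coding of bit sequences by reals in base three\<close>

definition leading_digit :: "real \<Rightarrow> bool" where
  "leading_digit x \<longleftrightarrow> 1/3 \<le> x"

fun ternary_remainder :: "real \<Rightarrow> nat \<Rightarrow> real" where
  "ternary_remainder x 0 = x"
| "ternary_remainder x (Suc n) = 3 * ternary_remainder x n - of_bool (leading_digit (ternary_remainder x n))"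

text \<open>Base three with digits 0 and 1 leaves gaps that make decoding unambiguous: after a
  leading 0 the value is at most 1/6, after a leading 1 at least 1/3. The threshold in
  \<open>leading_digit\<close> therefore reads the first bit, and \<open>ternary_remainder\<close>
  shifts it out. Binary expansions would collide at dyadic values.\<close>

definition ternary_code :: "(nat \<Rightarrow> bool) \<Rightarrow> real" where
  "ternary_code b = (\<Sum>n. of_bool (b n) * (1/3) ^ Suc n)"

lemma ternary_summable: "summable (\<lambda>n. of_bool (b n) * (1/3 :: real) ^ Suc n)"
  by (rule summable_comparison_test[of _ "\<lambda>n. (1/3 :: real) ^ Suc n"])
    (auto intro!: exI[of _ 0] summable_Suc_iff[THEN iffD2] summable_geometric simp del: power_Suc)

lemma ternary_code_bounds: "0 \<le> ternary_code b" "ternary_code b \<le> 1/2"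
proof -
  show "0 \<le> ternary_code b" unfolding ternary_code_def by (rule suminf_nonneg[OF ternary_summable]) simp
  have "(\<lambda>n. (1/3 :: real) * (1/3) ^ n) sums (1/3 * (1 / (1 - 1/3)))"
    by (intro sums_mult geometric_sums) auto
  then have s: "(\<lambda>n. (1/3 :: real) ^ Suc n) sums (1/2)" by simp
  have "ternary_code b \<le> (\<Sum>n. (1/3 :: real) ^ Suc n)"
    unfolding ternary_code_def using ternary_summable sums_summable[OF s]
    by (intro suminf_le) auto
  then show "ternary_code b \<le> 1/2" using s by (simp add: sums_iff)
qed

lemma ternary_code_split: "ternary_code b = 1/3 * (of_bool (b 0) + ternary_code (\<lambda>n. b (Suc n)))"
proof -
  have "ternary_code b = (\<Sum>n. of_bool (b (Suc n)) * (1/3) ^ Suc (Suc n)) + of_bool (b 0) * (1/3) ^ Suc 0"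
    unfolding ternary_code_def by (subst suminf_split_head[OF ternary_summable]) simp
  also have "(\<Sum>n. of_bool (b (Suc n)) * (1/3) ^ Suc (Suc n)) = (\<Sum>n. 1/3 * (of_bool (b (Suc n)) * (1/3 :: real) ^ Suc n))"
    by (simp add: mult_ac)
  also have "\<dots> = 1/3 * ternary_code (\<lambda>n. b (Suc n))"
    unfolding ternary_code_def by (rule suminf_mult[OF ternary_summable])
  finally show ?thesis by (simp add: algebra_simps)
qed

lemma ternary_code_digit: "leading_digit (ternary_code b) \<longleftrightarrow> b 0"
  using ternary_code_split[of b] ternary_code_bounds[of "\<lambda>n. b (Suc n)"]
  by (cases "b 0") (auto simp: leading_digit_def)

lemma ternary_remainder_code: "ternary_remainder (ternary_code b) n = ternary_code (\<lambda>k. b (n + k))"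
proof (induction n)
  case (Suc n)
  have "ternary_code (\<lambda>k. b (n + k)) = 1/3 * (of_bool (b n) + ternary_code (\<lambda>k. b (Suc n + k)))"
    using ternary_code_split[of "\<lambda>k. b (n + k)"] by simp
  then show ?case by (simp add: Suc ternary_code_digit)
qed simp

lemma ternary_digit: "leading_digit (ternary_remainder (ternary_code b) n) \<longleftrightarrow> b n"
  by (simp add: ternary_remainder_code ternary_code_digit)

lemma measurable_ternary_remainder[measurable]: "(\<lambda>x. ternary_remainder x n) \<in> borel_measurable borel"
  by (induction n) (auto simp: leading_digit_def)

text \<open>A real is the supremum of the rationals below it. False bits contribute minus infinity,
  and with the supremum taken in \<open>ereal\<close> the expression makes sense for arbitrary bits,
  including those that code no path.\<close>

lemma SUP_rat_below:
  fixes y :: real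
  assumes "\<And>q. q \<in> \<rat> \<Longrightarrow> \<exists>n\<in>I. r n = q" "\<And>n. n \<in> I \<Longrightarrow> b n \<longleftrightarrow> r n < y"
  shows "(SUP n\<in>I. if b n then ereal (r n) else - \<infinity>) = ereal y"
proof (rule antisym)
  show "(SUP n\<in>I. if b n then ereal (r n) else - \<infinity>) \<le> ereal y"
  proof (rule SUP_least)
    fix n assume "n \<in> I"
    then show "(if b n then ereal (r n) else - \<infinity>) \<le> ereal y" using assms(2)[of n] by auto
  qed
  show "ereal y \<le> (SUP n\<in>I. if b n then ereal (r n) else - \<infinity>)"
  proof (rule le_SUP_iff[THEN iffD2], intro allI impI)
    fix z assume z: "z < ereal y"
    obtain q where q: "q \<in> \<rat>" "z < ereal q" "q < y"
    proof (cases z)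
      case (real a)
      then show ?thesis using z Rats_dense_in_real[of a y] that by auto
    next
      case MInf
      then show ?thesis using Rats_dense_in_real[of "y - 1" y] that by auto
    qed (use z in auto)
    obtain n where "n \<in> I" "r n = q" using assms(1) q(1) by blast
    then show "\<exists>n\<in>I. z < (if b n then ereal (r n) else - \<infinity>)"
      using assms(2) q by (intro bexI[of _ n]) auto
  qed
qed

text \<open>A path is coded by the digits \<open>q < \<omega> t \<bullet> b\<close> for rational times \<open>t\<close>, basis vectors \<open>b\<close> and rational
  levels \<open>q\<close>; it is recovered by continuity in time.\<close>

theorem retract_path_space:
  assumes T: "0 < T"
  shows "retract_of_unit_interval (path_space T :: (real \<Rightarrow> 'a::euclidean_space) measure)"
proof -
  define Tq where "Tq = \<rat> \<inter> {-T..T}"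
  have cTq: "countable Tq" unfolding Tq_def using countable_rat by (rule countable_subset[rotated]) auto
  have Tq: "t \<in> {-T..T}" if "t \<in> Tq" for t using that by (simp add: Tq_def)
  have "\<forall>t\<in>{-T..T}. \<exists>q::nat \<Rightarrow> real. (\<forall>n. q n \<in> Tq) \<and> q \<longlonglongrightarrow> t"
    unfolding Tq_def using rational_times_dense[OF T] by metis
  then obtain q :: "real \<Rightarrow> nat \<Rightarrow> real" where q: "\<And>t n. t \<in> {-T..T} \<Longrightarrow> q t n \<in> Tq" "\<And>t. t \<in> {-T..T} \<Longrightarrow> q t \<longlonglongrightarrow> t"
    by metis
  define I where "I = Tq \<times> (Basis :: 'a set) \<times> (\<rat> :: real set)"
  have cI: "countable I" unfolding I_def using cTq countable_rat
    by (intro countable_SIGMA) (auto intro: countable_finite)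
  have "0 \<in> Tq" using T by (auto simp: Tq_def)
  then have neI: "I \<noteq> {}" unfolding I_def using Rats_0 by (auto simp: nonempty_Basis)
  define e where "e = from_nat_into I"
  have e: "e n \<in> I" for n unfolding e_def using from_nat_into[OF neI] .
  have esurj: "\<exists>n. e n = i" if "i \<in> I" for i
    unfolding e_def using from_nat_into_surj[OF cI that] by metis
  define t' where "t' n = fst (e n)" for n
  define b' where "b' n = fst (snd (e n))" for n
  define r' where "r' n = snd (snd (e n))" for n
  have t': "t' n \<in> Tq" for n using e[of n] by (auto simp: t'_def I_def)
  have [measurable]: "(\<lambda>\<omega>. \<omega> (t' n)) \<in> path_space T \<rightarrow>\<^sub>M (borel :: 'a measure)" for n
    by (rule measurable_path_eval[OF Tq[OF t']])
  define c where "c \<omega> = ternary_code (\<lambda>n. r' n < \<omega> (t' n) \<bullet> b' n)" for \<omega> :: "real \<Rightarrow> 'a"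
  have c: "c \<in> path_space T \<rightarrow>\<^sub>M borel"
    unfolding c_def[abs_def] ternary_code_def by measurable
  define val where "val x t b = real_of_ereal (SUP n\<in>{n. t' n = t \<and> b' n = b}. if leading_digit (ternary_remainder x n) then ereal (r' n) else - \<infinity>)"
    for x t b
  define v where "v x t = (\<Sum>b\<in>Basis. val x t b *\<^sub>R b)" for x t
  have [measurable]: "(\<lambda>x. v x t) \<in> borel_measurable borel" for t
    unfolding v_def val_def leading_digit_def by measurable
  have vc: "v (c \<omega>) t = \<omega> t" if t: "t \<in> Tq" for \<omega> t
  proof -
    have "val (c \<omega>) t b = \<omega> t \<bullet> b" if b: "b \<in> Basis" for b
    proof -
      have "(SUP n\<in>{n. t' n = t \<and> b' n = b}. if leading_digit (ternary_remainder (c \<omega>) n) then ereal (r' n) else - \<infinity>) = ereal (\<omega> t \<bullet> b)"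
      proof (rule SUP_rat_below)
        fix q :: real assume "q \<in> \<rat>"
        then obtain n where "e n = (t, b, q)" using esurj[of "(t, b, q)"] t b by (auto simp: I_def)
        then show "\<exists>n\<in>{n. t' n = t \<and> b' n = b}. r' n = q"
          by (intro bexI[of _ n]) (auto simp: t'_def b'_def r'_def)
      qed (auto simp: c_def ternary_digit)
      then show ?thesis by (simp add: val_def)
    qed
    then show ?thesis by (simp add: v_def euclidean_representation)
  qed
  \<comment> \<open>An arbitrary real may code no path. Uniform continuity of the decoded values on
    the rational times \<open>Tq\<close> is exactly what allows a continuous extension to the
    interval, and with its countable quantifiers it is measurable in \<open>x\<close>. Where it
    fails, \<open>d\<close> will return the zero path.\<close>
  define uc where "uc x \<longleftrightarrow> (\<forall>m::nat. \<exists>n::nat. \<forall>s\<in>Tq. \<forall>t\<in>Tq. dist s t < 1/Suc n \<longrightarrow> dist (v x s) (v x t) < 1/Suc m)" for x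
  have [measurable]: "Measurable.pred borel uc"
    unfolding uc_def using cTq by measurable
  have uc_iff: "uc x \<longleftrightarrow> uniformly_continuous_on Tq (v x)" for x
  proof
    assume u: "uc x"
    show "uniformly_continuous_on Tq (v x)"
      unfolding uniformly_continuous_on_def
    proof (intro allI impI)
      fix \<epsilon> :: real assume "0 < \<epsilon>"
      then obtain m where m: "1 / Suc m < \<epsilon>" using nat_approx_posE by blast
      obtain n where n: "\<forall>s\<in>Tq. \<forall>t\<in>Tq. dist s t < 1/Suc n \<longrightarrow> dist (v x s) (v x t) < 1/Suc m"
        using u unfolding uc_def by blast
      show "\<exists>d>0. \<forall>s\<in>Tq. \<forall>t\<in>Tq. dist t s < d \<longrightarrow> dist (v x t) (v x s) < \<epsilon>"
        using n m by (intro exI[of _ "1/Suc n"]) (force simp del: of_nat_Suc)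
    qed
  next
    assume u: "uniformly_continuous_on Tq (v x)"
    show "uc x" unfolding uc_def
    proof
      fix m :: nat
      obtain d where d: "d > 0" "\<forall>s\<in>Tq. \<forall>t\<in>Tq. dist t s < d \<longrightarrow> dist (v x t) (v x s) < 1/Suc m"
        using u unfolding uniformly_continuous_on_def by (metis of_nat_0_less_iff zero_less_Suc zero_less_divide_1_iff)
      obtain n where n: "1 / Suc n < d" using d nat_approx_posE by blast
      show "\<exists>n::nat. \<forall>s\<in>Tq. \<forall>t\<in>Tq. dist s t < 1/Suc n \<longrightarrow> dist (v x s) (v x t) < 1/Suc m"
        using d n by (intro exI[of _ n]) (auto simp del: of_nat_Suc)
    qed
  qed
  define d where "d x = (if uc x then (\<lambda>t\<in>{-T..T}. lim (\<lambda>n. v x (q t n))) else (\<lambda>t\<in>{-T..T}. 0))" for x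
  have closure: "{-T..T} \<subseteq> closure Tq"
  proof
    fix t assume "t \<in> {-T..T}"
    then show "t \<in> closure Tq" unfolding closure_sequential using q[of t] by blast
  qed
  have limq: "lim (\<lambda>n. g (q t n)) = g t" if "continuous_on {-T..T} g" "t \<in> {-T..T}" for g :: "real \<Rightarrow> 'a" and t
    using continuous_on_tendsto_compose[OF that(1) q(2)[OF that(2)] that(2)] q(1)[OF that(2)] Tq
    by (intro limI) (auto simp: o_def)
  have d: "d \<in> borel \<rightarrow>\<^sub>M path_space T"
  proof (rule measurable_path_spaceI)
    fix t assume t: "t \<in> {-T..T}"
    have "(\<lambda>w. d w t) = (\<lambda>x. if uc x then lim (\<lambda>n. v x (q t n)) else 0)"
      using t by (auto simp: d_def)
    then show "(\<lambda>w. d w t) \<in> borel_measurable borel" by simp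
  next
    fix x :: real
    show "d x \<in> space (path_space T)"
    proof (cases "uc x")
      case True
      then have "uniformly_continuous_on Tq (v x)" by (simp add: uc_iff)
      then obtain g where g: "uniformly_continuous_on (closure Tq) g" "\<And>t. t \<in> Tq \<Longrightarrow> v x t = g t"
        using uniformly_continuous_on_extension_on_closure by metis
      have gc: "continuous_on {-T..T} g"
        by (rule continuous_on_subset[OF uniformly_continuous_imp_continuous[OF g(1)] closure])
      have "d x t = g t" if "t \<in> {-T..T}" for t
        using True that limq[OF gc that] by (simp add: d_def g(2)[OF q(1)[OF that]])
      then have "continuous_on {-T..T} (d x)" using continuous_on_cong[of "{-T..T}" "{-T..T}" "d x" g] gc by blast
      then show ?thesis by (auto simp: space_path_space d_def)
    next
      case False
      then have "continuous_on {-T..T} (d x)"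
        using continuous_on_cong[of "{-T..T}" "{-T..T}" "d x" "\<lambda>_. 0"] by (simp add: d_def)
      then show ?thesis using False by (auto simp: space_path_space d_def)
    qed
  qed
  have dc: "d (c \<omega>) = \<omega>" if w: "\<omega> \<in> space (path_space T)" for \<omega>
  proof -
    have wc: "continuous_on {-T..T} \<omega>" using w by (simp add: space_path_space)
    then have "uniformly_continuous_on {-T..T} \<omega>" by (rule compact_uniformly_continuous) simp
    then have "uniformly_continuous_on Tq \<omega>" using Tq unfolding uniformly_continuous_on_def by meson
    moreover have "uniformly_continuous_on Tq (v (c \<omega>)) = uniformly_continuous_on Tq \<omega>"
      unfolding uniformly_continuous_on_def by (simp add: vc)
    ultimately have u: "uc (c \<omega>)" by (simp add: uc_iff)
    have "d (c \<omega>) t = \<omega> t" if "t \<in> {-T..T}" for t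
      using u that limq[OF wc that] by (simp add: d_def vc[OF q(1)[OF that]])
    then show ?thesis
      using measurable_space[OF d, of "c \<omega>"] w by (simp add: path_eq_iff)
  qed
  have "0 \<le> c \<omega>" "c \<omega> \<le> 1" for \<omega> using ternary_code_bounds[of "\<lambda>n. r' n < \<omega> (t' n) \<bullet> b' n"] by (auto simp: c_def)
  with c d dc show ?thesis unfolding retract_of_unit_interval_def by blast
qed

text \<open>Closed base sets already generate, and their indicators are limits of continuous
  functions of finitely many coordinates; this connects equality of measures with test functionals.
  The choice \<open>J = {}\<close> gives the whole space.\<close>

definition closed_cylinders :: "real \<Rightarrow> (real \<Rightarrow> 'a::euclidean_space) set set" where
  "closed_cylinders T = {{\<omega>\<in>space (path_space T). \<forall>t\<in>J. \<omega> t \<in> C t} | J C. finite J \<and> J \<subseteq> {-T..T} \<and> (\<forall>t\<in>J. closed (C t))}"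

lemma Int_stable_closed_cylinders: "Int_stable (closed_cylinders T :: (real \<Rightarrow> 'a::euclidean_space) set set)"
proof (rule Int_stableI)
  fix a b :: "(real \<Rightarrow> 'a) set" assume "a \<in> closed_cylinders T" "b \<in> closed_cylinders T"
  then obtain J C J' C' where a: "a = {\<omega>\<in>space (path_space T). \<forall>t\<in>J. \<omega> t \<in> C t}" "finite J" "J \<subseteq> {-T..T}" "\<forall>t\<in>J. closed (C t)"
    and b: "b = {\<omega>\<in>space (path_space T). \<forall>t\<in>J'. \<omega> t \<in> C' t}" "finite J'" "J' \<subseteq> {-T..T}" "\<forall>t\<in>J'. closed (C' t)"
    unfolding closed_cylinders_def by auto
  define C'' where "C'' t = (if t \<in> J then C t else UNIV) \<inter> (if t \<in> J' then C' t else UNIV)" for t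
  have "a \<inter> b = {\<omega>\<in>space (path_space T). \<forall>t\<in>J\<union>J'. \<omega> t \<in> C'' t}"
    by (auto simp: a b C''_def split: if_splits)
  moreover have "\<forall>t\<in>J\<union>J'. closed (C'' t)" using a b by (auto simp: C''_def)
  ultimately show "a \<inter> b \<in> closed_cylinders T"
    unfolding closed_cylinders_def using a b
    by (intro CollectI exI[of _ "J \<union> J'"] exI[of _ C'']) auto
qed

lemma sets_path_space: "sets (path_space T :: (real \<Rightarrow> 'a::euclidean_space) measure) = sigma_sets (space (path_space T)) (closed_cylinders T)"
proof (rule antisym)
  let ?\<Sigma> = "sigma (space (path_space T)) (closed_cylinders T :: (real \<Rightarrow> 'a) set set)"
  have sub: "(closed_cylinders T :: (real \<Rightarrow> 'a) set set) \<subseteq> Pow (space (path_space T))" by (auto simp: closed_cylinders_def)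
  have "(\<lambda>\<omega>. \<omega>) \<in> ?\<Sigma> \<rightarrow>\<^sub>M path_space T"
  proof (rule measurable_path_spaceI)
    fix t assume t: "t \<in> {-T..T}"
    show "(\<lambda>\<omega>. \<omega> t) \<in> ?\<Sigma> \<rightarrow>\<^sub>M borel"
      unfolding borel_eq_closed
    proof (rule measurable_measure_of)
      fix C :: "'a set" assume "C \<in> Collect closed"
      then have "{\<omega>\<in>space (path_space T). \<forall>s\<in>{t}. \<omega> s \<in> C} \<in> closed_cylinders T"
        unfolding closed_cylinders_def using t by (intro CollectI exI[of _ "{t}"] exI[of _ "\<lambda>_. C"]) auto
      moreover have "(\<lambda>\<omega>. \<omega> t) -` C \<inter> space ?\<Sigma> = {\<omega>\<in>space (path_space T). \<forall>s\<in>{t}. \<omega> s \<in> C}"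
        using sub by auto
      ultimately show "(\<lambda>\<omega>. \<omega> t) -` C \<inter> space ?\<Sigma> \<in> sets ?\<Sigma>"
        using sub by auto
    qed auto
  qed (use sub in \<open>auto\<close>)
  from measurable_sets[OF this] show "sets (path_space T :: (real \<Rightarrow> 'a) measure) \<subseteq> sigma_sets (space (path_space T)) (closed_cylinders T)"
    using sub by (force dest: sets.sets_into_space simp: Int_absorb2)
  show "sigma_sets (space (path_space T)) (closed_cylinders T) \<subseteq> sets (path_space T :: (real \<Rightarrow> 'a) measure)"
  proof (rule sets.sigma_sets_subset, rule subsetI)
    fix A :: "(real \<Rightarrow> 'a) set" assume "A \<in> closed_cylinders T"
    then obtain J C where A: "A = {\<omega>\<in>space (path_space T). \<forall>t\<in>J. \<omega> t \<in> C t}" "finite J" "J \<subseteq> {-T..T}" "\<forall>t\<in>J. closed (C t)"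
      unfolding closed_cylinders_def by auto
    have "{\<omega>\<in>space (path_space T). \<omega> t \<in> C t} \<in> sets (path_space T)" if "t \<in> J" for t
    proof -
      have "(\<lambda>\<omega>. \<omega> t) \<in> path_space T \<rightarrow>\<^sub>M (borel :: 'a measure)" using A that by (intro measurable_path_eval) auto
      from measurable_sets[OF this borel_closed, of "C t"] show ?thesis
        using A that by (simp add: vimage_def Int_def conj_commute)
    qed
    then show "A \<in> sets (path_space T)"
      unfolding A(1) using A(2) by (intro sets.sets_Collect_finite_All) auto
  qed
qed

lemma path_measure_eqI:
  assumes P: "P \<in> space (prob_algebra (path_space T))" and Q: "Q \<in> space (prob_algebra (path_space T))"
    and eq: "\<And>J C. finite J \<Longrightarrow> J \<subseteq> {-T..T} \<Longrightarrow> (\<And>t. t \<in> J \<Longrightarrow> closed (C t)) \<Longrightarrow>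
      emeasure P {\<omega>\<in>space (path_space T). \<forall>t\<in>J. \<omega> t \<in> C t} = emeasure Q {\<omega>\<in>space (path_space T). \<forall>t\<in>J. \<omega> t \<in> C t}"
  shows "P = Q"
proof (rule measure_eqI_generator_eq[OF Int_stable_closed_cylinders, where A="\<lambda>_. space (path_space T)"])
  have sP: "sets P = sets (path_space T)" "prob_space P" and sQ: "sets Q = sets (path_space T)"
    using P Q by (auto simp: space_prob_algebra)
  interpret P: prob_space P by fact
  show "closed_cylinders T \<subseteq> Pow (space (path_space T))" by (auto simp: closed_cylinders_def)
  show "emeasure P X = emeasure Q X" if "X \<in> closed_cylinders T" for X
    using that eq unfolding closed_cylinders_def by blast
  show "range (\<lambda>_. space (path_space T)) \<subseteq> closed_cylinders T"
    by (auto simp: closed_cylinders_def intro!: exI[of _ "{}"])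
  show "sets P = sigma_sets (space (path_space T)) (closed_cylinders T)"
    "sets Q = sigma_sets (space (path_space T)) (closed_cylinders T)"
    by (simp_all add: sP sQ sets_path_space)
  show "emeasure P (space (path_space T)) \<noteq> \<infinity>" using P.emeasure_finite by simp
qed simp

section \<open>Differentiation of measures\<close>

text \<open>In the triangle with vertices 0, \<open>p\<close> and \<open>q\<close> the side opposite
  0 is a longest one, so the angle at 0 is at least 60 degrees, and unit vectors at such an angle
  are at distance at least 1.\<close>

lemma dist_sgn_ge_1:
  fixes p q :: "'a::real_inner"
  assumes "p \<noteq> 0" "q \<noteq> 0" "norm p \<le> norm (p - q)" "norm q \<le> norm (p - q)"
  shows "1 \<le> dist (sgn p) (sgn q)"
proof -
  have eq: "(norm (p - q))\<^sup>2 = (norm p)\<^sup>2 + (norm q)\<^sup>2 - 2 * (p \<bullet> q)"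
    by (simp add: power2_norm_eq_inner inner_diff inner_commute algebra_simps)
  have "(norm p)\<^sup>2 \<le> (norm (p - q))\<^sup>2" "(norm q)\<^sup>2 \<le> (norm (p - q))\<^sup>2"
    using assms by (simp_all add: power_mono)
  then have 1: "2 * (p \<bullet> q) \<le> (norm q)\<^sup>2" "2 * (p \<bullet> q) \<le> (norm p)\<^sup>2" unfolding eq by auto
  have "2 * (p \<bullet> q) \<le> norm p * norm q"
  proof (cases "norm p \<le> norm q")
    case True
    have "(norm p)\<^sup>2 \<le> norm p * norm q" unfolding power2_eq_square using True by (intro mult_left_mono) auto
    then show ?thesis using 1 by linarith
  next
    case False
    have "(norm q)\<^sup>2 \<le> norm p * norm q" unfolding power2_eq_square using False by (intro mult_right_mono) auto
    then show ?thesis using 1 by linarith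
  qed
  then have "2 * (sgn p \<bullet> sgn q) \<le> 1"
    using assms(1,2) by (simp add: sgn_div_norm field_simps)
  moreover have "(dist (sgn p) (sgn q))\<^sup>2 = 2 - 2 * (sgn p \<bullet> sgn q)"
  proof -
    have "sgn p \<bullet> sgn p = 1" "sgn q \<bullet> sgn q = 1"
      using assms(1,2) by (simp_all add: power2_norm_eq_inner[symmetric] norm_sgn)
    then show ?thesis by (simp add: dist_norm power2_norm_eq_inner inner_diff inner_commute)
  qed
  ultimately have "1\<^sup>2 \<le> (dist (sgn p) (sgn q))\<^sup>2" by simp
  then show ?thesis by (rule power2_le_imp_le) simp
qed

text \<open>Finitely many balls of radius 1/2 cover the sphere, and each contains at most one point
  of a set whose points are 1 apart.\<close>

lemma card_separated_sphere_bounded: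
  obtains N :: nat where "\<And>S :: 'a::euclidean_space set. S \<subseteq> sphere 0 1 \<Longrightarrow>
    (\<And>x y. x \<in> S \<Longrightarrow> y \<in> S \<Longrightarrow> x \<noteq> y \<Longrightarrow> 1 \<le> dist x y) \<Longrightarrow> finite S \<and> card S \<le> N"
proof -
  have "compact (sphere 0 1 :: 'a set)" by simp
  then obtain k where k: "finite k" "sphere 0 1 \<subseteq> (\<Union>x\<in>k. ball x (1/2) :: 'a set)"
    by (rule compactE_image[of _ "sphere 0 1" "\<lambda>x. ball x (1/2)"]) (auto intro!: bexI)
  have "finite S \<and> card S \<le> card k" if S: "S \<subseteq> sphere 0 1"
    and sep: "\<And>x y. x \<in> S \<Longrightarrow> y \<in> S \<Longrightarrow> x \<noteq> y \<Longrightarrow> 1 \<le> dist x y" for S :: "'a set"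
  proof -
    have "\<forall>s\<in>S. \<exists>x\<in>k. dist x s < 1/2" using S k(2) by fastforce
    then obtain f where f: "\<And>s. s \<in> S \<Longrightarrow> f s \<in> k" "\<And>s. s \<in> S \<Longrightarrow> dist (f s) s < 1/2" by metis
    have "inj_on f S"
    proof (rule inj_onI, rule ccontr)
      fix x y assume xy: "x \<in> S" "y \<in> S" "f x = f y" "x \<noteq> y"
      have "dist x y \<le> dist (f x) x + dist (f x) y" by (metis dist_commute dist_triangle)
      then show False using sep[OF xy(1,2,4)] f(2)[OF xy(1)] f(2)[OF xy(2)] xy(3) by simp
    qed
    moreover have "f ` S \<subseteq> k" using f by auto
    ultimately show ?thesis using k(1) by (metis card_inj_on_le finite_imageD finite_subset)
  qed
  then show ?thesis using that by blast
qed

text \<open>Seen from \<open>z\<close>, the centres of the balls that contain \<open>z\<close> lie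
  in directions at least 60 degrees apart: the distance from a centre to \<open>z\<close> is below
  its radius, which is at most its distance to any other centre. So the bound depends on the
  dimension alone. A centre at \<open>z\<close> itself excludes all others, whence
  \<open>max 1 N\<close>.\<close>

lemma separated_balls_bounded_overlap:
  obtains N :: nat where "\<And>(S :: 'a::euclidean_space set) r z.
    (\<And>s s'. s \<in> S \<Longrightarrow> s' \<in> S \<Longrightarrow> s \<noteq> s' \<Longrightarrow> r s \<le> dist s s') \<Longrightarrow>
    finite {s\<in>S. z \<in> ball s (r s)} \<and> card {s\<in>S. z \<in> ball s (r s)} \<le> N"
proof -
  obtain N :: nat where N: "\<And>S :: 'a set. S \<subseteq> sphere 0 1 \<Longrightarrow>
    (\<And>x y. x \<in> S \<Longrightarrow> y \<in> S \<Longrightarrow> x \<noteq> y \<Longrightarrow> 1 \<le> dist x y) \<Longrightarrow> finite S \<and> card S \<le> N"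
    using card_separated_sphere_bounded by blast
  have "finite {s\<in>S. z \<in> ball s (r s)} \<and> card {s\<in>S. z \<in> ball s (r s)} \<le> max 1 N"
    if sep: "\<And>s s'. s \<in> S \<Longrightarrow> s' \<in> S \<Longrightarrow> s \<noteq> s' \<Longrightarrow> r s \<le> dist s s'" for S :: "'a set" and r z
  proof -
    define A where "A = {s\<in>S. z \<in> ball s (r s)}"
    show ?thesis
    proof (cases "z \<in> A")
      case True
      have "A \<subseteq> {z}"
      proof
        fix s assume s: "s \<in> A"
        show "s \<in> {z}"
          using sep[of s z] s True by (force simp: A_def)
      qed
      then have "finite A" "card A \<le> 1" using finite_subset card_mono[of "{z}" A] by auto
      then show ?thesis unfolding A_def by auto
    next
      case False
      define u where "u s = sgn (s - z)" for s
      have d: "1 \<le> dist (u s) (u s')" if "s \<in> A" "s' \<in> A" "s \<noteq> s'" for s s'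
        unfolding u_def
      proof (rule dist_sgn_ge_1)
        show "s - z \<noteq> 0" "s' - z \<noteq> 0" using that False by auto
        have "norm (s - z) < r s" "norm (s' - z) < r s'" using that by (auto simp: A_def dist_norm)
        moreover have "r s \<le> norm (s - z - (s' - z))" "r s' \<le> norm (s - z - (s' - z))"
          using sep[of s s'] sep[of s' s] that by (auto simp: A_def dist_norm norm_minus_commute)
        ultimately show "norm (s - z) \<le> norm (s - z - (s' - z))" "norm (s' - z) \<le> norm (s - z - (s' - z))"
          by linarith+
      qed
      have inj: "inj_on u A" by (rule inj_onI) (use d in force)
      have "finite (u ` A) \<and> card (u ` A) \<le> N"
      proof (rule N)
        show "u ` A \<subseteq> sphere 0 1" using False by (auto simp: u_def norm_sgn)
        show "1 \<le> dist x y" if "x \<in> u ` A" "y \<in> u ` A" "x \<noteq> y" for x y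
          using that d by auto
      qed
      then have "finite A" "card A \<le> N" using inj by (auto simp: card_image dest: finite_imageD)
      then show ?thesis unfolding A_def by auto
    qed
  qed
  then show ?thesis using that by blast
qed

text \<open>Zorn's lemma gives a separated set that is maximal for inclusion, and maximality gives
  the covering: a point of \<open>A\<close> at distance at least \<open>r\<close> from all of
  \<open>S\<close> could be added.\<close>

lemma maximal_separated_subset:
  fixes A :: "'a::metric_space set"
  assumes "0 < r"
  obtains S where "S \<subseteq> A" "\<And>s s'. s \<in> S \<Longrightarrow> s' \<in> S \<Longrightarrow> s \<noteq> s' \<Longrightarrow> r \<le> dist s s'"
    "\<And>y. y \<in> A \<Longrightarrow> \<exists>s\<in>S. dist s y < r"
proof -
  define F where "F = {S. S \<subseteq> A \<and> (\<forall>s\<in>S. \<forall>s'\<in>S. s \<noteq> s' \<longrightarrow> r \<le> dist s s')}"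
  have "\<exists>S\<in>F. \<forall>X\<in>F. S \<subseteq> X \<longrightarrow> X = S"
  proof (rule subset_Zorn_nonempty)
    show "F \<noteq> {}" by (auto simp: F_def)
    fix C assume C: "C \<noteq> {}" "subset.chain F C"
    show "\<Union>C \<in> F"
      unfolding F_def
    proof (intro CollectI conjI ballI impI)
      show "\<Union>C \<subseteq> A" using C(2) by (auto simp: subset_chain_def F_def)
      fix s s' assume "s \<in> \<Union>C" "s' \<in> \<Union>C" and ne: "s \<noteq> s'"
      then obtain X Y where "X \<in> C" "Y \<in> C" "s \<in> X" "s' \<in> Y" by auto
      moreover have "X \<subseteq> Y \<or> Y \<subseteq> X" using C(2) \<open>X \<in> C\<close> \<open>Y \<in> C\<close> by (auto simp: subset_chain_def)
      ultimately obtain Z where "Z \<in> C" "s \<in> Z" "s' \<in> Z" by blast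
      then show "r \<le> dist s s'" using C(2) ne by (auto simp: subset_chain_def F_def)
    qed
  qed
  then obtain S where S: "S \<in> F" and max: "\<And>X. X \<in> F \<Longrightarrow> S \<subseteq> X \<Longrightarrow> X = S" by blast
  have "\<exists>s\<in>S. dist s y < r" if "y \<in> A" for y
  proof (rule ccontr)
    assume n: "\<not> (\<exists>s\<in>S. dist s y < r)"
    then have "insert y S \<in> F" using S that by (auto simp: F_def dist_commute not_less)
    then have "y \<in> S" using max by blast
    then show False using n assms by auto
  qed
  then show ?thesis using S that by (auto simp: F_def)
qed

text \<open>The finite-radii form of the Besicovitch covering lemma: choose balls greedily by decreasing radius.\<close>

lemma greedy_separated_cover:
  fixes E :: "'a::metric_space set" and \<rho> :: "'a \<Rightarrow> real"
  assumes "finite R" "\<And>r. r \<in> R \<Longrightarrow> 0 < r" "\<And>y. y \<in> E \<Longrightarrow> \<rho> y \<in> R"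
  shows "\<exists>S\<subseteq>E. E \<subseteq> (\<Union>s\<in>S. ball s (\<rho> s)) \<and>
    (\<forall>s\<in>S. \<forall>s'\<in>S. s \<noteq> s' \<longrightarrow> \<rho> s \<le> dist s s')"
  using assms
proof (induction R arbitrary: E rule: finite_linorder_max_induct)
  case empty
  then show ?case by auto
next
  case (insert b R)
  define A where "A = {y\<in>E. \<rho> y = b}"
  have "0 < b" using insert by auto
  obtain S where S: "S \<subseteq> A" "\<And>s s'. s \<in> S \<Longrightarrow> s' \<in> S \<Longrightarrow> s \<noteq> s' \<Longrightarrow> b \<le> dist s s'"
    "\<And>y. y \<in> A \<Longrightarrow> \<exists>s\<in>S. dist s y < b"
    using maximal_separated_subset[OF \<open>0 < b\<close>, of A] by blast
  \<comment> \<open>Discarding what the largest balls already cover keeps later centres at distance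
    at least \<open>b\<close> from the earlier ones, and \<open>b\<close> is at least as large as
    either radius.\<close>
  define E' where "E' = {y\<in>E. \<rho> y \<in> R \<and> y \<notin> (\<Union>s\<in>S. ball s b)}"
  have "\<exists>S'\<subseteq>E'. E' \<subseteq> (\<Union>s\<in>S'. ball s (\<rho> s)) \<and> (\<forall>s\<in>S'. \<forall>s'\<in>S'. s \<noteq> s' \<longrightarrow> \<rho> s \<le> dist s s')"
    using insert by (intro insert.IH) (auto simp: E'_def)
  then obtain S' where S': "S' \<subseteq> E'" "E' \<subseteq> (\<Union>s\<in>S'. ball s (\<rho> s))"
    and sep': "\<forall>s\<in>S'. \<forall>s'\<in>S'. s \<noteq> s' \<longrightarrow> \<rho> s \<le> dist s s'" by (elim exE conjE)
  have \<rho>S: "\<rho> s = b" if "s \<in> S" for s using that S(1) by (auto simp: A_def)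
  have \<rho>S': "\<rho> s < b" if "s \<in> S'" for s using that S'(1) insert by (auto simp: E'_def)
  have far: "b \<le> dist s s'" if "s \<in> S" "s' \<in> S'" for s s'
    using that S'(1) by (auto simp: E'_def not_less)
  show ?case
  proof (intro exI[of _ "S \<union> S'"] conjI ballI impI)
    show "S \<union> S' \<subseteq> E" using S(1) S'(1) by (auto simp: A_def E'_def)
    show "E \<subseteq> (\<Union>s\<in>S \<union> S'. ball s (\<rho> s))"
    proof
      fix y assume y: "y \<in> E"
      show "y \<in> (\<Union>s\<in>S \<union> S'. ball s (\<rho> s))"
      proof (cases "y \<in> A \<or> y \<in> (\<Union>s\<in>S. ball s b)")
        case True
        then obtain s where "s \<in> S" "dist s y < b" using S(3) by auto
        then show ?thesis using \<rho>S by auto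
      next
        case False
        then have "y \<in> E'" using y insert.prems by (auto simp: E'_def A_def)
        then show ?thesis using S'(2) by auto
      qed
    qed
    fix s s' assume "s \<in> S \<union> S'" "s' \<in> S \<union> S'" "s \<noteq> s'"
    then consider "s \<in> S" "s' \<in> S" | "s \<in> S" "s' \<in> S'" | "s \<in> S'" "s' \<in> S" | "s \<in> S'" "s' \<in> S'" by auto
    then show "\<rho> s \<le> dist s s'"
    proof cases
      case 3
      then show ?thesis using far[of s' s] \<rho>S'[of s] by (simp add: dist_commute)
    qed (use S(2) sep' \<rho>S far \<open>s \<noteq> s'\<close> in auto)
  qed
qed

section \<open>Maximal inequality and differentiation for arbitrary finite Borel measures\<close>

lemma borel_measurable_measure_ball:
  assumes "finite_measure M" and sM: "sets M = sets (borel :: 'a::euclidean_space measure)" and D: "D \<in> sets borel"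
  shows "(\<lambda>y. measure M (D \<inter> ball y r)) \<in> borel_measurable borel"
proof -
  interpret finite_measure M by fact
  note sM[measurable_cong] D[measurable]
  have spM: "space M = UNIV" using sets_eq_imp_space_eq[OF sM] by simp
  define Q where "Q = {z\<in>space (borel \<Otimes>\<^sub>M M). snd z \<in> D \<and> dist (fst z) (snd z) < r}"
  have Q: "Q \<in> sets (borel \<Otimes>\<^sub>M M)" unfolding Q_def by measurable
  have "(\<lambda>y. emeasure M (Pair y -` Q)) \<in> borel_measurable borel"
    by (rule measurable_emeasure_Pair[OF Q])
  moreover have "Pair y -` Q = D \<inter> ball y r" for y
    by (auto simp: Q_def space_pair_measure spM)
  ultimately have "(\<lambda>y. emeasure M (D \<inter> ball y r)) \<in> borel_measurable borel" by simp
  then show ?thesis unfolding measure_def by measurable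
qed

text \<open>Rational radii keep the exceptional sets measurable. As \<open>measure M (ball y r)\<close> is left-continuous in \<open>r\<close>, they
  are enough to control the limit over all radii.\<close>

definition maximal_superlevel :: "'a::metric_space measure \<Rightarrow> 'a set \<Rightarrow> real \<Rightarrow> 'a set" where
  "maximal_superlevel M D t = {y. \<exists>r\<in>\<rat>. 0 < r \<and> t * measure M (ball y r) \<le> measure M (D \<inter> ball y r)}"

text \<open>Bounded overlap of balls at their own radii replaces the enlarged balls of Vitali's
  lemma, so the constant is uniform over all finite measures. A finite set of radii lets the greedy
  choice start from a largest one; inner regularity reduces to compact sets, which finitely many of
  the balls cover; an increasing union over finite sets of radii reaches all positive
  rationals.\<close>

theorem centred_maximal_weak_type:
  obtains N :: nat where "\<And>(M :: 'a::euclidean_space measure) D t. finite_measure M \<Longrightarrow> sets M = sets borel \<Longrightarrow>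
    D \<in> sets borel \<Longrightarrow> 0 < t \<Longrightarrow>
    maximal_superlevel M D t \<in> sets borel \<and>
    emeasure M (maximal_superlevel M D t) \<le> ennreal (N * measure M D / t)"
proof -
  obtain N :: nat where N: "\<And>(S :: 'a set) r z.
    (\<And>s s'. s \<in> S \<Longrightarrow> s' \<in> S \<Longrightarrow> s \<noteq> s' \<Longrightarrow> r s \<le> dist s s') \<Longrightarrow>
    finite {s\<in>S. z \<in> ball s (r s)} \<and> card {s\<in>S. z \<in> ball s (r s)} \<le> N"
    using separated_balls_bounded_overlap by blast
  show ?thesis
  proof (rule that[of N], goal_cases)
    case (1 M D t)
    interpret finite_measure M by fact
    note sM[measurable_cong] = 1(2) and D[measurable] = 1(3)
    have spM: "space M = UNIV" using sets_eq_imp_space_eq[OF sM] by simp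
    define E where "E R = {y. \<exists>r\<in>R. t * measure M (ball y r) \<le> measure M (D \<inter> ball y r)}" for R
    have m: "(\<lambda>y. measure M (D \<inter> ball y r)) \<in> borel_measurable borel"
      "(\<lambda>y. measure M (ball y r)) \<in> borel_measurable borel" for r
      using borel_measurable_measure_ball[OF \<open>finite_measure M\<close> sM D, of r]
        borel_measurable_measure_ball[OF \<open>finite_measure M\<close> sM, of UNIV r] by auto
    have Emeas: "E R \<in> sets borel" if "countable R" for R
    proof -
      have "E R = (\<Union>r\<in>R. {y. t * measure M (ball y r) \<le> measure M (D \<inter> ball y r)})" by (auto simp: E_def)
      moreover have "{y. t * measure M (ball y r) \<le> measure M (D \<inter> ball y r)} \<in> sets borel" for r
        using borel_measurable_le[OF borel_measurable_times[OF borel_measurable_const m(2)] m(1), of t r r] by simp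
      ultimately show ?thesis using that by (auto intro!: sets.countable_UN'')
    qed
    have fin: "emeasure M (E R) \<le> ennreal (N * measure M D / t)" if R: "finite R" "\<And>r. r \<in> R \<Longrightarrow> 0 < r" for R
    proof -
      have "emeasure M K \<le> ennreal (N * measure M D / t)" if K: "K \<subseteq> E R" "compact K" for K
      proof -
        have "\<forall>y\<in>K. \<exists>r\<in>R. t * measure M (ball y r) \<le> measure M (D \<inter> ball y r)"
          using K by (auto simp: E_def)
        then obtain \<rho> where \<rho>: "\<And>y. y \<in> K \<Longrightarrow> \<rho> y \<in> R"
          "\<And>y. y \<in> K \<Longrightarrow> t * measure M (ball y (\<rho> y)) \<le> measure M (D \<inter> ball y (\<rho> y))" by metis
        obtain S where S: "S \<subseteq> K" "K \<subseteq> (\<Union>s\<in>S. ball s (\<rho> s))"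
          "\<And>s s'. s \<in> S \<Longrightarrow> s' \<in> S \<Longrightarrow> s \<noteq> s' \<Longrightarrow> \<rho> s \<le> dist s s'"
          using greedy_separated_cover[of R K \<rho>, OF R \<rho>(1)] by blast
        obtain S0 where S0: "S0 \<subseteq> S" "finite S0" "K \<subseteq> (\<Union>s\<in>S0. ball s (\<rho> s))"
          using compactE_image[OF K(2), of S "\<lambda>s. ball s (\<rho> s)"] S(2) by auto
        have [measurable]: "K \<in> sets borel" using K(2) by (rule borel_compact)
        have "measure M K \<le> measure M (\<Union>s\<in>S0. ball s (\<rho> s))"
          using S0 by (intro finite_measure_mono) auto
        also have "\<dots> \<le> (\<Sum>s\<in>S0. measure M (ball s (\<rho> s)))"
          using S0 by (intro finite_measure_subadditive_finite) auto
        finally have "t * measure M K \<le> (\<Sum>s\<in>S0. t * measure M (ball s (\<rho> s)))"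
          using \<open>0 < t\<close> by (simp add: sum_distrib_left[symmetric])
        also have "\<dots> \<le> (\<Sum>s\<in>S0. measure M (D \<inter> ball s (\<rho> s)))"
          using S0 S by (intro sum_mono \<rho>) auto
        \<comment> \<open>The sum is the integral of the multiplicity with which the chosen balls
          cover a point of \<open>D\<close>, and the overlap bound limits that multiplicity to
          \<open>N\<close>.\<close>
        also have "\<dots> = (\<integral>z. (\<Sum>s\<in>S0. indicator (D \<inter> ball s (\<rho> s)) z) \<partial>M)"
          by (subst Bochner_Integration.integral_sum) (auto simp: less_top[symmetric])
        also have "\<dots> \<le> (\<integral>z. real N * indicator D z \<partial>M)"
        proof (rule integral_mono)
          fix z
          have "(\<Sum>s\<in>S0. indicator (D \<inter> ball s (\<rho> s)) z) = indicator D z * real (card {s\<in>S0. z \<in> ball s (\<rho> s)})"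
            using S0(2) by (auto simp: indicator_def sum.If_cases Int_def)
          also have "\<dots> \<le> indicator D z * real N"
            using N[of S0 \<rho> z] S(3) S0(1) by (intro mult_left_mono) (auto simp: subset_eq)
          finally show "(\<Sum>s\<in>S0. indicator (D \<inter> ball s (\<rho> s)) z) \<le> real N * indicator D z" by (simp add: mult.commute)
        qed (auto intro!: Bochner_Integration.integrable_sum simp: less_top[symmetric])
        also have "\<dots> = N * measure M D" by (simp add: spM)
        finally have "measure M K \<le> N * measure M D / t" using \<open>0 < t\<close> by (simp add: field_simps)
        then show ?thesis by (simp add: emeasure_eq_measure ennreal_leI)
      qed
      moreover have "emeasure M (E R) = (SUP K \<in> {K. K \<subseteq> E R \<and> compact K}. emeasure M K)"
        using sM emeasure_finite Emeas[of R] R(1) by (intro inner_regular) (auto simp: spM countable_finite)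
      ultimately show ?thesis by (auto intro!: SUP_least)
    qed
    define q where "q = from_nat_into {r\<in>\<rat>. 0 < (r::real)}"
    have cq: "countable {r\<in>\<rat>. 0 < (r::real)}" using countable_rat by (rule countable_subset[rotated]) auto
    have neq: "{r\<in>\<rat>. 0 < (r::real)} \<noteq> {}" using Rats_1 by force
    have q: "q n \<in> {r\<in>\<rat>. 0 < r}" for n unfolding q_def by (rule from_nat_into[OF neq])
    have rq: "{r\<in>\<rat>. 0 < r} = range q" unfolding q_def using range_from_nat_into[OF neq cq] by simp
    have eqE: "maximal_superlevel M D t = E {r\<in>\<rat>. 0 < r}"
      by (auto simp: E_def maximal_superlevel_def)
    have un: "E {r\<in>\<rat>. 0 < r} = (\<Union>n. E (q ` {..n}))" by (auto simp: E_def rq)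
    have "emeasure M (\<Union>n. E (q ` {..n})) = (SUP n. emeasure M (E (q ` {..n})))"
    proof (rule SUP_emeasure_incseq[symmetric])
      show "range (\<lambda>n. E (q ` {..n})) \<subseteq> sets M" by (auto simp: sM intro!: Emeas countable_finite)
      show "incseq (\<lambda>n. E (q ` {..n}))" by (rule incseq_SucI) (auto simp: E_def)
    qed
    also have "\<dots> \<le> ennreal (N * measure M D / t)" using q by (intro SUP_least fin) auto
    finally show ?case unfolding eqE using un Emeas[OF cq] by simp
  qed
qed

text \<open>An open set around \<open>A\<close> with small excess measure turns failure of density
  into largeness of a maximal function: small balls around a point of \<open>A\<close> lie inside
  the open set, so what they contain outside \<open>A\<close> belongs to the excess. The weak-type
  bound then makes the set of bad points arbitrarily small.\<close>

theorem AE_density_point: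
  fixes M :: "'a::euclidean_space measure"
  assumes M: "finite_measure M" and sM: "sets M = sets borel" and A: "A \<in> sets borel"
  shows "AE y in M. y \<in> A \<longrightarrow> (\<forall>k::nat. \<exists>n::nat. \<forall>r\<in>\<rat>. 0 < r \<and> r < 1/Suc n \<longrightarrow>
     measure M (ball y r - A) < measure M (ball y r) / Suc k)"
proof -
  interpret finite_measure M by fact
  note sM[measurable_cong] A[measurable]
  obtain N :: nat where "\<And>(M :: 'a measure) D t. finite_measure M \<Longrightarrow> sets M = sets borel \<Longrightarrow>
    D \<in> sets borel \<Longrightarrow> 0 < t \<Longrightarrow>
    maximal_superlevel M D t \<in> sets borel \<and>
    emeasure M (maximal_superlevel M D t) \<le> ennreal (N * measure M D / t)"
    by (rule centred_maximal_weak_type, erule that)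
  note N = this[OF M sM]
  define g1 where "g1 r y = measure M (- A \<inter> ball y r)" for r y
  define g2 where "g2 r y = measure M (ball y r)" for r y
  have [measurable]: "g1 r \<in> borel_measurable borel" "g2 r \<in> borel_measurable borel" for r
    unfolding g1_def[abs_def] g2_def[abs_def] using borel_measurable_measure_ball[OF M sM, of "-A" r] borel_measurable_measure_ball[OF M sM, of UNIV r] by auto
  have "AE y in M. y \<in> A \<longrightarrow> (\<exists>n::nat. \<forall>r\<in>\<rat>. 0 < r \<and> r < 1/Suc n \<longrightarrow>
     measure M (ball y r - A) < measure M (ball y r) / Suc k)" for k :: nat
  proof -
    define Z where "Z = {y\<in>A. \<forall>n::nat. \<exists>r\<in>\<rat>. 0 < r \<and> r < 1/Suc n \<and>
      measure M (ball y r) / Suc k \<le> measure M (- A \<inter> ball y r)}"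
    have Z[measurable]: "Z \<in> sets borel" unfolding Z_def g1_def[symmetric] g2_def[symmetric] using countable_rat by measurable
    \<comment> \<open>The factor \<open>N * Suc k\<close> is the weak-type constant at level
      \<open>1 / Suc k\<close>.\<close>
    have le: "measure M Z \<le> N * Suc k * \<eta>" if "0 < \<eta>" for \<eta> :: real
    proof -
      have "emeasure M A = (INF U \<in> {U. A \<subseteq> U \<and> open U}. emeasure M U)"
        by (rule outer_regular[OF sM _ A]) simp
      moreover have "emeasure M A < emeasure M A + ennreal \<eta>"
        using that by (simp add: emeasure_eq_measure ennreal_plus[symmetric] ennreal_less_iff del: ennreal_plus)
      ultimately obtain O' where O': "A \<subseteq> O'" "open O'" "emeasure M O' < emeasure M A + ennreal \<eta>"
        by (auto simp: INF_less_iff)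
      have [measurable]: "O' \<in> sets borel" using O' by auto
      have "measure M O' < measure M A + \<eta>"
        using O'(3) that by (simp add: emeasure_eq_measure ennreal_plus[symmetric] ennreal_less_iff del: ennreal_plus)
      then have m: "measure M (O' - A) \<le> \<eta>" using O'(1) by (subst finite_measure_Diff) auto
      have "Z \<subseteq> maximal_superlevel M (O' - A) (1 / Suc k)"
      proof
        fix y assume y: "y \<in> Z"
        then have "y \<in> O'" using O' by (auto simp: Z_def)
        then obtain e where e: "e > 0" "ball y e \<subseteq> O'" using O'(2) open_contains_ball by blast
        obtain n where n: "1/Suc n < e" using e nat_approx_posE by blast
        obtain r where r: "r \<in> \<rat>" "0 < r" "r < 1/Suc n" "measure M (ball y r) / Suc k \<le> measure M (- A \<inter> ball y r)"
          using y unfolding Z_def by blast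
        have "ball y r \<subseteq> ball y e" using r n by (intro subset_ball) linarith
        then have "(O' - A) \<inter> ball y r = - A \<inter> ball y r" using e by auto
        then show "y \<in> maximal_superlevel M (O' - A) (1 / Suc k)"
          using r by (auto simp: maximal_superlevel_def)
      qed
      then have "emeasure M Z \<le> emeasure M (maximal_superlevel M (O' - A) (1 / Suc k))"
        using N[of "O' - A" "1 / Suc k"] by (intro emeasure_mono) (auto simp: sM)
      also have "\<dots> \<le> ennreal (N * measure M (O' - A) / (1 / Suc k))" using N[of "O' - A" "1 / Suc k"] by auto
      also have "\<dots> \<le> ennreal (N * Suc k * \<eta>)"
      proof (rule ennreal_leI)
        have "real N * measure M (O' - A) * Suc k \<le> real N * \<eta> * Suc k"
          using m by (intro mult_right_mono mult_left_mono) auto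
        then show "real N * measure M (O' - A) / (1 / real (Suc k)) \<le> real (N * Suc k) * \<eta>"
          by (simp only: of_nat_mult) (simp add: mult_ac del: of_nat_Suc)
      qed
      finally show ?thesis using that by (simp add: emeasure_eq_measure)
    qed
    have "measure M Z \<le> 0"
    proof (rule field_le_epsilon)
      fix e :: real assume e: "0 < e"
      define c where "c = real (N * Suc k)"
      have c: "0 \<le> c" by (simp add: c_def)
      \<comment> \<open>Dividing by \<open>c + 1\<close> covers the case
        \<open>c = 0\<close>.\<close>
      have "measure M Z \<le> c * (e / (c + 1))"
        using e c le[of "e / (c + 1)", folded c_def] by simp
      also have "\<dots> \<le> e"
        using e c by (simp add: divide_le_eq algebra_simps)
      finally show "measure M Z \<le> 0 + e" by simp
    qed
    then have "Z \<in> null_sets M" by (auto simp: null_sets_def sM emeasure_eq_measure measure_le_0_iff)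
    then have "AE y in M. y \<notin> Z" by (rule AE_not_in)
    then show ?thesis
    proof eventually_elim
      case (elim y)
      have "ball y r - A = - A \<inter> ball y r" for r by auto
      then show ?case using elim by (auto simp: Z_def not_le)
    qed
  qed
  then have "AE y in M. \<forall>k::nat. y \<in> A \<longrightarrow> (\<exists>n::nat. \<forall>r\<in>\<rat>. 0 < r \<and> r < 1/Suc n \<longrightarrow>
     measure M (ball y r - A) < measure M (ball y r) / Suc k)"
    by (simp only: AE_all_countable) blast
  then show ?thesis by eventually_elim blast
qed

text \<open>Density points of the level bands of \<open>f\<close> suffice: within a band
  \<open>f\<close> varies by at most \<open>1/K\<close>, and the part of a small ball outside the
  band has less than the fraction \<open>1/K\<close> of its mass. The strict inequality also
  contains the positivity of the mass of small balls, on which conditioning on them relies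
  later.\<close>

theorem AE_differentiation:
  fixes M :: "'a::euclidean_space measure"
  assumes M: "finite_measure M" and sM: "sets M = sets borel"
    and f: "f \<in> borel_measurable borel" and f01: "\<And>y. 0 \<le> f y \<and> f y \<le> 1"
  shows "AE y in M. \<forall>k::nat. \<exists>n::nat. \<forall>r\<in>\<rat>. 0 < r \<and> r < 1/Suc n \<longrightarrow>
     \<bar>(LINT z:ball y r|M. f z) - f y * measure M (ball y r)\<bar> < measure M (ball y r) / Suc k"
proof -
  interpret finite_measure M by fact
  note sM[measurable_cong] f[measurable]
  have spM: "space M = UNIV" using sets_eq_imp_space_eq[OF sM] by simp
  have "AE y in M. \<exists>n::nat. \<forall>r\<in>\<rat>. 0 < r \<and> r < 1/Suc n \<longrightarrow>
     \<bar>(LINT z:ball y r|M. f z) - f y * measure M (ball y r)\<bar> < measure M (ball y r) / Suc k" for k :: nat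
  proof -
    \<comment> \<open>\<open>K = 2 * (1 + real k)\<close>, so that two errors of \<open>1/K\<close>
      add up to \<open>1 / Suc k\<close>; written as a successor to match the density statement with
      index \<open>2 * k + 1\<close>.\<close>
    define K where "K = real (Suc (2 * k + 1))"
    have K: "K = 2 * (1 + real k)" "0 < K" by (auto simp: K_def)
    define A where "A j = {y. \<lfloor>K * f y\<rfloor> = j}" for j
    have [measurable]: "A j \<in> sets borel" for j unfolding A_def by measurable
    have "AE y in M. \<forall>j. y \<in> A j \<longrightarrow> (\<forall>k::nat. \<exists>n::nat. \<forall>r\<in>\<rat>. 0 < r \<and> r < 1/Suc n \<longrightarrow>
     measure M (ball y r - A j) < measure M (ball y r) / Suc k)"
      unfolding AE_all_countable by (intro allI AE_density_point M sM) measurable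
    then show ?thesis
    proof eventually_elim
      case (elim y)
      define j where "j = \<lfloor>K * f y\<rfloor>"
      have "y \<in> A j" by (simp add: A_def j_def)
      then obtain n :: nat where n: "\<And>r. r\<in>\<rat> \<Longrightarrow> 0 < r \<Longrightarrow> r < 1/Suc n \<Longrightarrow>
          measure M (ball y r - A j) < measure M (ball y r) / K"
        using elim unfolding K_def by blast
      have "\<bar>(LINT z:ball y r|M. f z) - f y * measure M (ball y r)\<bar> < measure M (ball y r) / Suc k"
        if r: "r\<in>\<rat>" "0 < r" "r < 1/Suc n" for r
      proof -
        have int[simp]: "integrable M (\<lambda>z. indicator B z * g z)" if [measurable]: "B \<in> sets borel" "g \<in> borel_measurable borel"
          and "\<And>z. \<bar>g z\<bar> \<le> 1" for B and g :: "'a \<Rightarrow> real"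
          by (rule integrable_const_bound[where B=1]) (use that in \<open>auto simp: indicator_def\<close>)
        have ff: "\<bar>f z\<bar> \<le> 1" "\<bar>f y\<bar> \<le> 1" "\<bar>f z - f y\<bar> \<le> 1" for z using f01[of z] f01[of y] by auto
        have "(LINT z:ball y r|M. f z) - f y * measure M (ball y r) = (\<integral>z. indicator (ball y r) z * f z \<partial>M) - (\<integral>z. indicator (ball y r) z * f y \<partial>M)"
          by (simp add: set_lebesgue_integral_def spM mult.commute)
        also have "\<dots> = (\<integral>z. indicator (ball y r) z * (f z - f y) \<partial>M)"
          by (subst Bochner_Integration.integral_diff[OF int int, symmetric]) (auto simp: ff right_diff_distrib)
        also have "\<bar>\<dots>\<bar> \<le> (\<integral>z. \<bar>indicator (ball y r) z * (f z - f y)\<bar> \<partial>M)"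
          by (rule integral_abs_bound)
        also have "\<dots> \<le> (\<integral>z. indicator (ball y r) z * (1/K) + indicator (ball y r - A j) z \<partial>M)"
        proof (rule integral_mono)
          show "integrable M (\<lambda>z. \<bar>indicator (ball y r) z * (f z - f y)\<bar>)"
            by (intro integrable_abs int) (auto simp: ff)
          have "integrable M (\<lambda>z. indicator (ball y r) z * (1/K))" using K by (intro int) auto
          then show "integrable M (\<lambda>z. indicator (ball y r) z * (1/K) + indicator (ball y r - A j) z)"
            by (intro Bochner_Integration.integrable_add) (auto simp: less_top[symmetric])
          fix z
          have "\<bar>f z - f y\<bar> \<le> 1/K" if "z \<in> A j"
          proof -
            have "\<bar>K * f z - K * f y\<bar> \<le> 1" using that unfolding A_def j_def by simp linarith
            then have "K * \<bar>f z - f y\<bar> \<le> 1" using K by (simp add: abs_mult right_diff_distrib[symmetric])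
            then show ?thesis using K by (simp add: field_simps)
          qed
          then show "\<bar>indicator (ball y r) z * (f z - f y)\<bar> \<le> indicator (ball y r) z * (1/K) + indicator (ball y r - A j) z"
            using order_trans[OF ff(3)[of z], of "1/K + 1"] K by (cases "z \<in> A j"; cases "z \<in> ball y r") (auto simp: indicator_def)
        qed
        also have "\<dots> = measure M (ball y r) / K + measure M (ball y r - A j)"
          using K by (subst Bochner_Integration.integral_add) (auto simp: spM less_top[symmetric])
        also have "\<dots> < measure M (ball y r) / K + measure M (ball y r) / K"
          using n[OF r] by simp
        also have "measure M (ball y r) / K = measure M (ball y r) / Suc k / 2" by (simp add: K(1))
        also have "measure M (ball y r) / Suc k / 2 + measure M (ball y r) / Suc k / 2 = measure M (ball y r) / Suc k" by (rule field_sum_of_halves)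
        finally show ?thesis .
      qed
      then show ?case by blast
    qed
  qed
  then show ?thesis by (simp only: AE_all_countable) blast
qed

section \<open>Weak convergence on path space\<close>

text \<open>Openness of the time window has two uses: rational times are dense in its intersection
  with the interval, which gives measurability, and compactness leaves finitely many windows that
  cover the interval. The non-strict bound passes to limits in time.\<close>

definition tube :: "real \<Rightarrow> real \<Rightarrow> real \<Rightarrow> 'a \<Rightarrow> real \<Rightarrow> (real \<Rightarrow> 'a::euclidean_space) set" where
  "tube T p q v r = {\<omega>\<in>space (path_space T). \<forall>t\<in>{-T..T} \<inter> {p<..<q}. dist (\<omega> t) v \<le> r}"

lemma sets_tube:
  fixes v :: "'a::euclidean_space"
  assumes T: "0 < T"
  shows "tube T p q v r \<in> sets (path_space T)"
proof -
  define Q where "Q = {t\<in>\<rat>. t \<in> {-T..T} \<inter> {p<..<q}}"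
  have cQ: "countable Q" unfolding Q_def using countable_rat by (rule countable_subset[rotated]) auto
  have "tube T p q v r = {\<omega>\<in>space (path_space T). \<forall>t\<in>Q. dist (\<omega> t) v \<le> r}"
  proof (intro equalityI subsetI)
    fix \<omega> assume \<omega>: "\<omega> \<in> {\<omega>\<in>space (path_space T). \<forall>t\<in>Q. dist (\<omega> t) v \<le> r}"
    then have c: "continuous_on {-T..T} \<omega>" by (simp add: space_path_space)
    have "dist (\<omega> t) v \<le> r" if t: "t \<in> {-T..T} \<inter> {p<..<q}" for t
    proof -
      obtain s where s: "\<And>n. s n \<in> \<rat> \<inter> {-T..T}" "s \<longlonglongrightarrow> t"
        using rational_times_dense[OF T, of t] t by blast
      have "(\<lambda>n. \<omega> (s n)) \<longlonglongrightarrow> \<omega> t"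
        by (rule continuous_on_tendsto_compose[OF c s(2)]) (use s t in auto)
      then have lim: "(\<lambda>n. dist (\<omega> (s n)) v) \<longlonglongrightarrow> dist (\<omega> t) v" by (intro tendsto_intros)
      have "\<forall>\<^sub>F n in sequentially. s n \<in> {p<..<q}"
        by (rule topological_tendstoD[OF s(2)]) (use t in auto)
      then have "\<forall>\<^sub>F n in sequentially. dist (\<omega> (s n)) v \<le> r"
        by eventually_elim (use s \<omega> in \<open>auto simp: Q_def\<close>)
      then show ?thesis by (intro tendsto_upperbound[OF lim]) auto
    qed
    then show "\<omega> \<in> tube T p q v r" using \<omega> by (auto simp: tube_def)
  qed (auto simp: tube_def Q_def)
  also have "\<dots> \<in> sets (path_space T)"
  proof (rule sets.sets_Collect_countable_All'[OF _ cQ])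
    fix t assume "t \<in> Q"
    then have [measurable]: "(\<lambda>\<omega>. \<omega> t) \<in> path_space T \<rightarrow>\<^sub>M (borel :: 'a measure)"
      by (intro measurable_path_eval) (auto simp: Q_def)
    show "{\<omega>\<in>space (path_space T). dist (\<omega> t) v \<le> r} \<in> sets (path_space T)" by measurable
  qed
  finally show ?thesis .
qed

definition tubes :: "real \<Rightarrow> 'a set \<Rightarrow> (real \<Rightarrow> 'a::euclidean_space) set set" where
  "tubes T D = {tube T p q v r | p q v r. p \<in> \<rat> \<and> q \<in> \<rat> \<and> r \<in> \<rat> \<and> v \<in> D}"

lemma countable_tubes:
  assumes "countable D"
  shows "countable (tubes T D)"
proof -
  have "tubes T D = (\<lambda>(p, q, v, r). tube T p q v r) ` (\<rat> \<times> \<rat> \<times> D \<times> \<rat>)"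
    by (auto simp: tubes_def)
  then show ?thesis using assms countable_rat by (simp only:) (intro countable_image countable_SIGMA)
qed

text \<open>On a short window the path stays within \<open>e\<close> of one point of the dense set
  \<open>D\<close>, and finitely many windows cover the interval. Another path in the same tubes is
  then within \<open>2 * e\<close>: once for the distance of each path to the centre of the
  tube.\<close>

lemma tubes_cover_path:
  fixes \<omega> :: "real \<Rightarrow> 'a::euclidean_space"
  assumes \<omega>: "\<omega> \<in> space (path_space T)" and e: "e \<in> \<rat>" "0 < e"
    and D: "\<And>X :: 'a set. open X \<Longrightarrow> X \<noteq> {} \<Longrightarrow> \<exists>d\<in>D. d \<in> X"
  obtains F where "finite F" "F \<subseteq> tubes T D" "\<omega> \<in> \<Inter>F"
    "\<And>\<omega>' t. \<omega>' \<in> \<Inter>F \<Longrightarrow> t \<in> {-T..T} \<Longrightarrow> dist (\<omega>' t) (\<omega> t) \<le> 2 * e"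
proof -
  have c: "continuous_on {-T..T} \<omega>" using \<omega> by (simp add: space_path_space)
  have "\<exists>p q v. p \<in> \<rat> \<and> q \<in> \<rat> \<and> v \<in> D \<and> t \<in> {p<..<q} \<and> \<omega> \<in> tube T p q v e" if t: "t \<in> {-T..T}" for t
  proof -
    \<comment> \<open>Half of \<open>e\<close> is for the oscillation of the path, the other half
      for replacing \<open>\<omega> t\<close> by a point of \<open>D\<close>.\<close>
    obtain d where d: "d > 0" "\<And>s. s \<in> {-T..T} \<Longrightarrow> dist s t < d \<Longrightarrow> dist (\<omega> s) (\<omega> t) < e / 2"
      using c t e unfolding continuous_on_iff by (metis half_gt_zero)
    obtain p where p: "p \<in> \<rat>" "t - d < p" "p < t" using Rats_dense_in_real[of "t - d" t] d by auto
    obtain q where q: "q \<in> \<rat>" "t < q" "q < t + d" using Rats_dense_in_real[of t "t + d"] d by auto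
    obtain v where v: "v \<in> D" "v \<in> ball (\<omega> t) (e / 2)" using D[of "ball (\<omega> t) (e / 2)"] e by auto
    have "\<omega> \<in> tube T p q v e"
      unfolding tube_def
    proof (intro CollectI conjI ballI \<omega>)
      fix s assume s: "s \<in> {-T..T} \<inter> {p<..<q}"
      then have "dist (\<omega> s) (\<omega> t) < e / 2" using p q by (intro d) (auto simp: dist_real_def)
      moreover have "dist (\<omega> s) v \<le> dist (\<omega> s) (\<omega> t) + dist (\<omega> t) v" by (rule dist_triangle)
      ultimately show "dist (\<omega> s) v \<le> e" using v by simp
    qed
    then show ?thesis using p q v by auto
  qed
  then obtain p q v where pqv: "\<And>t. t \<in> {-T..T} \<Longrightarrow> p t \<in> \<rat> \<and> q t \<in> \<rat> \<and> v t \<in> D \<and> t \<in> {p t<..<q t} \<and> \<omega> \<in> tube T (p t) (q t) (v t) e"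
    by metis
  obtain K where K: "K \<subseteq> {-T..T}" "finite K" "{-T..T} \<subseteq> (\<Union>t\<in>K. {p t<..<q t})"
    by (rule compactE_image[of "{-T..T}" "{-T..T}" "\<lambda>t. {p t<..<q t}"]) (use pqv in auto)
  show ?thesis
  proof (rule that[of "(\<lambda>t. tube T (p t) (q t) (v t) e) ` K"])
    show "(\<lambda>t. tube T (p t) (q t) (v t) e) ` K \<subseteq> tubes T D"
      using K(1) pqv e unfolding tubes_def by blast
    show "\<omega> \<in> \<Inter> ((\<lambda>t. tube T (p t) (q t) (v t) e) ` K)" using K(1) pqv by auto
    fix \<omega>' s assume \<omega>': "\<omega>' \<in> \<Inter> ((\<lambda>t. tube T (p t) (q t) (v t) e) ` K)" and s: "s \<in> {-T..T}"
    obtain t where t: "t \<in> K" "s \<in> {p t<..<q t}" using K(3) s by auto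
    have "dist (\<omega>' s) (v t) \<le> e" using \<omega>' t s by (auto simp: tube_def)
    moreover have "dist (\<omega> s) (v t) \<le> e" using K(1) pqv[of t] t s by (auto simp: tube_def)
    moreover have "dist (\<omega>' s) (\<omega> s) \<le> dist (\<omega>' s) (v t) + dist (\<omega> s) (v t)" by (rule dist_triangle2)
    ultimately show "dist (\<omega>' s) (\<omega> s) \<le> 2 * e" by simp
  qed (use K in auto)
qed

text \<open>Openness for the uniform distance in sequential form, the form in which continuity of
  the test functionals is given. Passing to subsequences shows that a single index in
  \<open>G\<close> amounts to eventual membership.\<close>

definition uniformly_open :: "real \<Rightarrow> (real \<Rightarrow> 'a::euclidean_space) set \<Rightarrow> bool" where
  "uniformly_open T G \<longleftrightarrow> G \<subseteq> space (path_space T) \<and>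
     (\<forall>w \<omega>. (\<forall>n. w n \<in> space (path_space T)) \<and> \<omega> \<in> G \<and> uniform_limit {-T..T} w \<omega> sequentially \<longrightarrow> (\<exists>n. w n \<in> G))"

text \<open>Satisfied by the finite unions of a countable base of the uniform topology. It is what the portmanteau
  argument needs to pass from convergence on \<open>\<A>\<close> to weak convergence.\<close>

definition convergence_determining :: "real \<Rightarrow> (real \<Rightarrow> 'a::euclidean_space) set set \<Rightarrow> bool" where
  "convergence_determining T \<A> \<longleftrightarrow> countable \<A> \<and> \<A> \<subseteq> sets (path_space T) \<and>
     (\<forall>G. uniformly_open T G \<longrightarrow> (\<exists>A :: nat \<Rightarrow> _. range A \<subseteq> \<A> \<and> incseq A \<and> G = (\<Union>n. A n)))"

text \<open>If no basic neighbourhood of \<open>\<omega>\<close> were contained in \<open>G\<close>,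
  paths outside \<open>G\<close> chosen from neighbourhoods of radius tending to 0 would converge
  uniformly to \<open>\<omega>\<close>, against \<open>uniformly_open\<close>. So \<open>G\<close>
  is the union of the countably many basic sets inside it, and finite unions of these form the
  increasing sequence.\<close>

theorem exists_convergence_determining:
  assumes T: "0 < T"
  obtains \<A> :: "(real \<Rightarrow> 'a::euclidean_space) set set" where "convergence_determining T \<A>"
proof -
  obtain D :: "'a set" where D: "countable D" "\<And>X :: 'a set. open X \<Longrightarrow> X \<noteq> {} \<Longrightarrow> \<exists>d\<in>D. d \<in> X"
    using countable_dense_exists[where 'a='a] by auto
  define \<B> where "\<B> = (\<lambda>F. space (path_space T) \<inter> \<Inter>F) ` {F. finite F \<and> F \<subseteq> tubes T D}"
  define \<A> where "\<A> = Union ` {F. finite F \<and> F \<subseteq> \<B>}"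
  have cB: "countable \<B>" unfolding \<B>_def
    using countable_Collect_finite_subset[OF countable_tubes[OF D(1), of T]] by (auto simp: conj_commute)
  have cA: "countable \<A>" unfolding \<A>_def
    using countable_Collect_finite_subset[OF cB] by (auto simp: conj_commute)
  have sB: "\<B> \<subseteq> sets (path_space T)"
  proof
    fix B assume "B \<in> \<B>"
    then obtain F where F: "finite F" "F \<subseteq> tubes T D" "B = space (path_space T) \<inter> \<Inter>F" by (auto simp: \<B>_def)
    have "X \<in> sets (path_space T)" if "X \<in> F" for X
    proof -
      have "X \<in> tubes T D" using that F(2) by auto
      then obtain p q v r where "X = tube T p q v r" unfolding tubes_def by auto
      then show ?thesis by (simp add: sets_tube[OF T])
    qed
    then have "F \<noteq> {} \<Longrightarrow> \<Inter>F \<in> sets (path_space T)"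
      using sets.finite_INT[where A="\<lambda>x. x" and I=F] F(1) by auto
    then show "B \<in> sets (path_space T)"
      using F(3) by (cases "F = {}") auto
  qed
  have sA: "\<A> \<subseteq> sets (path_space T)"
    using sB by (auto simp: \<A>_def intro!: sets.finite_Union)
  have "\<exists>A :: nat \<Rightarrow> _. range A \<subseteq> \<A> \<and> incseq A \<and> G = (\<Union>n. A n)" if G: "uniformly_open T G" for G
  proof -
    have Gs: "G \<subseteq> space (path_space T)" using G by (simp add: uniformly_open_def)
    \<comment> \<open>The empty set is added so that there is something to enumerate.\<close>
    define I where "I = insert {} {B\<in>\<B>. B \<subseteq> G}"
    have cI: "countable I" 
    proof -
      have "countable {B\<in>\<B>. B \<subseteq> G}" by (rule countable_subset[OF _ cB]) (rule subsetI, simp)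
      then show ?thesis unfolding I_def by (rule countable_insert)
    qed
    define b where "b = from_nat_into I"
    have b: "range b = I" unfolding b_def by (rule range_from_nat_into[OF _ cI]) (simp add: I_def)
    \<comment> \<open>Intersecting with \<open>\<B>\<close> makes \<open>A n\<close> a union of
      basic sets whether or not the added empty set is one of them.\<close>
    define A where "A n = \<Union>(b ` {..n} \<inter> \<B>)" for n
    have "G \<subseteq> (\<Union>n. A n)"
    proof
      fix \<omega> assume \<omega>: "\<omega> \<in> G"
      have "\<exists>B\<in>\<B>. \<omega> \<in> B \<and> B \<subseteq> G"
      proof (rule ccontr)
        assume n: "\<not> (\<exists>B\<in>\<B>. \<omega> \<in> B \<and> B \<subseteq> G)"
        have "\<exists>w\<in>space (path_space T). w \<notin> G \<and> (\<forall>t\<in>{-T..T}. dist (w t) (\<omega> t) \<le> 2 * (1 / Suc n))" for n :: nat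
        proof -
          obtain F where F: "finite F" "F \<subseteq> tubes T D" "\<omega> \<in> \<Inter>F"
            "\<And>\<omega>' t. \<omega>' \<in> \<Inter>F \<Longrightarrow> t \<in> {-T..T} \<Longrightarrow> dist (\<omega>' t) (\<omega> t) \<le> 2 * (1 / Suc n)"
            using tubes_cover_path[of \<omega> T "1 / Suc n" D] \<omega> Gs D(2) by (auto simp del: of_nat_Suc)
          then have "space (path_space T) \<inter> \<Inter>F \<in> \<B>" by (auto simp: \<B>_def)
          moreover have "\<omega> \<in> space (path_space T) \<inter> \<Inter>F" using \<omega> Gs F(3) by auto
          ultimately have "\<not> space (path_space T) \<inter> \<Inter>F \<subseteq> G" using n by meson
          then obtain w where "w \<in> space (path_space T)" "w \<in> \<Inter>F" "w \<notin> G" by auto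
          then show ?thesis using F(4) by meson
        qed
        then obtain w where w: "\<And>n::nat. w n \<in> space (path_space T)" "\<And>n. w n \<notin> G"
          "\<And>n t. t \<in> {-T..T} \<Longrightarrow> dist (w n t) (\<omega> t) \<le> 2 * (1 / Suc n)" by metis
        have "uniform_limit {-T..T} w \<omega> sequentially"
        proof (rule uniform_limitI)
          fix e :: real assume "0 < e"
          have "(\<lambda>n. 2 * (1 / Suc n)) \<longlonglongrightarrow> 2 * 0"
            using LIMSEQ_inverse_real_of_nat by (intro tendsto_mult tendsto_const) (simp add: inverse_eq_divide)
          then have "\<forall>\<^sub>F n in sequentially. 2 * (1 / Suc n) < e"
            by (rule order_tendstoD) (use \<open>0 < e\<close> in simp)
          then show "\<forall>\<^sub>F n in sequentially. \<forall>t\<in>{-T..T}. dist (w n t) (\<omega> t) < e"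
          proof eventually_elim
            case (elim n)
            show ?case using le_less_trans[OF w(3) elim] by blast
          qed
        qed
        then show False using G w(1,2) \<omega> unfolding uniformly_open_def by blast
      qed
      then obtain B where B: "B \<in> \<B>" "\<omega> \<in> B" "B \<subseteq> G" by blast
      then have "B \<in> range b" by (simp add: b I_def)
      then obtain n where "b n = B" by auto
      then have "\<omega> \<in> A n" using B by (auto simp: A_def)
      then show "\<omega> \<in> (\<Union>n. A n)" by auto
    qed
    moreover have "b i \<subseteq> G" for i
    proof -
      have "b i \<in> I" using b by (metis rangeI)
      then show ?thesis by (auto simp: I_def)
    qed
    then have "(\<Union>n. A n) \<subseteq> G" by (auto simp: A_def)
    moreover have "range A \<subseteq> \<A>" by (auto simp: A_def \<A>_def)
    moreover have "incseq A" by (rule incseq_SucI, unfold A_def, intro Union_mono Int_mono image_mono) auto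
    ultimately show ?thesis by blast
  qed
  then have "convergence_determining T \<A>" using cA sA by (simp add: convergence_determining_def)
  then show ?thesis by (rule that)
qed

text \<open>The number of levels \<open>j / k\<close> below \<open>g\<close> is the ceiling of
  \<open>k * g\<close>. Integrated, this expresses an expectation, up to \<open>1 / k\<close>,
  through the masses of strict superlevel sets, and for a test functional these sets are uniformly
  open.\<close>

lemma step_approximation:
  fixes g :: real
  assumes "0 \<le> g" "g \<le> 1" "0 < k"
  shows "g \<le> (\<Sum>j<k. indicator {x. real j / k < x} g) / k" "(\<Sum>j<k. indicator {x. real j / k < x} g) / k \<le> g + 1 / k"
proof -
  have "(\<Sum>j<k. indicator {x. real j / k < x} g) = (\<Sum>j<k. if real j < k * g then 1 else 0 :: real)"
    using assms by (intro sum.cong) (auto simp: indicator_def field_simps)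
  also have "\<dots> = card ({..<k} \<inter> {j. real j < k * g})" by (simp add: sum.If_cases)
  also have "{..<k} \<inter> {j. real j < k * g} = {..<nat \<lceil>k * g\<rceil>}"
  proof -
    have "k * g \<le> k" using assms by (simp add: mult_left_le)
    then show ?thesis by (auto simp: less_ceiling_iff zless_nat_eq_int_zless)
  qed
  finally have eq: "(\<Sum>j<k. indicator {x. real j / k < x} g) = real (nat \<lceil>k * g\<rceil>)" by simp
  have "0 \<le> real k * g" using assms by simp
  then have "k * g \<le> real (nat \<lceil>k * g\<rceil>)" "real (nat \<lceil>k * g\<rceil>) \<le> k * g + 1" by linarith+
  then show "g \<le> (\<Sum>j<k. indicator {x. real j / k < x} g) / k" "(\<Sum>j<k. indicator {x. real j / k < x} g) / k \<le> g + 1 / k"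
    unfolding eq using assms by (simp_all add: field_simps)
qed

lemma path_test_functional_affine:
  fixes F :: "(real \<Rightarrow> 'a::euclidean_space) \<Rightarrow> real"
  assumes "path_test_functional T F"
  shows "path_test_functional T (\<lambda>\<omega>. a + b * F \<omega>)"
  unfolding path_test_functional_def
proof (intro conjI allI impI)
  show "(\<lambda>\<omega>. a + b * F \<omega>) \<in> borel_measurable (path_space T)"
    using assms by (auto simp: path_test_functional_def)
  have "bounded ((\<lambda>x. a + b * x) ` F ` space (path_space T))"
  proof -
    have "bounded ((\<lambda>x. b * x) ` F ` space (path_space T))"
      using assms by (intro bounded_linear_image bounded_linear_mult_right) (auto simp: path_test_functional_def)
    then show ?thesis using bounded_translation[of "(\<lambda>x. b * x) ` F ` space (path_space T)" a] by (simp add: image_image)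
  qed
  then show "bounded ((\<lambda>\<omega>. a + b * F \<omega>) ` space (path_space T))" by (simp add: image_image)
  fix w and \<omega> :: "real \<Rightarrow> 'a" assume "(\<forall>n. w n \<in> space (path_space T)) \<and> \<omega> \<in> space (path_space T) \<and> uniform_limit {-T..T} w \<omega> sequentially"
  then have "(\<lambda>n. F (w n)) \<longlonglongrightarrow> F \<omega>" using assms by (simp add: path_test_functional_def)
  then show "(\<lambda>n. a + b * F (w n)) \<longlonglongrightarrow> a + b * F \<omega>" by (intro tendsto_intros)
qed

text \<open>The lower half of the portmanteau theorem. The superlevel sets of \<open>G\<close> are
  exhausted from inside by members of \<open>\<A>\<close>, so convergence on \<open>\<A>\<close>
  keeps their mass under \<open>R e\<close> from eventually falling noticeably below the mass under
  \<open>R0\<close>; exhaustion from inside controls this direction only.\<close>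

lemma eventually_integral_gt:
  fixes R0 :: "(real \<Rightarrow> 'a::euclidean_space) measure"
  assumes \<A>: "convergence_determining T \<A>"
    and R0: "R0 \<in> space (prob_algebra (path_space T))"
    and R: "\<forall>\<^sub>F e in \<F>. R e \<in> space (prob_algebra (path_space T))"
    and lim: "\<And>A. A \<in> \<A> \<Longrightarrow> ((\<lambda>e. measure (R e) A) \<longlongrightarrow> measure R0 A) \<F>"
    and G: "path_test_functional T G" "\<And>\<omega>. \<omega> \<in> space (path_space T) \<Longrightarrow> 0 \<le> G \<omega> \<and> G \<omega> \<le> 1"
    and \<delta>: "0 < \<delta>"
  shows "\<forall>\<^sub>F e in \<F>. (\<integral>\<omega>. G \<omega> \<partial>R0) - \<delta> < (\<integral>\<omega>. G \<omega> \<partial>R e)"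
proof -
  have Gm[measurable]: "G \<in> borel_measurable (path_space T)" using G(1) by (simp add: path_test_functional_def)
  \<comment> \<open>One quarter of \<open>\<delta>\<close> pays for the discretization, another for
    the masses of the superlevel sets.\<close>
  obtain k' :: nat where k': "1 / Suc k' < \<delta> / 4" using nat_approx_posE[of "\<delta>/4"] \<delta> by auto
  define k where "k = Suc k'"
  have k: "0 < k" "1 / real k < \<delta> / 4" using k' by (auto simp: k_def)
  define Oj where "Oj j = {\<omega>\<in>space (path_space T). real j / k < G \<omega>}" for j
  have Oj[measurable]: "Oj j \<in> sets (path_space T)" for j unfolding Oj_def by measurable
  have bounds: "(\<integral>\<omega>. G \<omega> \<partial>M) \<le> (\<Sum>j<k. measure M (Oj j)) / k"
      "(\<Sum>j<k. measure M (Oj j)) / k \<le> (\<integral>\<omega>. G \<omega> \<partial>M) + 1 / k"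
    if M: "M \<in> space (prob_algebra (path_space T))" for M
  proof -
    have sM[measurable_cong]: "sets M = sets (path_space T)" and "prob_space M"
      using M by (auto simp: space_prob_algebra)
    interpret prob_space M by fact
    have spM: "space M = space (path_space T)" by (rule sets_eq_imp_space_eq[OF sM])
    have eq: "(\<Sum>j<k. measure M (Oj j)) / k = (\<integral>\<omega>. (\<Sum>j<k. indicator (Oj j) \<omega>) / k \<partial>M)"
      by (simp add: sM less_top[symmetric] Int_absorb2 sets.sets_into_space)
    have int1: "integrable M G"
      by (rule integrable_const_bound[where B=1]) (use G(2) spM in auto)
    have int2: "integrable M (\<lambda>\<omega>. (\<Sum>j<k. indicator (Oj j) \<omega>) / k :: real)"
      by (intro integrable_divide Bochner_Integration.integrable_sum) (auto simp: sM less_top[symmetric])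
    have ind: "(\<Sum>j<k. indicator (Oj j) \<omega>) = (\<Sum>j<k. indicator {x. real j / k < x} (G \<omega>) :: real)" if "\<omega> \<in> space M" for \<omega>
      using that by (intro sum.cong) (auto simp: indicator_def Oj_def spM)
    show "(\<integral>\<omega>. G \<omega> \<partial>M) \<le> (\<Sum>j<k. measure M (Oj j)) / k"
      unfolding eq using step_approximation(1) G(2) k(1)
      by (intro integral_mono int1 int2) (simp add: ind, simp add: spM)
    have "(\<integral>\<omega>. (\<Sum>j<k. indicator (Oj j) \<omega>) / k \<partial>M) \<le> (\<integral>\<omega>. G \<omega> + 1 / k \<partial>M)"
      using step_approximation(2) G(2) k(1)
      by (intro integral_mono int2 Bochner_Integration.integrable_add int1) (simp, simp add: ind, simp add: spM)
    also have "\<dots> = (\<integral>\<omega>. G \<omega> \<partial>M) + 1 / k"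
      using int1 by (subst Bochner_Integration.integral_add) (auto simp: prob_space)
    finally show "(\<Sum>j<k. measure M (Oj j)) / k \<le> (\<integral>\<omega>. G \<omega> \<partial>M) + 1 / k" unfolding eq .
  qed
  have sR0: "sets R0 = sets (path_space T)" and "prob_space R0" using R0 by (auto simp: space_prob_algebra)
  interpret R0: prob_space R0 by fact
  have ev: "\<forall>\<^sub>F e in \<F>. measure R0 (Oj j) - \<delta> / 4 < measure (R e) (Oj j)" for j
  proof -
    have "uniformly_open T (Oj j)"
      unfolding uniformly_open_def
    proof (intro conjI allI impI)
      fix w and \<omega> :: "real \<Rightarrow> 'a" assume a: "(\<forall>n. w n \<in> space (path_space T)) \<and> \<omega> \<in> Oj j \<and> uniform_limit {-T..T} w \<omega> sequentially"
      then have "(\<lambda>n. G (w n)) \<longlonglongrightarrow> G \<omega>" using G(1) by (auto simp: path_test_functional_def Oj_def)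
      then have "\<forall>\<^sub>F n in sequentially. real j / k < G (w n)"
        by (rule order_tendstoD) (use a in \<open>auto simp: Oj_def\<close>)
      then show "\<exists>n. w n \<in> Oj j" using a by (auto simp: Oj_def eventually_sequentially)
    qed (auto simp: Oj_def)
    then obtain A :: "nat \<Rightarrow> _" where A: "range A \<subseteq> \<A>" "incseq A" "Oj j = (\<Union>n. A n)"
      using \<A> unfolding convergence_determining_def by blast
    have As: "A n \<in> sets (path_space T)" for n using A(1) \<A> by (auto simp: convergence_determining_def)
    have "(\<lambda>n. measure R0 (A n)) \<longlonglongrightarrow> measure R0 (\<Union>n. A n)"
      using A(2) As by (intro R0.finite_Lim_measure_incseq) (auto simp: sR0)
    then have "\<forall>\<^sub>F n in sequentially. measure R0 (Oj j) - \<delta> / 4 < measure R0 (A n)"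
      by (rule order_tendstoD) (use A(3) \<delta> in simp)
    then obtain n where n: "measure R0 (Oj j) - \<delta> / 4 < measure R0 (A n)" by (auto simp: eventually_sequentially)
    have "\<forall>\<^sub>F e in \<F>. measure R0 (Oj j) - \<delta> / 4 < measure (R e) (A n)"
      using lim[of "A n"] A(1) n by (intro order_tendstoD(1)) auto
    then show ?thesis using R
    proof eventually_elim
      case (elim e)
      then have sRe: "sets (R e) = sets (path_space T)" and "prob_space (R e)" by (auto simp: space_prob_algebra)
      interpret Re: prob_space "R e" by fact
      have "measure (R e) (A n) \<le> measure (R e) (Oj j)"
        by (rule Re.finite_measure_mono) (simp_all add: sRe Oj, use A(3) in blast)
      then show ?case using elim by simp
    qed
  qed
  have "\<forall>\<^sub>F e in \<F>. \<forall>j\<in>{..<k}. measure R0 (Oj j) - \<delta> / 4 < measure (R e) (Oj j)"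
    by (intro eventually_ball_finite ballI ev) simp
  then show ?thesis using R
  proof eventually_elim
    case (elim e)
    have "(\<integral>\<omega>. G \<omega> \<partial>R0) \<le> (\<Sum>j<k. measure R0 (Oj j)) / k" by (rule bounds(1)[OF R0])
    also have "\<dots> \<le> (\<Sum>j<k. measure (R e) (Oj j) + \<delta> / 4) / k"
      using elim(1) by (intro divide_right_mono sum_mono) (auto simp: algebra_simps intro: less_imp_le)
    also have "\<dots> = (\<Sum>j<k. measure (R e) (Oj j)) / k + \<delta> / 4"
      using k(1) by (simp add: sum.distrib add_divide_distrib)
    also have "\<dots> \<le> (\<integral>\<omega>. G \<omega> \<partial>R e) + 1 / k + \<delta> / 4" using bounds(2)[OF elim(2)] by simp
    also have "\<dots> < (\<integral>\<omega>. G \<omega> \<partial>R e) + \<delta>" using k(2) \<delta> by simp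
    finally show ?case by simp
  qed
qed

text \<open>The one-sided estimate is applied to the rescaled functionals
  \<open>1/2 + F / (2 * B)\<close> and \<open>1/2 - F / (2 * B)\<close>, both with values in [0,1];
  together they bound the integral of \<open>F\<close> from both sides, with the tolerance scaled by
  the same factor.\<close>

theorem weakly_converges_if_converges_on:
  fixes R0 :: "(real \<Rightarrow> 'a::euclidean_space) measure"
  assumes \<A>: "convergence_determining T \<A>"
    and R0: "R0 \<in> space (prob_algebra (path_space T))"
    and R: "\<forall>\<^sub>F e in \<F>. R e \<in> space (prob_algebra (path_space T))"
    and lim: "\<And>A. A \<in> \<A> \<Longrightarrow> ((\<lambda>e. measure (R e) A) \<longlongrightarrow> measure R0 A) \<F>"
  shows "weakly_converges T R R0 \<F>"
  unfolding weakly_converges_def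
proof (intro allI impI)
  fix F :: "(real \<Rightarrow> 'a) \<Rightarrow> real" assume F: "path_test_functional T F"
  then obtain B0 where "\<And>\<omega>. \<omega> \<in> space (path_space T) \<Longrightarrow> \<bar>F \<omega>\<bar> \<le> B0"
    by (auto simp: path_test_functional_def bounded_iff)
  then obtain B where B: "0 < B" "\<And>\<omega>. \<omega> \<in> space (path_space T) \<Longrightarrow> \<bar>F \<omega>\<bar> \<le> B"
    by (metis abs_ge_zero abs_le_D1 abs_le_iff abs_le_self_iff gt_ex le_less_trans less_imp_le order_trans)
  have Fm: "F \<in> borel_measurable (path_space T)" using F by (simp add: path_test_functional_def)
  have affine: "(\<integral>\<omega>. a + b * F \<omega> \<partial>M) = a + b * (\<integral>\<omega>. F \<omega> \<partial>M)"
    if M: "M \<in> space (prob_algebra (path_space T))" for M a b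
  proof -
    have sM: "sets M = sets (path_space T)" and "prob_space M"
      using M by (auto simp: space_prob_algebra)
    interpret prob_space M by fact
    have "integrable M F"
      by (rule integrable_const_bound[where B=B])
        (use B(2) Fm sets_eq_imp_space_eq[OF sM] in \<open>auto cong: measurable_cong_sets simp: sM\<close>)
    then show ?thesis by (simp add: prob_space)
  qed
  show "((\<lambda>e. \<integral>\<omega>. F \<omega> \<partial>R e) \<longlongrightarrow> (\<integral>\<omega>. F \<omega> \<partial>R0)) \<F>"
  proof (rule tendstoI)
    fix \<delta> :: real assume \<delta>: "0 < \<delta>"
    have b: "0 \<le> 1/2 + s / (2 * B) * F \<omega> \<and> 1/2 + s / (2 * B) * F \<omega> \<le> 1"
      if "\<omega> \<in> space (path_space T)" "s = 1 \<or> s = -1" for \<omega> s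
      using B(1) B(2)[OF that(1)] that(2) by (auto simp: field_simps)
    have ev: "\<forall>\<^sub>F e in \<F>. (1/2 + s / (2 * B) * (\<integral>\<omega>. F \<omega> \<partial>R0)) - \<delta> / (2 * B) < 1/2 + s / (2 * B) * (\<integral>\<omega>. F \<omega> \<partial>R e)"
      if s: "s = 1 \<or> s = -1" for s :: real
    proof -
      have "\<forall>\<^sub>F e in \<F>. (\<integral>\<omega>. 1/2 + s / (2 * B) * F \<omega> \<partial>R0) - \<delta> / (2 * B) < (\<integral>\<omega>. 1/2 + s / (2 * B) * F \<omega> \<partial>R e)"
        using \<delta> B(1) b s by (intro eventually_integral_gt[OF \<A> R0 R lim] path_test_functional_affine F) auto
      then show ?thesis using R
        by eventually_elim (simp only: affine R0)
    qed
    show "\<forall>\<^sub>F e in \<F>. dist (\<integral>\<omega>. F \<omega> \<partial>R e) (\<integral>\<omega>. F \<omega> \<partial>R0) < \<delta>"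
      using ev[of 1, OF disjI1[OF refl]] ev[of "-1", OF disjI2[OF refl]]
    proof eventually_elim
      case (elim e)
      have "(\<integral>\<omega>. F \<omega> \<partial>R0) - \<delta> < (\<integral>\<omega>. F \<omega> \<partial>R e)" "(\<integral>\<omega>. F \<omega> \<partial>R e) < (\<integral>\<omega>. F \<omega> \<partial>R0) + \<delta>"
      proof -
        have "1 / (2 * B) * ((\<integral>\<omega>. F \<omega> \<partial>R0) - \<delta>) < 1 / (2 * B) * (\<integral>\<omega>. F \<omega> \<partial>R e)"
          "1 / (2 * B) * (\<integral>\<omega>. F \<omega> \<partial>R e) < 1 / (2 * B) * ((\<integral>\<omega>. F \<omega> \<partial>R0) + \<delta>)"
          using elim by (simp_all add: right_diff_distrib distrib_left)
        then show "(\<integral>\<omega>. F \<omega> \<partial>R0) - \<delta> < (\<integral>\<omega>. F \<omega> \<partial>R e)" "(\<integral>\<omega>. F \<omega> \<partial>R e) < (\<integral>\<omega>. F \<omega> \<partial>R0) + \<delta>"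
          using B(1) by (subst (asm) (1 2) mult_less_cancel_left_pos; simp)+
      qed
      then show ?case by (simp add: dist_real_def abs_less_iff)
    qed
  qed
qed

text \<open>Indicators of closed cylinders are pointwise limits of products of Lipschitz cutoffs of
  the distances to the base sets; dominated convergence carries the equality over to the cylinders,
  which determine the measure.\<close>

theorem path_measure_eqI_test_functionals:
  fixes R R' :: "(real \<Rightarrow> 'a::euclidean_space) measure"
  assumes R: "R \<in> space (prob_algebra (path_space T))" and R': "R' \<in> space (prob_algebra (path_space T))"
    and eq: "\<And>F. path_test_functional T F \<Longrightarrow> (\<integral>\<omega>. F \<omega> \<partial>R) = (\<integral>\<omega>. F \<omega> \<partial>R')"
  shows "R = R'"
proof (rule path_measure_eqI[OF R R'])
  fix J C assume J: "finite J" "J \<subseteq> {-T..T}" and C: "\<And>t. t \<in> J \<Longrightarrow> closed (C t :: 'a set)"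
  define S where "S = {\<omega>\<in>space (path_space T). \<forall>t\<in>J. \<omega> t \<in> C t}"
  show "emeasure R S = emeasure R' S"
  \<comment> \<open>\<open>infdist\<close> to the empty set is 0, so the cutoff of an empty base set
    would be constantly 1.\<close>
  proof (cases "\<exists>t\<in>J. C t = {}")
    case True
    then have "S = {}" by (auto simp: S_def)
    then show ?thesis by simp
  next
    case False
    have Sset: "S \<in> sets (path_space T)"
      unfolding sets_path_space S_def closed_cylinders_def using J C by (intro sigma_sets.Basic) blast
    define F where "F n \<omega> = (\<Prod>t\<in>J. max 0 (1 - real n * infdist (\<omega> t) (C t)))" for n and \<omega> :: "real \<Rightarrow> 'a"
    have F01: "0 \<le> F n \<omega>" "F n \<omega> \<le> 1" for n \<omega>
      unfolding F_def by (auto intro!: prod_nonneg prod_le_1 simp: infdist_nonneg)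
    have ev: "(\<lambda>\<omega>. \<omega> t) \<in> path_space T \<rightarrow>\<^sub>M (borel :: 'a measure)" if "t \<in> J" for t
      using J that by (intro measurable_path_eval) auto
    have Fm: "F n \<in> borel_measurable (path_space T)" for n
      unfolding F_def[abs_def]
      by (intro borel_measurable_prod borel_measurable_max borel_measurable_diff borel_measurable_times
          borel_measurable_const measurable_compose[OF ev] borel_measurable_continuous_onI
          continuous_on_infdist continuous_on_id)
    have test: "path_test_functional T (F n)" for n
      unfolding path_test_functional_def
    proof (intro conjI allI impI Fm)
      show "bounded (F n ` space (path_space T))"
        using F01 by (auto simp: bounded_iff intro!: exI[of _ 1])
      fix w and \<omega> :: "real \<Rightarrow> 'a" assume a: "(\<forall>n. w n \<in> space (path_space T)) \<and> \<omega> \<in> space (path_space T) \<and> uniform_limit {-T..T} w \<omega> sequentially"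
      have "(\<lambda>m. w m t) \<longlonglongrightarrow> \<omega> t" if "t \<in> J" for t
        using a J that by (intro tendsto_uniform_limitI[where S="{-T..T}"]) auto
      then show "(\<lambda>m. F n (w m)) \<longlonglongrightarrow> F n \<omega>"
        unfolding F_def by (intro tendsto_intros) auto
    qed
    have lim: "(\<lambda>n. F n \<omega>) \<longlonglongrightarrow> indicator S \<omega>" if \<omega>: "\<omega> \<in> space (path_space T)" for \<omega>
    proof (cases "\<omega> \<in> S")
      case True
      then have "F n \<omega> = 1" for n using False by (auto simp: F_def S_def)
      then show ?thesis using True by simp
    next
      case f: False
      then obtain t where t: "t \<in> J" "\<omega> t \<notin> C t" using \<omega> by (auto simp: S_def)
      have d: "0 < infdist (\<omega> t) (C t)"
        using t C False by (metis infdist_pos_not_in_closed)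
      obtain m :: nat where m: "1 < real m * infdist (\<omega> t) (C t)" using reals_Archimedean3[OF d] by blast
      have "F n \<omega> = 0" if "m \<le> n" for n
      proof -
        have "real m * infdist (\<omega> t) (C t) \<le> real n * infdist (\<omega> t) (C t)"
          using that d by (intro mult_right_mono) auto
        then have "max 0 (1 - real n * infdist (\<omega> t) (C t)) = 0" using m by simp
        then show ?thesis unfolding F_def using J(1) t(1) by (intro prod_zero) auto
      qed
      then have "\<forall>\<^sub>F n in sequentially. F n \<omega> = 0" by (auto simp: eventually_sequentially)
      then show ?thesis using f by (simp add: tendsto_eventually)
    qed
    have "(\<lambda>n. \<integral>\<omega>. F n \<omega> \<partial>M) \<longlonglongrightarrow> measure M S" if M: "M \<in> space (prob_algebra (path_space T))" for M
    proof -
      have sM[measurable_cong]: "sets M = sets (path_space T)" and "prob_space M"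
        using M by (auto simp: space_prob_algebra)
      interpret prob_space M by fact
      have spM: "space M = space (path_space T)" by (rule sets_eq_imp_space_eq[OF sM])
      have "(\<lambda>n. \<integral>\<omega>. F n \<omega> \<partial>M) \<longlonglongrightarrow> (\<integral>\<omega>. indicator S \<omega> \<partial>M)"
        using Fm Sset lim F01
        by (intro integral_dominated_convergence[where w="\<lambda>_. 1"]) (auto simp: spM sM cong: measurable_cong_sets)
      then show ?thesis using Sset spM by (simp add: Int_absorb2 sets.sets_into_space)
    qed
    from this[OF R] this[OF R'] have "measure R S = measure R' S"
      using LIMSEQ_unique by (simp add: eq[OF test])
    moreover have "prob_space R" "prob_space R'" using R R' by (auto simp: space_prob_algebra)
    ultimately show ?thesis by (simp add: prob_space_def finite_measure.emeasure_eq_measure)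
  qed
qed

text \<open>Test functionals separate probability measures on path space and
  \<open>at_right 0\<close> is a nontrivial filter, so the weak limit in the definite description is
  unique.\<close>

lemma bridge_eqI:
  assumes R: "R \<in> space (prob_algebra (path_space T))"
    and lim: "weakly_converges T
       (\<lambda>\<epsilon>. uniform_measure (langevin_from T U x) {\<omega> \<in> space (path_space T). dist (\<omega> T) y < \<epsilon>})
       R (at_right 0)"
  shows "bridge T U x y = R"
  unfolding bridge_def
proof (rule the_equality)
  fix R' assume R': "R' \<in> space (prob_algebra (path_space T)) \<and> weakly_converges T
       (\<lambda>\<epsilon>. uniform_measure (langevin_from T U x) {\<omega> \<in> space (path_space T). dist (\<omega> T) y < \<epsilon>})
       R' (at_right 0)"
  show "R' = R"
  proof (rule path_measure_eqI_test_functionals)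
    fix F :: "(real \<Rightarrow> 'a) \<Rightarrow> real" assume "path_test_functional T F"
    with R' lim show "(\<integral>\<omega>. F \<omega> \<partial>R') = (\<integral>\<omega>. F \<omega> \<partial>R)"
      unfolding weakly_converges_def
      by (metis (no_types, lifting) tendsto_unique trivial_limit_at_right_real)
  qed (use R R' in auto)
qed (use R lim in auto)

section \<open>Langevin dynamics\<close>

lemma distr_comp_eq:
  assumes g: "g \<in> S \<rightarrow>\<^sub>M R" and f: "f \<in> M \<rightarrow>\<^sub>M S" and f': "f' \<in> N \<rightarrow>\<^sub>M S" and eq: "distr M S f = distr N S f'"
  shows "distr M R (\<lambda>w. g (f w)) = distr N R (\<lambda>w. g (f' w))"
  using distr_distr[OF g f] distr_distr[OF g f'] eq by (simp add: o_def)

text \<open>Start and Gaussian increments are read off the law on path space; independence of the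
  increments becomes a property of that law once it is rewritten as a product form of their joint
  distribution.\<close>

lemma brownian_motion_transfer:
  fixes B :: "'w \<Rightarrow> real \<Rightarrow> 'a::euclidean_space" and \<beta> :: "'v \<Rightarrow> real \<Rightarrow> 'a"
  assumes T: "0 < T" and BM: "brownian_motion M T B" and N: "prob_space N"
    and \<beta>[measurable]: "\<beta> \<in> N \<rightarrow>\<^sub>M path_space T"
    and eq: "distr M (path_space T) B = distr N (path_space T) \<beta>"
  shows "brownian_motion N T \<beta>"
proof -
  have M: "prob_space M" and B[measurable]: "B \<in> M \<rightarrow>\<^sub>M path_space T" and 0: "AE w in M. B w (-T) = 0"
    and gauss: "\<And>s t. -T \<le> s \<Longrightarrow> s < t \<Longrightarrow> t \<le> T \<Longrightarrow> distributed M lborel (\<lambda>w. B w t - B w s)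
          (\<lambda>z. ennreal (\<Prod>b\<in>Basis. normal_density 0 (sqrt (t - s)) (z \<bullet> b)))"
    and ind: "\<And>(n::nat) \<tau>. \<forall>i\<le>n. \<tau> i \<in> {-T..T} \<Longrightarrow> \<forall>i<n. \<tau> i < \<tau> (Suc i) \<Longrightarrow>
        prob_space.indep_vars M (\<lambda>_. borel) (\<lambda>i w. B w (\<tau> (Suc i)) - B w (\<tau> i)) {..<n}"
    using BM unfolding brownian_motion_def by blast+
  interpret M: prob_space M by fact
  interpret N: prob_space N by fact
  have ev[measurable]: "(\<lambda>\<omega>. \<omega> t) \<in> path_space T \<rightarrow>\<^sub>M (borel :: 'a measure)" if "t \<in> {-T..T}" for t
    using that by (rule measurable_path_eval)
  note law = distr_comp_eq[OF _ B \<beta> eq]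
  have inc: "(\<lambda>\<omega>. \<omega> t - \<omega> s) \<in> path_space T \<rightarrow>\<^sub>M (borel :: 'a measure)" if "s \<in> {-T..T}" "t \<in> {-T..T}" for s t
    using ev[OF that(1)] ev[OF that(2)] by measurable
  show ?thesis
    unfolding brownian_motion_def
  proof (intro conjI allI impI N \<beta>)
    have T': "-T \<in> {-T..T}" using T by auto
    have [measurable]: "(\<lambda>\<omega>. \<omega> (-T)) \<in> path_space T \<rightarrow>\<^sub>M (borel :: 'a measure)" by (rule ev[OF T'])
    have s: "{\<omega>\<in>space (path_space T). \<omega> (-T) = (0::'a)} \<in> sets (path_space T)" by measurable
    have "AE \<omega> in distr M (path_space T) B. \<omega> (-T) = 0" by (rule AE_distr_iff[OF B s, THEN iffD2, OF 0])
    then show "AE w in N. \<beta> w (-T) = 0" unfolding eq by (rule AE_distr_iff[OF \<beta> s, THEN iffD1])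
  next
    fix s t assume st: "-T \<le> s \<and> s < t \<and> t \<le> T"
    let ?d = "\<lambda>z. ennreal (\<Prod>b\<in>Basis. normal_density 0 (sqrt (t - s)) (z \<bullet> b)) :: ennreal"
    have i: "(\<lambda>\<omega>. \<omega> t - \<omega> s) \<in> path_space T \<rightarrow>\<^sub>M (lborel :: 'a measure)" using inc[of s t] st by simp
    have "distributed M lborel (\<lambda>w. B w t - B w s) ?d" using st by (intro gauss) auto
    then show "distributed N lborel (\<lambda>w. \<beta> w t - \<beta> w s) ?d"
      using law[OF i] measurable_compose[OF \<beta> i] unfolding distributed_def by simp
  next
    fix n :: nat and \<tau> assume \<tau>: "(\<forall>i\<le>n. \<tau> i \<in> {-T..T}) \<and> (\<forall>i<n. \<tau> i < \<tau> (Suc i))"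
    show "N.indep_vars (\<lambda>_. borel) (\<lambda>i w. \<beta> w (\<tau> (Suc i)) - \<beta> w (\<tau> i)) {..<n}"
    \<comment> \<open>The product characterization of independence is for nonempty index
      sets.\<close>
    proof (cases "n = 0")
      case True
      then show ?thesis by (simp add: N.indep_vars_def2 N.indep_sets_def)
    next
      case False
      have i: "(\<lambda>\<omega>. \<omega> (\<tau> (Suc i)) - \<omega> (\<tau> i)) \<in> path_space T \<rightarrow>\<^sub>M (borel :: 'a measure)" if "i \<in> {..<n}" for i
        using \<tau> that by (intro inc) auto
      have ri: "(\<lambda>\<omega>. \<lambda>i\<in>{..<n}. \<omega> (\<tau> (Suc i)) - \<omega> (\<tau> i)) \<in> path_space T \<rightarrow>\<^sub>M (\<Pi>\<^sub>M i\<in>{..<n}. (borel :: 'a measure))"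
        by (rule measurable_restrict) (rule i)
      have "M.indep_vars (\<lambda>_. borel) (\<lambda>i w. B w (\<tau> (Suc i)) - B w (\<tau> i)) {..<n}" using \<tau> by (intro ind) auto
      then have "distr M (\<Pi>\<^sub>M i\<in>{..<n}. borel) (\<lambda>w. \<lambda>i\<in>{..<n}. B w (\<tau> (Suc i)) - B w (\<tau> i))
          = (\<Pi>\<^sub>M i\<in>{..<n}. distr M borel (\<lambda>w. B w (\<tau> (Suc i)) - B w (\<tau> i)))"
        using False measurable_compose[OF B i] by (subst (asm) M.indep_vars_iff_distr_eq_PiM') auto
      then have "distr N (\<Pi>\<^sub>M i\<in>{..<n}. borel) (\<lambda>w. \<lambda>i\<in>{..<n}. \<beta> w (\<tau> (Suc i)) - \<beta> w (\<tau> i))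
          = (\<Pi>\<^sub>M i\<in>{..<n}. distr N borel (\<lambda>w. \<beta> w (\<tau> (Suc i)) - \<beta> w (\<tau> i)))"
        unfolding law[OF ri, symmetric] by (rule trans) (intro PiM_cong refl law i)
      then show ?thesis
        using False measurable_compose[OF \<beta> i] by (subst N.indep_vars_iff_distr_eq_PiM') auto
    qed
  qed
qed

section \<open>Uniqueness of the law of Brownian motion\<close>

lemma sorted_enumeration:
  fixes S :: "real set"
  assumes "finite S" "S \<noteq> {}"
  obtains n :: nat and \<tau> where "\<tau> ` {..n} = S" "\<forall>i<n. \<tau> i < \<tau> (Suc i)" "\<tau> 0 = Min S" "n = card S - 1"
proof -
  define l where "l = sorted_list_of_set S"
  have l: "set l = S" "sorted_wrt (<) l" "length l = card S"
    using assms by (auto simp: l_def strict_sorted_iff)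
  have c: "0 < card S" using assms by (simp add: card_gt_0_iff)
  have img: "(!) l ` {..card S - 1} = S"
  proof -
    have "{..card S - 1} = {..<length l}" using c l by auto
    then show ?thesis using l(1) by (auto simp: set_conv_nth)
  qed
  have mono: "l ! i < l ! j" if "i < j" "j \<le> card S - 1" for i j
    using sorted_wrt_nth_less[OF l(2), of i j] that c l(3) by auto
  have "Min S = l ! 0"
  proof (rule Min_eqI)
    show "l ! 0 \<in> S" using img by auto
    fix y assume "y \<in> S"
    then obtain i where "y = l ! i" "i \<le> card S - 1" using img by auto
    then show "l ! 0 \<le> y" using mono[of 0 i] by (cases "i = 0") auto
  qed (use assms in auto)
  then show ?thesis using img mono that[of "(!) l" "card S - 1"] by auto
qed

text \<open>A path that starts at 0 is, along an increasing list of times beginning at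
  \<open>-T\<close>, the sequence of partial sums of its increments. These are independent with
  prescribed Gaussian densities, so every Brownian motion gives a cylinder the same
  probability.\<close>

lemma brownian_law_unique:
  fixes B :: "'w \<Rightarrow> real \<Rightarrow> 'a::euclidean_space" and B' :: "'v \<Rightarrow> real \<Rightarrow> 'a"
  assumes T: "0 < T" and BM: "brownian_motion M T B" and BM': "brownian_motion N T B'"
  shows "distr M (path_space T) B = distr N (path_space T) B'"
proof (rule path_measure_eqI)
  have M: "prob_space M" and B[measurable]: "B \<in> M \<rightarrow>\<^sub>M path_space T" and N: "prob_space N" and B'[measurable]: "B' \<in> N \<rightarrow>\<^sub>M path_space T"
    using BM BM' by (auto simp: brownian_motion_def)
  show "distr M (path_space T) B \<in> space (prob_algebra (path_space T))"
    "distr N (path_space T) B' \<in> space (prob_algebra (path_space T))"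
    using M N B B' by (auto simp: space_prob_algebra intro: prob_space.prob_space_distr)
  fix J C assume J: "finite J" "J \<subseteq> {-T..T}" and C: "\<And>t. t \<in> J \<Longrightarrow> closed (C t :: 'a set)"
  \<comment> \<open>Adding \<open>-T\<close> makes the list begin where the path vanishes; adding
    \<open>T\<close> as well ensures at least one increment.\<close>
  define S where "S = insert (-T) (insert T J)"
  have S: "finite S" "S \<noteq> {}" "S \<subseteq> {-T..T}" using J T by (auto simp: S_def)
  obtain n :: nat and \<tau> where \<tau>: "\<tau> ` {..n} = S" "\<forall>i<n. \<tau> i < \<tau> (Suc i)" "\<tau> 0 = Min S" "n = card S - 1"
    by (rule sorted_enumeration[OF S(1,2)], erule (3) that)
  have \<tau>0: "\<tau> 0 = -T" unfolding \<tau>(3) using S T by (intro Min_eqI) (auto simp: S_def)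
  have "card {-T, T} \<le> card S" using S by (intro card_mono) (auto simp: S_def)
  then have n: "0 < n" using T \<tau>(4) by simp
  have \<tau>i: "\<tau> i \<in> {-T..T}" if "i \<le> n" for i using that \<tau>(1) S(3) by auto
  define \<Delta> where "\<Delta> \<omega> = (\<lambda>i\<in>{..<n}. \<omega> (\<tau> (Suc i)) - \<omega> (\<tau> i))" for \<omega> :: "real \<Rightarrow> 'a"
  have i: "(\<lambda>\<omega>. \<omega> (\<tau> (Suc i)) - \<omega> (\<tau> i)) \<in> path_space T \<rightarrow>\<^sub>M (borel :: 'a measure)" if "i \<in> {..<n}" for i
    using that by (intro borel_measurable_diff measurable_path_eval \<tau>i) auto
  have \<Delta>[measurable]: "\<Delta> \<in> path_space T \<rightarrow>\<^sub>M (\<Pi>\<^sub>M i\<in>{..<n}. (borel :: 'a measure))"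
    unfolding \<Delta>_def[abs_def] by (rule measurable_restrict) (rule i)
  \<comment> \<open>The cylinder event as a condition on the vector of increments.\<close>
  define E where "E = {d\<in>space (\<Pi>\<^sub>M i\<in>{..<n}. (borel :: 'a measure)). \<forall>k\<in>{k. k \<le> n \<and> \<tau> k \<in> J}. (\<Sum>i<k. d i) \<in> C (\<tau> k)}"
  have E[measurable]: "E \<in> sets (\<Pi>\<^sub>M i\<in>{..<n}. (borel :: 'a measure))"
    unfolding E_def
  proof (rule sets.sets_Collect_finite_All)
    show "finite {k. k \<le> n \<and> \<tau> k \<in> J}" by simp
    fix k assume k: "k \<in> {k. k \<le> n \<and> \<tau> k \<in> J}"
    have "(\<lambda>d. \<Sum>i<k. d i) \<in> (\<Pi>\<^sub>M i\<in>{..<n}. (borel :: 'a measure)) \<rightarrow>\<^sub>M borel"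
      using k by (intro borel_measurable_sum measurable_component_singleton) auto
    from measurable_sets[OF this borel_closed[OF C[of "\<tau> k"]]] k
    show "{d\<in>space (\<Pi>\<^sub>M i\<in>{..<n}. (borel :: 'a measure)). (\<Sum>i<k. d i) \<in> C (\<tau> k)} \<in> sets (\<Pi>\<^sub>M i\<in>{..<n}. borel)"
      by (simp add: vimage_def Int_def conj_commute)
  qed
  let ?A = "{\<omega>\<in>space (path_space T). \<forall>t\<in>J. \<omega> t \<in> C t}"
  have A[measurable]: "?A \<in> sets (path_space T)"
    unfolding sets_path_space closed_cylinders_def using J C by (intro sigma_sets.Basic) blast
  have iff: "\<omega> \<in> ?A \<longleftrightarrow> \<Delta> \<omega> \<in> E" if \<omega>: "\<omega> \<in> space (path_space T)" "\<omega> (-T) = 0" for \<omega>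
  proof -
    have tel: "(\<Sum>i<k. \<Delta> \<omega> i) = \<omega> (\<tau> k)" if "k \<le> n" for k
      using that
    proof (induction k)
      case 0
      then show ?case using \<omega>(2) by (simp add: \<tau>0)
    next
      case (Suc k)
      then show ?case by (simp add: \<Delta>_def)
    qed
    have "\<Delta> \<omega> \<in> space (\<Pi>\<^sub>M i\<in>{..<n}. (borel :: 'a measure))" using measurable_space[OF \<Delta> \<omega>(1)] .
    then have "\<Delta> \<omega> \<in> E \<longleftrightarrow> (\<forall>k\<in>{k. k \<le> n \<and> \<tau> k \<in> J}. \<omega> (\<tau> k) \<in> C (\<tau> k))"
      by (simp add: E_def tel)
    moreover have "t \<in> \<tau> ` {..n}" if "t \<in> J" for t using that by (simp add: \<tau>(1) S_def)
    then have "(\<forall>t\<in>J. \<omega> t \<in> C t) \<longleftrightarrow> (\<forall>k\<in>{k. k \<le> n \<and> \<tau> k \<in> J}. \<omega> (\<tau> k) \<in> C (\<tau> k))" by fastforce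
    ultimately show ?thesis using \<omega> by simp
  qed
  have main: "emeasure (distr M' (path_space T) W) ?A
      = emeasure (\<Pi>\<^sub>M i\<in>{..<n}. density lborel (\<lambda>z. ennreal (\<Prod>b\<in>Basis. normal_density 0 (sqrt (\<tau> (Suc i) - \<tau> i)) (z \<bullet> b)))) E"
    if W': "brownian_motion M' T W" for M' :: "'u measure" and W :: "'u \<Rightarrow> real \<Rightarrow> 'a"
  proof -
    have M': "prob_space M'" and W[measurable]: "W \<in> M' \<rightarrow>\<^sub>M path_space T" and 0: "AE w in M'. W w (-T) = 0"
      and gauss: "\<And>s t. -T \<le> s \<Longrightarrow> s < t \<Longrightarrow> t \<le> T \<Longrightarrow> distributed M' lborel (\<lambda>w. W w t - W w s)
          (\<lambda>z. ennreal (\<Prod>b\<in>Basis. normal_density 0 (sqrt (t - s)) (z \<bullet> b)))"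
      and ind: "prob_space.indep_vars M' (\<lambda>_. borel) (\<lambda>i w. W w (\<tau> (Suc i)) - W w (\<tau> i)) {..<n}"
      using W' \<tau>i \<tau>(2) unfolding brownian_motion_def by blast+
    interpret M': prob_space M' by fact
    have "emeasure (distr M' (path_space T) W) ?A = emeasure M' (W -` ?A \<inter> space M')" by (simp add: emeasure_distr)
    also have "\<dots> = emeasure M' ((\<lambda>w. \<Delta> (W w)) -` E \<inter> space M')"
    proof (rule emeasure_eq_AE)
      show "AE x in M'. (x \<in> W -` ?A \<inter> space M') = (x \<in> (\<lambda>w. \<Delta> (W w)) -` E \<inter> space M')"
        using 0 AE_space
      proof eventually_elim
        case (elim x)
        then show ?case using iff[of "W x"] measurable_space[OF W, of x] by simp
      qed
    qed measurable
    also have "\<dots> = emeasure (distr M' (\<Pi>\<^sub>M i\<in>{..<n}. borel) (\<lambda>w. \<Delta> (W w))) E" by (simp add: emeasure_distr)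
    also have "distr M' (\<Pi>\<^sub>M i\<in>{..<n}. borel) (\<lambda>w. \<Delta> (W w)) = (\<Pi>\<^sub>M i\<in>{..<n}. distr M' borel (\<lambda>w. W w (\<tau> (Suc i)) - W w (\<tau> i)))"
      using ind n measurable_compose[OF W i] unfolding \<Delta>_def
      by (subst (asm) M'.indep_vars_iff_distr_eq_PiM') auto
    also have "\<dots> = (\<Pi>\<^sub>M i\<in>{..<n}. density lborel (\<lambda>z. ennreal (\<Prod>b\<in>Basis. normal_density 0 (sqrt (\<tau> (Suc i) - \<tau> i)) (z \<bullet> b))))"
    proof (intro PiM_cong refl)
      fix i assume "i \<in> {..<n}"
      then have "distributed M' lborel (\<lambda>w. W w (\<tau> (Suc i)) - W w (\<tau> i))
          (\<lambda>z. ennreal (\<Prod>b\<in>Basis. normal_density 0 (sqrt (\<tau> (Suc i) - \<tau> i)) (z \<bullet> b)))"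
        using \<tau>(2) \<tau>i[of i] \<tau>i[of "Suc i"] by (intro gauss) auto
      then show "distr M' borel (\<lambda>w. W w (\<tau> (Suc i)) - W w (\<tau> i)) =
         density lborel (\<lambda>z. ennreal (\<Prod>b\<in>Basis. normal_density 0 (sqrt (\<tau> (Suc i) - \<tau> i)) (z \<bullet> b)))"
        using distr_cong[of M' M' borel lborel "\<lambda>w. W w (\<tau> (Suc i)) - W w (\<tau> i)"] by (simp add: distributed_def)
    qed
    finally show ?thesis .
  qed
  show "emeasure (distr M (path_space T) B) ?A = emeasure (distr N (path_space T) B') ?A"
    using main[OF BM] main[OF BM'] by simp
qed

section \<open>Regularity of the drift\<close>

lemma Ck_space_imp_continuous: "Ck_space k T f \<Longrightarrow> continuous_on ({-T..T} \<times> UNIV) (\<lambda>(t, z). f t z)"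
  by (cases k) auto

lemma admissible_partial:
  assumes "admissible_potential T U" "b \<in> Basis"
  shows "Ck_space 3 T (\<lambda>t. partial b (U t))"
  using assms by (simp add: admissible_potential_def eval_nat_numeral)

lemma continuous_on_grad:
  assumes U: "admissible_potential T U"
  shows "continuous_on ({-T..T} \<times> UNIV) (\<lambda>(t, z). grad (U t) z)"
proof -
  have "continuous_on ({-T..T} \<times> UNIV) (\<lambda>p. \<Sum>b\<in>Basis. (\<lambda>(t, z). partial b (U t) z) p *\<^sub>R b)"
    using Ck_space_imp_continuous[OF admissible_partial[OF U]] by (intro continuous_intros) auto
  then show ?thesis by (simp add: grad_def case_prod_unfold)
qed

lemma frechet_derivative_eq_sum_partial:
  assumes "f differentiable (at z)"
  shows "frechet_derivative f (at z) h = (\<Sum>b\<in>Basis. (h \<bullet> b) * partial b f z)"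
proof -
  have "linear (frechet_derivative f (at z))"
    using assms by (rule linear_frechet_derivative)
  then have "frechet_derivative f (at z) (\<Sum>b\<in>Basis. (h \<bullet> b) *\<^sub>R b) = (\<Sum>b\<in>Basis. (h \<bullet> b) *\<^sub>R frechet_derivative f (at z) b)"
    by (simp add: linear_sum linear_scale)
  then show ?thesis by (simp add: euclidean_representation partial_def)
qed

text \<open>The partial derivatives are jointly continuous, hence bounded on the compact product of
  time interval and ball; the mean value inequality then gives one constant for all times.\<close>

lemma locally_lipschitz_Ck_space:
  fixes f :: "real \<Rightarrow> 'a::euclidean_space \<Rightarrow> real"
  assumes f: "Ck_space (Suc k) T f"
  obtains L where "0 \<le> L" "\<And>t z z'. t \<in> {-T..T} \<Longrightarrow> z \<in> cball 0 r \<Longrightarrow> z' \<in> cball 0 r \<Longrightarrow> \<bar>f t z - f t z'\<bar> \<le> L * norm (z - z')"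
proof -
  define K where "K = {-T..T} \<times> (cball 0 r :: 'a set)"
  have K: "compact K" unfolding K_def by (intro compact_Times) auto
  have "\<exists>M. \<forall>t\<in>{-T..T}. \<forall>z\<in>cball 0 r. \<bar>partial b (f t) z\<bar> \<le> M" if b: "b \<in> Basis" for b
  proof -
    have "continuous_on ({-T..T} \<times> UNIV) (\<lambda>(t, z). partial b (f t) z)"
      using f b Ck_space_imp_continuous[of k T "\<lambda>t. partial b (f t)"] by simp
    then have "continuous_on K (\<lambda>(t, z). partial b (f t) z)"
      by (rule continuous_on_subset) (auto simp: K_def)
    then have "bounded ((\<lambda>(t, z). partial b (f t) z) ` K)"
      using K by (intro compact_imp_bounded compact_continuous_image)
    then obtain M where "\<forall>x\<in>(\<lambda>(t, z). partial b (f t) z) ` K. norm x \<le> M" by (auto simp: bounded_iff)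
    then show ?thesis by (intro exI[of _ M]) (force simp: K_def)
  qed
  then obtain M where M: "\<And>b t z. b \<in> Basis \<Longrightarrow> t \<in> {-T..T} \<Longrightarrow> z \<in> cball 0 r \<Longrightarrow> \<bar>partial b (f t) z\<bar> \<le> M b"
    by metis
  define L where "L = (\<Sum>b\<in>(Basis::'a set). \<bar>M b\<bar>)"
  show ?thesis
  proof (rule that[of L])
    show "0 \<le> L" by (simp add: L_def sum_nonneg)
    fix t and z z' :: 'a assume t: "t \<in> {-T..T}" and z: "z \<in> cball 0 r" "z' \<in> cball (0::'a) r"
    have d: "f t differentiable (at x)" for x using f t by simp
    have "norm (f t z - f t z') \<le> L * norm (z - z')"
    proof (rule differentiable_bound[of "cball 0 r" "f t" "\<lambda>x. frechet_derivative (f t) (at x)"])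
      show "(f t has_derivative frechet_derivative (f t) (at x)) (at x within cball 0 r)" for x
        using d frechet_derivative_works has_derivative_at_withinI by blast
      fix x :: 'a assume x: "x \<in> cball 0 r"
      show "onorm (frechet_derivative (f t) (at x)) \<le> L"
      proof (rule onorm_le)
        fix h
        have "norm (frechet_derivative (f t) (at x) h) \<le> (\<Sum>b\<in>Basis. norm ((h \<bullet> b) * partial b (f t) x))"
          unfolding frechet_derivative_eq_sum_partial[OF d] by (rule norm_sum)
        also have "\<dots> \<le> (\<Sum>b\<in>Basis. norm h * \<bar>M b\<bar>)"
        proof (rule sum_mono)
          fix b :: 'a assume b: "b \<in> Basis"
          have "\<bar>partial b (f t) x\<bar> \<le> \<bar>M b\<bar>" using M[OF b t x] by simp
          then show "norm ((h \<bullet> b) * partial b (f t) x) \<le> norm h * \<bar>M b\<bar>"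
            using Basis_le_norm[OF b, of h] by (auto simp: abs_mult intro!: mult_mono)
        qed
        also have "\<dots> = L * norm h" by (simp add: L_def sum_distrib_left mult.commute)
        finally show "norm (frechet_derivative (f t) (at x) h) \<le> L * norm h" .
      qed
    qed (use z in auto)
    then show "\<bar>f t z - f t z'\<bar> \<le> L * norm (z - z')" by simp
  qed
qed

lemma locally_lipschitz_grad:
  fixes U :: "real \<Rightarrow> 'a::euclidean_space \<Rightarrow> real"
  assumes U: "admissible_potential T U"
  obtains L where "0 \<le> L" "\<And>t z z'. t \<in> {-T..T} \<Longrightarrow> z \<in> cball 0 r \<Longrightarrow> z' \<in> cball 0 r \<Longrightarrow>
    norm (grad (U t) z - grad (U t) z') \<le> L * norm (z - z')"
proof -
  have "\<exists>L\<ge>0. \<forall>t\<in>{-T..T}. \<forall>z\<in>cball 0 r. \<forall>z'\<in>cball 0 r. \<bar>partial b (U t) z - partial b (U t) z'\<bar> \<le> L * norm (z - z')"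
    if "b \<in> Basis" for b
  proof -
    have "Ck_space (Suc 2) T (\<lambda>t. partial b (U t))" using admissible_partial[OF U that] by (simp add: eval_nat_numeral)
    then obtain L where "0 \<le> L" "\<And>t z z'. t \<in> {-T..T} \<Longrightarrow> z \<in> cball 0 r \<Longrightarrow> z' \<in> cball 0 r \<Longrightarrow>
        \<bar>partial b (U t) z - partial b (U t) z'\<bar> \<le> L * norm (z - z')"
      using locally_lipschitz_Ck_space[where r=r] by blast
    then show ?thesis by blast
  qed
  then obtain L where L: "\<And>b. b \<in> Basis \<Longrightarrow> 0 \<le> L b" "\<And>b t z z'. b \<in> Basis \<Longrightarrow> t \<in> {-T..T} \<Longrightarrow> z \<in> cball 0 r \<Longrightarrow> z' \<in> cball 0 r \<Longrightarrow>
      \<bar>partial b (U t) z - partial b (U t) z'\<bar> \<le> L b * norm (z - z')" by metis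
  show ?thesis
  proof (rule that[of "\<Sum>b\<in>(Basis::'a set). L b"])
    show "0 \<le> (\<Sum>b\<in>Basis. L b)" using L by (simp add: sum_nonneg)
    fix t and z z' :: 'a assume t: "t \<in> {-T..T}" "z \<in> cball 0 r" "z' \<in> cball (0::'a) r"
    have "norm (grad (U t) z - grad (U t) z') = norm (\<Sum>b\<in>Basis. (partial b (U t) z - partial b (U t) z') *\<^sub>R b)"
      by (simp add: grad_def sum_subtractf scaleR_diff_left)
    also have "\<dots> \<le> (\<Sum>b\<in>Basis. norm ((partial b (U t) z - partial b (U t) z') *\<^sub>R b))" by (rule norm_sum)
    also have "\<dots> \<le> (\<Sum>b\<in>Basis. L b * norm (z - z'))"
      using L(2) t by (intro sum_mono) auto
    finally show "norm (grad (U t) z - grad (U t) z') \<le> (\<Sum>b\<in>Basis. L b) * norm (z - z')"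
      by (simp add: sum_distrib_right)
  qed
qed

text \<open>The equation solved for \<open>B\<close>: as the noise is additive, a path determines its own noise.\<close>

definition driving_noise :: "real \<Rightarrow> (real \<Rightarrow> 'a::euclidean_space \<Rightarrow> real) \<Rightarrow> (real \<Rightarrow> 'a) \<Rightarrow> real \<Rightarrow> 'a" where
  "driving_noise T U \<omega> = (\<lambda>t\<in>{-T..T}. \<omega> t - \<omega> (-T) + integral {-T..t} (\<lambda>s. grad (U s) (\<omega> s)))"

lemma continuous_on_grad_path:
  assumes U: "admissible_potential T U" and \<omega>: "\<omega> \<in> space (path_space T)"
  shows "continuous_on {-T..T} (\<lambda>s. grad (U s) (\<omega> s))"
proof -
  have "continuous_on {-T..T} (\<lambda>s. (\<lambda>(t, z). grad (U t) z) (s, \<omega> s))"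
    by (rule continuous_on_compose2[OF continuous_on_grad[OF U]])
      (use \<omega> in \<open>auto simp: space_path_space intro!: continuous_intros\<close>)
  then show ?thesis by simp
qed

lemma driving_noise_in_space:
  assumes U: "admissible_potential T U" and \<omega>: "\<omega> \<in> space (path_space T)"
  shows "driving_noise T U \<omega> \<in> space (path_space T)"
proof -
  have "continuous_on {-T..T} (\<lambda>t. \<omega> t - \<omega> (-T) + integral {-T..t} (\<lambda>s. grad (U s) (\<omega> s)))"
    using \<omega> continuous_on_grad_path[OF U \<omega>]
    by (intro continuous_intros indefinite_integral_continuous_1 integrable_continuous_interval) (auto simp: space_path_space)
  then have "continuous_on {-T..T} (driving_noise T U \<omega>)"
    using continuous_on_cong[of "{-T..T}" "{-T..T}" "driving_noise T U \<omega>"] by (simp add: driving_noise_def)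
  then show ?thesis by (simp add: space_path_space driving_noise_def)
qed

text \<open>A continuous path is recovered in the limit from its values at grid times, and for each
  grid the evaluation is a countable case distinction in \<open>s\<close>. Clamping keeps every grid
  time inside the interval on which paths are continuous.\<close>

lemma measurable_path_eval_clamp:
  assumes T: "0 < T"
  shows "(\<lambda>(\<omega>, s). \<omega> (max (-T) (min T s))) \<in> path_space T \<Otimes>\<^sub>M borel \<rightarrow>\<^sub>M (borel :: 'a::euclidean_space measure)"
proof (rule borel_measurable_LIMSEQ_metric)
  define cl where "cl s = max (-T) (min T s)" for s :: real
  have cl: "cl s \<in> {-T..T}" for s using T by (auto simp: cl_def)
  fix n :: nat
  show "(\<lambda>p. fst p (cl (real_of_int \<lfloor>real (Suc n) * snd p\<rfloor> / Suc n))) \<in> path_space T \<Otimes>\<^sub>M borel \<rightarrow>\<^sub>M (borel :: 'a measure)"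
  proof (rule measurable_compose_countable[where f="\<lambda>i p. fst p (cl (real_of_int i / Suc n))" and g="\<lambda>p. \<lfloor>real (Suc n) * snd p\<rfloor>"])
    show "(\<lambda>p. fst p (cl (real_of_int i / Suc n))) \<in> path_space T \<Otimes>\<^sub>M borel \<rightarrow>\<^sub>M (borel :: 'a measure)" for i
      by (rule measurable_compose[OF measurable_fst measurable_path_eval[OF cl]])
    show "(\<lambda>p. \<lfloor>real (Suc n) * snd p\<rfloor>) \<in> path_space T \<Otimes>\<^sub>M borel \<rightarrow>\<^sub>M count_space UNIV"
      by measurable
  qed
next
  define cl where "cl s = max (-T) (min T s)" for s :: real
  have cl: "cl s \<in> {-T..T}" for s using T by (auto simp: cl_def)
  have ccl: "continuous_on UNIV cl" unfolding cl_def by (intro continuous_intros)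
  fix p :: "(real \<Rightarrow> 'a) \<times> real" assume p: "p \<in> space (path_space T \<Otimes>\<^sub>M borel)"
  have \<omega>: "continuous_on {-T..T} (fst p)" using p by (auto simp: space_pair_measure space_path_space)
  have "(\<lambda>n. snd p - 1 / Suc n) \<longlonglongrightarrow> snd p"
    using LIMSEQ_inverse_real_of_nat_add_minus[of "snd p"] by (simp add: inverse_eq_divide)
  moreover have "(\<lambda>n. snd p) \<longlonglongrightarrow> snd p" by simp
  ultimately have lim: "(\<lambda>n. real_of_int \<lfloor>real (Suc n) * snd p\<rfloor> / Suc n) \<longlonglongrightarrow> snd p"
  proof (rule tendsto_sandwich[rotated 2])
    have "real_of_int \<lfloor>real (Suc n) * snd p\<rfloor> / Suc n \<le> (real (Suc n) * snd p) / Suc n"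
      "(real (Suc n) * snd p - 1) / Suc n \<le> real_of_int \<lfloor>real (Suc n) * snd p\<rfloor> / Suc n" for n
      by (intro divide_right_mono; linarith)+
    then show "\<forall>\<^sub>F n in sequentially. snd p - 1 / Suc n \<le> real_of_int \<lfloor>real (Suc n) * snd p\<rfloor> / Suc n"
      "\<forall>\<^sub>F n in sequentially. real_of_int \<lfloor>real (Suc n) * snd p\<rfloor> / Suc n \<le> snd p"
      by (auto simp: diff_divide_distrib simp del: of_nat_Suc)
  qed
  have "(\<lambda>n. cl (real_of_int \<lfloor>real (Suc n) * snd p\<rfloor> / Suc n)) \<longlonglongrightarrow> cl (snd p)"
    by (rule continuous_on_tendsto_compose[OF ccl lim]) auto
  then have "(\<lambda>n. fst p (cl (real_of_int \<lfloor>real (Suc n) * snd p\<rfloor> / Suc n))) \<longlonglongrightarrow> fst p (cl (snd p))"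
    by (rule continuous_on_tendsto_compose[OF \<omega>]) (use cl in auto)
  then show "(\<lambda>n. fst p (cl (real_of_int \<lfloor>real (Suc n) * snd p\<rfloor> / Suc n))) \<longlonglongrightarrow> (case p of (\<omega>, s) \<Rightarrow> \<omega> (max (-T) (min T s)))"
    by (simp add: cl_def case_prod_unfold)
qed

text \<open>The integrand is jointly measurable in path and time, so Fubini's theorem makes its time
  integral measurable in the path, after the gauge integral has been identified with the Lebesgue
  integral.\<close>

lemma measurable_driving_noise:
  assumes T: "0 < T" and U: "admissible_potential T (U :: real \<Rightarrow> 'a::euclidean_space \<Rightarrow> real)"
  shows "driving_noise T U \<in> path_space T \<rightarrow>\<^sub>M path_space T"
proof (rule measurable_path_spaceI)
  fix t assume t: "t \<in> {-T..T}"
  define cl where "cl s = max (-T) (min T s)" for s :: real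
  have cl: "cl s \<in> {-T..T}" for s using T by (auto simp: cl_def)
  have clid: "cl s = s" if "s \<in> {-T..t}" for s using that t by (auto simp: cl_def)
  have [measurable]: "(\<lambda>p. fst p (cl (snd p))) \<in> path_space T \<Otimes>\<^sub>M borel \<rightarrow>\<^sub>M (borel :: 'a measure)"
    using measurable_path_eval_clamp[OF T] by (simp add: cl_def case_prod_unfold)
  have "continuous_on UNIV (\<lambda>p::real \<times> 'a. (\<lambda>(t, z). grad (U t) z) (cl (fst p), snd p))"
    by (rule continuous_on_compose2[OF continuous_on_grad[OF U]])
      (use cl in \<open>auto simp: cl_def intro!: continuous_intros\<close>)
  then have g[measurable]: "(\<lambda>p::real \<times> 'a. grad (U (cl (fst p))) (snd p)) \<in> borel \<Otimes>\<^sub>M borel \<rightarrow>\<^sub>M borel"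
    by (simp add: borel_prod borel_measurable_continuous_onI)
  \<comment> \<open>The clamp \<open>cl\<close> is the identity on the range of integration and
    makes the integrand jointly measurable on the whole line.\<close>
  define h where "h \<omega> s = indicator {-T..t} s *\<^sub>R grad (U (cl s)) (\<omega> (cl s))" for \<omega> s
  have g2: "(\<lambda>q. grad (U (cl (snd q))) (fst q (cl (snd q)))) \<in> path_space T \<Otimes>\<^sub>M borel \<rightarrow>\<^sub>M (borel :: 'a measure)"
  proof -
    have "(\<lambda>q. (snd q, fst q (cl (snd q)))) \<in> path_space T \<Otimes>\<^sub>M borel \<rightarrow>\<^sub>M borel \<Otimes>\<^sub>M (borel :: 'a measure)" by measurable
    from measurable_compose[OF this g] show ?thesis by simp
  qed
  have "(\<lambda>\<omega>. \<integral>s. h \<omega> s \<partial>lborel) \<in> borel_measurable (path_space T)"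
  proof (rule lborel.borel_measurable_lebesgue_integral)
    have "case_prod h = (\<lambda>q. indicator {-T..t} (snd q) *\<^sub>R grad (U (cl (snd q))) (fst q (cl (snd q))))"
      by (auto simp: h_def)
    moreover have "\<dots> \<in> borel_measurable (path_space T \<Otimes>\<^sub>M borel)" using g2 by measurable
    ultimately show "case_prod h \<in> borel_measurable (path_space T \<Otimes>\<^sub>M lborel)"
      by (simp cong: measurable_cong_sets)
  qed
  moreover have "integral {-T..t} (\<lambda>s. grad (U s) (\<omega> s)) = (\<integral>s. h \<omega> s \<partial>lborel)" if \<omega>: "\<omega> \<in> space (path_space T)" for \<omega>
  proof -
    have "continuous_on {-T..t} (\<lambda>s. grad (U s) (\<omega> s))"
      by (rule continuous_on_subset[OF continuous_on_grad_path[OF U \<omega>]]) (use t in auto)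
    then have "set_integrable lborel {-T..t} (\<lambda>s. grad (U s) (\<omega> s))"
      by (intro borel_integrable_atLeastAtMost')
    then have "integral {-T..t} (\<lambda>s. grad (U s) (\<omega> s)) = (LINT s:{-T..t}|lborel. grad (U s) (\<omega> s))"
      by (rule set_borel_integral_eq_integral(2)[symmetric])
    also have "\<dots> = (\<integral>s. h \<omega> s \<partial>lborel)"
      unfolding set_lebesgue_integral_def h_def
      by (intro Bochner_Integration.integral_cong) (auto simp: indicator_def clid)
    finally show ?thesis .
  qed
  ultimately have [measurable]: "(\<lambda>\<omega>. integral {-T..t} (\<lambda>s. grad (U s) (\<omega> s))) \<in> borel_measurable (path_space T)"
    by (simp cong: measurable_cong)
  have "-T \<in> {-T..T}" using T by auto
  then have "(\<lambda>\<omega>. \<omega> t - \<omega> (-T) + integral {-T..t} (\<lambda>s. grad (U s) (\<omega> s))) \<in> path_space T \<rightarrow>\<^sub>M (borel :: 'a measure)"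
    using t by (intro borel_measurable_add borel_measurable_diff measurable_path_eval) measurable
  then show "(\<lambda>\<omega>. driving_noise T U \<omega> t) \<in> path_space T \<rightarrow>\<^sub>M borel"
    using t by (simp add: driving_noise_def)
qed (rule driving_noise_in_space[OF U])

text \<open>The integral of \<open>d\<close> damped by \<open>exp (- L * t)\<close> has nonpositive
  derivative and starts at 0, so it never becomes positive.\<close>

lemma gronwall_zero:
  fixes d :: "real \<Rightarrow> real"
  assumes "a \<le> b" "continuous_on {a..b} d" "\<And>t. t \<in> {a..b} \<Longrightarrow> 0 \<le> d t"
    and le: "\<And>t. t \<in> {a..b} \<Longrightarrow> d t \<le> L * integral {a..t} d" and L: "0 \<le> L" and t: "t \<in> {a..b}"
  shows "d t = 0"
proof -
  define u where "u t = integral {a..t} d" for t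
  define v where "v t = u t * exp (- L * t)" for t
  have ucont: "continuous_on {a..b} u" unfolding u_def
    by (intro indefinite_integral_continuous_1 integrable_continuous_interval assms)
  have "v t \<le> v a"
  proof (rule DERIV_nonpos_imp_decreasing_open[of a t v])
    show "a \<le> t" using t by simp
    show "continuous_on {a..t} v" unfolding v_def
      by (intro continuous_intros continuous_on_subset[OF ucont]) (use t in auto)
    fix s assume s: "a < s" "s < t"
    then have sb: "s \<in> {a..b}" using t by auto
    have "(u has_real_derivative d s) (at s within {a..b})"
      unfolding u_def by (rule integral_has_real_derivative[OF assms(2) sb])
    moreover have "at s within {a..b} = at s" using s t by (intro at_within_Icc_at) auto
    ultimately have u': "(u has_real_derivative d s) (at s)" by simp
    have "(v has_real_derivative (d s - L * u s) * exp (- L * s)) (at s)"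
      unfolding v_def by (auto intro!: derivative_eq_intros u' simp: algebra_simps)
    moreover have "(d s - L * u s) * exp (- L * s) \<le> 0"
      using le[OF sb] by (simp add: u_def mult_le_0_iff)
    ultimately show "\<exists>y. (v has_real_derivative y) (at s) \<and> y \<le> 0" by blast
  qed
  moreover have "v a = 0" by (simp add: v_def u_def)
  ultimately have "u t \<le> 0" by (simp add: v_def mult_le_0_iff not_le[symmetric])
  then have "d t \<le> 0" using le[OF t] L by (simp add: u_def) (meson mult_nonneg_nonpos order_trans)
  then show ?thesis using assms(3)[OF t] by simp
qed

text \<open>This is pathwise uniqueness. Both paths are continuous on a compact interval, hence stay
  in a common ball; there the gradient is Lipschitz uniformly in time, and Gronwall's inequality
  makes the distance of the paths vanish.\<close>

lemma driving_noise_inj: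
  fixes \<omega> \<omega>' :: "real \<Rightarrow> 'a::euclidean_space"
  assumes T: "0 < T" and U: "admissible_potential T U"
    and \<omega>: "\<omega> \<in> space (path_space T)" and \<omega>': "\<omega>' \<in> space (path_space T)"
    and eq: "driving_noise T U \<omega> = driving_noise T U \<omega>'" and init: "\<omega> (-T) = \<omega>' (-T)"
  shows "\<omega> = \<omega>'"
proof -
  have c: "continuous_on {-T..T} \<omega>" "continuous_on {-T..T} \<omega>'" using \<omega> \<omega>' by (auto simp: space_path_space)
  have "bounded (\<omega> ` {-T..T} \<union> \<omega>' ` {-T..T})"
    using c by (intro bounded_Un[THEN iffD2] conjI compact_imp_bounded compact_continuous_image) auto
  then obtain r where "\<forall>x\<in>\<omega> ` {-T..T} \<union> \<omega>' ` {-T..T}. norm x \<le> r" by (auto simp: bounded_iff)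
  then have r: "\<And>s. s \<in> {-T..T} \<Longrightarrow> \<omega> s \<in> cball 0 r" "\<And>s. s \<in> {-T..T} \<Longrightarrow> \<omega>' s \<in> cball 0 r" by simp_all
  obtain L where L: "0 \<le> L" "\<And>t z z'. t \<in> {-T..T} \<Longrightarrow> z \<in> cball 0 r \<Longrightarrow> z' \<in> cball 0 r \<Longrightarrow>
    norm (grad (U t) z - grad (U t) z') \<le> L * norm (z - z')"
    using locally_lipschitz_grad[OF U, of r] by blast
  define d where "d t = norm (\<omega> t - \<omega>' t)" for t
  have dc: "continuous_on {-T..T} d" unfolding d_def using c by (intro continuous_intros)
  have "d t = 0" if t: "t \<in> {-T..T}" for t
  proof (rule gronwall_zero[of "-T" T d L t])
    fix t assume t: "t \<in> {-T..T}"
    have sub: "{-T..t} \<subseteq> {-T..T}" using t by auto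
    have i1: "(\<lambda>s. grad (U s) (\<omega> s)) integrable_on {-T..t}" "(\<lambda>s. grad (U s) (\<omega>' s)) integrable_on {-T..t}"
      by (intro integrable_continuous_interval continuous_on_subset[OF continuous_on_grad_path[OF U] sub] \<omega> \<omega>')+
    have i2: "d integrable_on {-T..t}"
      by (intro integrable_continuous_interval continuous_on_subset[OF dc sub])
    have "\<omega> t - \<omega> (-T) + integral {-T..t} (\<lambda>s. grad (U s) (\<omega> s)) = \<omega>' t - \<omega>' (-T) + integral {-T..t} (\<lambda>s. grad (U s) (\<omega>' s))"
      using fun_cong[OF eq, of t] t by (simp add: driving_noise_def)
    then have "\<omega> t - \<omega>' t = integral {-T..t} (\<lambda>s. grad (U s) (\<omega>' s)) - integral {-T..t} (\<lambda>s. grad (U s) (\<omega> s))"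
      using init by (simp add: algebra_simps)
    also have "\<dots> = integral {-T..t} (\<lambda>s. grad (U s) (\<omega>' s) - grad (U s) (\<omega> s))"
      using i1 by (simp add: Henstock_Kurzweil_Integration.integral_diff)
    finally have "d t = norm (integral {-T..t} (\<lambda>s. grad (U s) (\<omega>' s) - grad (U s) (\<omega> s)))" by (simp add: d_def)
    also have "\<dots> \<le> integral {-T..t} (\<lambda>s. L * d s)"
    proof (rule integral_norm_bound_integral)
      show "(\<lambda>s. grad (U s) (\<omega>' s) - grad (U s) (\<omega> s)) integrable_on {-T..t}" using i1 by (intro integrable_diff)
      show "(\<lambda>s. L * d s) integrable_on {-T..t}" using integrable_cmul[OF i2, of L] by simp
      show "norm (grad (U s) (\<omega>' s) - grad (U s) (\<omega> s)) \<le> L * d s" if "s \<in> {-T..t}" for s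
        using that sub L(2)[of s "\<omega>' s" "\<omega> s"] r[of s] by (auto simp: d_def norm_minus_commute)
    qed
    also have "\<dots> = L * integral {-T..t} d" by simp
    finally show "d t \<le> L * integral {-T..t} d" .
  qed (use T t L dc in \<open>auto simp: d_def\<close>)
  then show ?thesis using path_eq_iff[OF \<omega> \<omega>'] by (auto simp: d_def)
qed

lemma langevin_solution_noise:
  assumes T: "0 < T" and U: "admissible_potential T U" and sol: "langevin_solution M T U \<mu> B X"
  shows "AE w in M. driving_noise T U (X w) = B w"
proof -
  have B: "B \<in> M \<rightarrow>\<^sub>M path_space T" and X: "X \<in> M \<rightarrow>\<^sub>M path_space T"
    and eq: "AE w in M. \<forall>t\<in>{-T..T}. X w t = X w (-T) - integral {-T..t} (\<lambda>s. grad (U s) (X w s)) + B w t"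
    using sol by (auto simp: langevin_solution_def brownian_motion_def)
  from eq AE_space show ?thesis
  proof eventually_elim
    case (elim w)
    have "driving_noise T U (X w) t = B w t" if "t \<in> {-T..T}" for t
    proof -
      from elim(1) that have "X w t = X w (-T) - integral {-T..t} (\<lambda>s. grad (U s) (X w s)) + B w t" by blast
      moreover have "driving_noise T U (X w) t = X w t - X w (-T) + integral {-T..t} (\<lambda>s. grad (U s) (X w s))"
        using that by (simp add: driving_noise_def)
      ultimately show ?thesis by (simp only:) simp
    qed
    then show ?case
      using path_eq_iff[OF measurable_space[OF measurable_compose[OF X measurable_driving_noise[OF T U]] elim(2)] measurable_space[OF B elim(2)]]
      by blast
  qed
qed

lemma langevin_law_noise:
  assumes T: "0 < T" and U: "admissible_potential T U" and sol: "langevin_solution M T U \<mu> B X"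
  shows "distr (distr M (path_space T) X) (path_space T) (driving_noise T U) = distr M (path_space T) B"
proof -
  have B[measurable]: "B \<in> M \<rightarrow>\<^sub>M path_space T" and X[measurable]: "X \<in> M \<rightarrow>\<^sub>M path_space T"
    using sol by (auto simp: langevin_solution_def brownian_motion_def)
  note N[measurable] = measurable_driving_noise[OF T U]
  have "distr (distr M (path_space T) X) (path_space T) (driving_noise T U) = distr M (path_space T) (\<lambda>w. driving_noise T U (X w))"
    by (subst distr_distr[OF N X]) (simp add: o_def)
  also have "\<dots> = distr M (path_space T) B"
    by (rule distr_cong_AE) (use langevin_solution_noise[OF T U sol] in auto)
  finally show ?thesis .
qed

lemma langevin_solution_law_in_space:
  assumes "langevin_solution M T U \<mu> B X"
  shows "distr M (path_space T) X \<in> space (prob_algebra (path_space T))"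
  using assms prob_space.prob_space_distr[of M X "path_space T"]
  by (auto simp: space_prob_algebra langevin_solution_def brownian_motion_def)

text \<open>The real code of paths is injective and measurable, so equality of paths becomes
  equality of reals.\<close>

lemma pred_path_eq:
  assumes T: "0 < T" and f[measurable]: "f \<in> M \<rightarrow>\<^sub>M path_space T" and g[measurable]: "g \<in> M \<rightarrow>\<^sub>M (path_space T :: (real \<Rightarrow> 'a::euclidean_space) measure)"
  shows "Measurable.pred M (\<lambda>w. f w = g w)"
proof -
  obtain c d where c[measurable]: "c \<in> path_space T \<rightarrow>\<^sub>M (borel :: real measure)"
    and dc: "\<And>\<omega> :: real \<Rightarrow> 'a. \<omega> \<in> space (path_space T) \<Longrightarrow> d (c \<omega>) = \<omega>"
    using retract_path_space[OF T, where 'a='a] unfolding retract_of_unit_interval_def by auto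
  have inj: "\<omega> = \<omega>'" if "\<omega> \<in> space (path_space T)" "\<omega>' \<in> space (path_space T)" "c \<omega> = c \<omega>'" for \<omega> \<omega>' :: "real \<Rightarrow> 'a"
  proof -
    have "\<omega> = d (c \<omega>)" using dc[OF that(1)] by (rule sym)
    also have "\<dots> = d (c \<omega>')" by (simp only: that(3))
    also have "\<dots> = \<omega>'" by (rule dc[OF that(2)])
    finally show ?thesis .
  qed
  have "Measurable.pred M (\<lambda>w. c (f w) = c (g w))" by measurable
  moreover have "c (f w) = c (g w) \<longleftrightarrow> f w = g w" if "w \<in> space M" for w
    using inj[OF measurable_space[OF f that] measurable_space[OF g that]] by auto
  ultimately show ?thesis by (simp cong: measurable_cong)
qed

lemma emeasure_AE_eq_const:
  assumes "prob_space k" and AE: "AE w in k. w = c" and A: "A \<in> sets k"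
  shows "emeasure k A = indicator A c"
proof -
  interpret prob_space k by fact
  have "emeasure k A = (\<integral>\<^sup>+w. indicator A w \<partial>k)" using A by simp
  also have "\<dots> = (\<integral>\<^sup>+w. indicator A c \<partial>k)"
    using AE by (intro nn_integral_cong_AE) (auto elim: AE_mp)
  finally show ?thesis by (simp add: emeasure_space_1)
qed

text \<open>Yamada-Watanabe: conditionally on the noise, both laws are the Dirac mass at the pathwise unique solution.\<close>

lemma is_langevin_law_unique:
  fixes P1 P2 :: "(real \<Rightarrow> 'a::euclidean_space) measure"
  assumes T: "0 < T" and U: "admissible_potential T U"
    and P1: "is_langevin_law T U (return borel x) P1" and P2: "is_langevin_law T U (return borel x) P2"
  shows "P1 = P2"
proof -
  note N[measurable] = measurable_driving_noise[OF T U]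
  define D where "D = distr P1 (path_space T) (driving_noise T U)"
  have mT[measurable]: "(\<lambda>\<omega>. \<omega> (-T)) \<in> path_space T \<rightarrow>\<^sub>M (borel :: 'a measure)"
    using T by (intro measurable_path_eval) auto
  \<comment> \<open>Each of the two laws is disintegrated along its own noise. Both noises are
    Brownian motions, so the base measure is the same \<open>D\<close>, and the conditional laws
    live on paths with the given noise and start \<open>x\<close>.\<close>
  have kernel: "\<exists>k. disintegration P (driving_noise T U) (path_space T) k \<and>
      (AE b in D. AE \<omega> in k b. driving_noise T U \<omega> = b \<and> \<omega> (-T) = x) \<and>
      distr P (path_space T) (driving_noise T U) = D \<and> P \<in> space (prob_algebra (path_space T))"
    if P: "is_langevin_law T U (return borel x) P" for P
  proof -
    obtain M1 :: "(real \<Rightarrow> 'a) measure" and B1 X1 where 1: "langevin_solution M1 T U (return borel x) B1 X1" "P1 = distr M1 (path_space T) X1"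
      using P1 unfolding is_langevin_law_def by blast
    obtain M :: "(real \<Rightarrow> 'a) measure" and B X where 2: "langevin_solution M T U (return borel x) B X" "P = distr M (path_space T) X"
      using P unfolding is_langevin_law_def by blast
    have BM: "brownian_motion M1 T B1" "brownian_motion M T B" using 1 2 by (auto simp: langevin_solution_def)
    have D: "distr P (path_space T) (driving_noise T U) = D"
      unfolding D_def 1 2 langevin_law_noise[OF T U 1(1)] langevin_law_noise[OF T U 2(1)]
      by (rule brownian_law_unique[OF T BM(2,1)])
    have Pp: "P \<in> space (prob_algebra (path_space T))" unfolding 2(2) by (rule langevin_solution_law_in_space[OF 2(1)])
    then have sP[measurable_cong]: "sets P = sets (path_space T)" and pP: "prob_space P" by (auto simp: space_prob_algebra)
    have NP: "driving_noise T U \<in> P \<rightarrow>\<^sub>M path_space T" by measurable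
    obtain k where k: "disintegration P (driving_noise T U) (path_space T) k"
      using exists_disintegration[OF retract_path_space[OF T] Pp N] by blast
    have X[measurable]: "X \<in> M \<rightarrow>\<^sub>M path_space T" and init: "distr M borel (\<lambda>w. X w (-T)) = return borel x"
      using 2 by (auto simp: langevin_solution_def)
    have init': "distr P borel (\<lambda>\<omega>. \<omega> (-T)) = return borel x"
      unfolding 2(2) using init by (subst distr_distr) (auto simp: o_def)
    have "AE y in distr P borel (\<lambda>\<omega>. \<omega> (-T)). y = x" unfolding init' by (simp add: AE_return)
    then have "AE \<omega> in P. \<omega> (-T) = x" by (subst (asm) AE_distr_iff) auto
    then have AEx: "AE \<omega> in P. driving_noise T U \<omega> = fst (driving_noise T U \<omega>, \<omega>) \<and> snd (driving_noise T U \<omega>, \<omega>) (-T) = x" by simp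
    have "Measurable.pred (path_space T \<Otimes>\<^sub>M P) (\<lambda>p. driving_noise T U (snd p) = fst p \<and> snd p (-T) = x)"
      by (intro pred_intros_logic pred_path_eq[OF T]) measurable
    from disintegration_AE[OF pP NP k this] AEx
    have "AE b in distr P (path_space T) (driving_noise T U). AE \<omega> in k b. driving_noise T U \<omega> = b \<and> \<omega> (-T) = x" by simp
    then show ?thesis using k D Pp by auto
  qed
  obtain k1 where k1: "disintegration P1 (driving_noise T U) (path_space T) k1"
      "AE b in D. AE \<omega> in k1 b. driving_noise T U \<omega> = b \<and> \<omega> (-T) = x"
      and P1s: "P1 \<in> space (prob_algebra (path_space T))"
    using kernel[OF P1] by blast
  obtain k2 where k2: "disintegration P2 (driving_noise T U) (path_space T) k2"
      "AE b in D. AE \<omega> in k2 b. driving_noise T U \<omega> = b \<and> \<omega> (-T) = x"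
      and D2: "distr P2 (path_space T) (driving_noise T U) = D" and P2s: "P2 \<in> space (prob_algebra (path_space T))"
    using kernel[OF P2] by blast
  have sP: "sets P1 = sets (path_space T)" "sets P2 = sets (path_space T)" using P1s P2s by (auto simp: space_prob_algebra)
  have "AE b in D. k1 b = k2 b"
    using k1(2) k2(2) AE_space
  proof eventually_elim
    case (elim b)
    have b: "b \<in> space (path_space T)" using elim(3) by (simp add: D_def)
    have k: "prob_space (k1 b)" "sets (k1 b) = sets (path_space T)" "prob_space (k2 b)" "sets (k2 b) = sets (path_space T)"
      using measurable_space[of k1 "path_space T" "prob_algebra P1" b] measurable_space[of k2 "path_space T" "prob_algebra P2" b] k1(1) k2(1) b sP
      by (auto simp: disintegration_def space_prob_algebra)
    interpret K1: prob_space "k1 b" by fact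
    have spk: "space (k1 b) = space (path_space T)" "space (k2 b) = space (path_space T)"
      using k by (auto dest: sets_eq_imp_space_eq)
    have "AE \<omega> in k1 b. \<omega> \<in> space (path_space T) \<and> driving_noise T U \<omega> = b \<and> \<omega> (-T) = x"
      using elim(1) AE_space by eventually_elim (simp add: spk)
    \<comment> \<open>A path with noise \<open>b\<close> and start \<open>x\<close> exists because a
      property that holds almost surely holds somewhere; injectivity of the noise map makes it the
      only one, for both kernels.\<close>
    from eventually_happens'[OF K1.ae_filter_bot this]
    obtain \<omega>0 where \<omega>0: "\<omega>0 \<in> space (path_space T)" "driving_noise T U \<omega>0 = b" "\<omega>0 (-T) = x" by blast
    have "AE \<omega> in k1 b. \<omega> = \<omega>0"
      using elim(1) AE_space by eventually_elim (auto intro!: driving_noise_inj[OF T U _ \<omega>0(1)] simp: \<omega>0 spk)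
    moreover have "AE \<omega> in k2 b. \<omega> = \<omega>0"
      using elim(2) AE_space by eventually_elim (auto intro!: driving_noise_inj[OF T U _ \<omega>0(1)] simp: \<omega>0 spk)
    ultimately show ?case
      using emeasure_AE_eq_const[OF k(1)] emeasure_AE_eq_const[OF k(3)] by (intro measure_eqI) (simp_all add: k)
  qed
  show ?thesis
  proof (rule measure_eqI)
    show "sets P1 = sets P2" using sP by simp
    fix A assume A: "A \<in> sets P1"
    have e: "emeasure P A = (\<integral>\<^sup>+b. emeasure (k b) A \<partial>D)"
      if k: "disintegration P (driving_noise T U) (path_space T) k" and "distr P (path_space T) (driving_noise T U) = D"
        and P: "P \<in> space (prob_algebra (path_space T))" for P k
    proof -
      have sP: "sets P = sets (path_space T)" using P by (auto simp: space_prob_algebra)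
      have spP: "space P = space (path_space T)" by (rule sets_eq_imp_space_eq[OF sP])
      have AP: "A \<in> sets P" using A P1s sP by (auto simp: space_prob_algebra)
      have "emeasure P {w\<in>space P. w \<in> A \<and> driving_noise T U w \<in> space (path_space T)}
          = (\<integral>\<^sup>+b. emeasure (k b) A * indicator (space (path_space T)) b \<partial>D)"
        using k that(2) AP unfolding disintegration_def by blast
      also have "{w\<in>space P. w \<in> A \<and> driving_noise T U w \<in> space (path_space T)} = A"
        using sets.sets_into_space[OF AP] driving_noise_in_space[OF U] by (auto simp: spP)
      also have "(\<integral>\<^sup>+b. emeasure (k b) A * indicator (space (path_space T)) b \<partial>D) = (\<integral>\<^sup>+b. emeasure (k b) A \<partial>D)"
        by (intro nn_integral_cong) (simp add: D_def)
      finally show ?thesis .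
    qed
    have "emeasure P1 A = (\<integral>\<^sup>+b. emeasure (k1 b) A \<partial>D)" by (rule e[OF k1(1) _ P1s]) (simp add: D_def)
    also have "\<dots> = (\<integral>\<^sup>+b. emeasure (k2 b) A \<partial>D)"
      using \<open>AE b in D. k1 b = k2 b\<close> by (intro nn_integral_cong_AE) auto
    also have "\<dots> = emeasure P2 A" by (rule e[OF k2(1) D2 P2s, symmetric])
    finally show "emeasure P1 A = emeasure P2 A" .
  qed
qed

lemma prob_algebra_cong:
  assumes "sets M = sets N"
  shows "prob_algebra M = prob_algebra N"
  unfolding prob_algebra_def subprob_algebra_cong[OF assms] ..

lemma disintegrationD:
  assumes "disintegration P f S k" "A \<in> sets P" "C \<in> sets S"
  shows "emeasure P {w\<in>space P. w \<in> A \<and> f w \<in> C} = (\<integral>\<^sup>+s. emeasure (k s) A * indicator C s \<partial>distr P S f)"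
  using assms unfolding disintegration_def by blast

text \<open>Start and noise are independent, so for almost every \<open>x\<close> the noise still
  has the Brownian law under \<open>k x\<close>. The canonical process, together with the noise that
  it determines, then solves the equation from \<open>x\<close> under \<open>k x\<close>, and
  uniqueness identifies \<open>k x\<close> with \<open>langevin_from T U x\<close>.\<close>

lemma langevin_disintegration:
  fixes P :: "(real \<Rightarrow> 'a::euclidean_space) measure"
  assumes T: "0 < T" and U: "admissible_potential T U" and P: "is_langevin_law T U \<mu> P"
  obtains k where "disintegration P (\<lambda>\<omega>. \<omega> (-T)) borel k" "AE x in distr P borel (\<lambda>\<omega>. \<omega> (-T)). langevin_from T U x = k x"
proof -
  note N[measurable] = measurable_driving_noise[OF T U]
  have mT[measurable]: "(\<lambda>\<omega>. \<omega> (-T)) \<in> path_space T \<rightarrow>\<^sub>M (borel :: 'a measure)"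
    using T by (intro measurable_path_eval) auto
  obtain M :: "(real \<Rightarrow> 'a) measure" and B X where sol: "langevin_solution M T U \<mu> B X" and PM: "P = distr M (path_space T) X"
    using P unfolding is_langevin_law_def by blast
  have BM: "brownian_motion M T B" and X[measurable]: "X \<in> M \<rightarrow>\<^sub>M path_space T" and init: "distr M borel (\<lambda>w. X w (-T)) = \<mu>"
    and ind: "prob_space.indep_set M {(\<lambda>w. X w (-T)) -` A \<inter> space M | A. A \<in> sets borel} {B -` A \<inter> space M | A. A \<in> sets (path_space T)}"
    using sol by (auto simp: langevin_solution_def)
  have M: "prob_space M" and B[measurable]: "B \<in> M \<rightarrow>\<^sub>M path_space T" using BM by (auto simp: brownian_motion_def)
  interpret M: prob_space M by fact
  have Ps: "P \<in> space (prob_algebra (path_space T))" unfolding PM by (rule langevin_solution_law_in_space[OF sol])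
  then have sP[measurable_cong]: "sets P = sets (path_space T)" and pP: "prob_space P" by (auto simp: space_prob_algebra)
  have spP: "space P = space (path_space T)" by (rule sets_eq_imp_space_eq[OF sP])
  interpret P: prob_space P by fact
  have mTP: "(\<lambda>\<omega>. \<omega> (-T)) \<in> P \<rightarrow>\<^sub>M (borel :: 'a measure)" by measurable
  have \<mu>: "distr P borel (\<lambda>\<omega>. \<omega> (-T)) = \<mu>"
    unfolding PM using init by (subst distr_distr) (auto simp: o_def)
  have s\<mu>[measurable_cong]: "sets \<mu> = sets borel" unfolding \<mu>[symmetric] by simp
  have p\<mu>: "prob_space \<mu>" unfolding \<mu>[symmetric] by (rule P.prob_space_distr[OF mTP])
  obtain k where k: "disintegration P (\<lambda>\<omega>. \<omega> (-T)) borel k"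
    using exists_disintegration[OF retract_path_space[OF T] Ps mT] by blast
  have k1: "k \<in> borel \<rightarrow>\<^sub>M prob_algebra (path_space T)" using k prob_algebra_cong[OF sP] by (simp add: disintegration_def)
  have kp: "prob_space (k x)" "sets (k x) = sets (path_space T)" for x
    using measurable_space[OF k1, of x] by (auto simp: space_prob_algebra)
  have spk: "space (k x) = space (path_space T)" for x by (rule sets_eq_imp_space_eq[OF kp(2)])
  define W where "W = distr M (path_space T) B"
  have W: "W \<in> space (prob_algebra (path_space T))"
    unfolding W_def by (simp add: space_prob_algebra M.prob_space_distr)
  have "AE x in \<mu>. distr (k x) (path_space T) (driving_noise T U) = W"
  proof (rule kernels_AE_eq[OF retract_path_space[OF T]])
    show "finite_measure \<mu>" using p\<mu> by (simp add: prob_space_def)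
    show "(\<lambda>x. distr (k x) (path_space T) (driving_noise T U)) \<in> \<mu> \<rightarrow>\<^sub>M prob_algebra (path_space T)"
      using measurable_compose[OF k1 measurable_distr_prob_space[OF N]] by (simp cong: measurable_cong_sets add: s\<mu>)
    show "(\<lambda>x. W) \<in> \<mu> \<rightarrow>\<^sub>M prob_algebra (path_space T)" using W by simp
    fix A :: "(real \<Rightarrow> 'a) set" and C assume A[measurable]: "A \<in> sets (path_space T)" and C: "C \<in> sets \<mu>"
    have C'[measurable]: "C \<in> sets borel" using C by (simp add: s\<mu>)
    have AN: "driving_noise T U -` A \<inter> space (path_space T) \<in> sets P" unfolding sP by measurable
    have "(\<integral>\<^sup>+x. emeasure (distr (k x) (path_space T) (driving_noise T U)) A * indicator C x \<partial>\<mu>)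
      = (\<integral>\<^sup>+x. emeasure (k x) (driving_noise T U -` A \<inter> space (path_space T)) * indicator C x \<partial>\<mu>)"
      using N kp by (intro nn_integral_cong) (simp add: emeasure_distr spk cong: measurable_cong_sets)
    also have "\<dots> = emeasure P {w\<in>space P. w \<in> driving_noise T U -` A \<inter> space (path_space T) \<and> w (-T) \<in> C}"
      using disintegrationD[OF k AN C'] unfolding \<mu> by (rule sym)
    also have "\<dots> = emeasure M (X -` {w\<in>space P. w \<in> driving_noise T U -` A \<inter> space (path_space T) \<and> w (-T) \<in> C} \<inter> space M)"
    proof -
      have "{w\<in>space P. w \<in> driving_noise T U -` A \<inter> space (path_space T) \<and> w (-T) \<in> C} \<in> sets (path_space T)"
        unfolding spP by measurable
      then show ?thesis unfolding PM by (subst emeasure_distr[OF X]) auto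
    qed
    also have "\<dots> = emeasure M (((\<lambda>w. X w (-T)) -` C \<inter> space M) \<inter> (B -` A \<inter> space M))"
    proof (rule emeasure_eq_AE)
      show "AE w in M. (w \<in> X -` {w\<in>space P. w \<in> driving_noise T U -` A \<inter> space (path_space T) \<and> w (-T) \<in> C} \<inter> space M)
          = (w \<in> ((\<lambda>w. X w (-T)) -` C \<inter> space M) \<inter> (B -` A \<inter> space M))"
        using langevin_solution_noise[OF T U sol] AE_space
        by eventually_elim (use measurable_space[OF X] in \<open>auto simp: spP\<close>)
    qed (unfold spP, measurable)
    \<comment> \<open>Independence of start and noise factorizes the probability; this makes the
      conditional law of the noise constant in \<open>x\<close>.\<close>
    also have "\<dots> = emeasure M ((\<lambda>w. X w (-T)) -` C \<inter> space M) * emeasure M (B -` A \<inter> space M)"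
    proof -
      have "M.prob (((\<lambda>w. X w (-T)) -` C \<inter> space M) \<inter> (B -` A \<inter> space M)) = M.prob ((\<lambda>w. X w (-T)) -` C \<inter> space M) * M.prob (B -` A \<inter> space M)"
        using A C' by (intro M.indep_setD[OF ind]) auto
      then show ?thesis by (simp add: M.emeasure_eq_measure ennreal_mult)
    qed
    also have "\<dots> = emeasure \<mu> C * emeasure W A"
      unfolding init[symmetric] W_def by (simp add: emeasure_distr)
    also have "\<dots> = (\<integral>\<^sup>+x. emeasure W A * indicator C x \<partial>\<mu>)"
      by (subst nn_integral_cmult_indicator[OF C]) (rule mult.commute)
    finally show "(\<integral>\<^sup>+x. emeasure (distr (k x) (path_space T) (driving_noise T U)) A * indicator C x \<partial>\<mu>)
      = (\<integral>\<^sup>+x. emeasure W A * indicator C x \<partial>\<mu>)" .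
  qed
  moreover have "AE x in \<mu>. AE \<omega> in k x. \<omega> (-T) = x"
  proof -
    have pr: "Measurable.pred (borel \<Otimes>\<^sub>M P) (\<lambda>p. snd p (-T) = fst p)" by measurable
    show ?thesis using disintegration_AE[OF pP mTP k pr] unfolding \<mu> by simp
  qed
  ultimately have "AE x in \<mu>. is_langevin_law T U (return borel x) (k x)"
  proof eventually_elim
    case (elim x)
    note sk[measurable_cong] = kp(2)[of x]
    interpret K: prob_space "k x" by (rule kp)
    have Nk: "driving_noise T U \<in> k x \<rightarrow>\<^sub>M path_space T" by measurable
    have "langevin_solution (k x) T U (return borel x) (driving_noise T U) (\<lambda>\<omega>. \<omega>)"
      unfolding langevin_solution_def
    proof (intro conjI)
      show "brownian_motion (k x) T (driving_noise T U)"
        by (rule brownian_motion_transfer[OF T BM kp(1) Nk]) (simp add: elim(1) W_def)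
      show "(\<lambda>\<omega>. \<omega>) \<in> k x \<rightarrow>\<^sub>M path_space T" by measurable
      show "distr (k x) borel (\<lambda>\<omega>. \<omega> (-T)) = return borel x"
      proof (rule measure_eqI)
        fix A assume "A \<in> sets (distr (k x) borel (\<lambda>\<omega>. \<omega> (-T)))"
        then have A[measurable]: "A \<in> sets borel" by simp
        have "AE y in distr (k x) borel (\<lambda>\<omega>. \<omega> (-T)). y = x"
          using elim(2) by (subst AE_distr_iff) auto
        moreover have "prob_space (distr (k x) borel (\<lambda>\<omega>. \<omega> (-T)))" by (rule K.prob_space_distr) measurable
        ultimately show "emeasure (distr (k x) borel (\<lambda>\<omega>. \<omega> (-T))) A = emeasure (return borel x) A"
          using emeasure_AE_eq_const A by force
      qed simp
      show "K.indep_set {(\<lambda>\<omega>. \<omega> (-T)) -` A \<inter> space (k x) | A. A \<in> sets borel} {driving_noise T U -` A \<inter> space (k x) | A. A \<in> sets (path_space T)}"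
      proof (rule K.indep_setI)
        show "{(\<lambda>\<omega>. \<omega> (-T)) -` A \<inter> space (k x) | A. A \<in> sets borel} \<subseteq> K.events"
          "{driving_noise T U -` A \<inter> space (k x) | A. A \<in> sets (path_space T)} \<subseteq> K.events" by auto
        fix a b assume "a \<in> {(\<lambda>\<omega>. \<omega> (-T)) -` A \<inter> space (k x) | A. A \<in> sets borel}"
          and "b \<in> {driving_noise T U -` A \<inter> space (k x) | A. A \<in> sets (path_space T)}"
        then obtain A where a: "a = (\<lambda>\<omega>. \<omega> (-T)) -` A \<inter> space (k x)" and A[measurable]: "A \<in> sets borel" and b[measurable]: "b \<in> K.events"
          by auto
        have a'[measurable]: "a \<in> K.events" unfolding a by measurable
        show "K.prob (a \<inter> b) = K.prob a * K.prob b"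
        \<comment> \<open>Under \<open>k x\<close> the start is almost surely \<open>x\<close>, so
          its events have probability 0 or 1 and are independent of every event.\<close>
        proof (cases "x \<in> A")
          case True
          have "AE \<omega> in k x. \<omega> \<in> a" using elim(2) AE_space by eventually_elim (auto simp: a True)
          then have "K.prob a = 1" "K.prob (a \<inter> b) = K.prob b"
            by (auto simp: K.prob_eq_1 intro!: K.finite_measure_eq_AE elim: AE_mp)
          then show ?thesis by simp
        next
          case False
          have ae: "AE \<omega> in k x. \<omega> \<notin> a" using elim(2) AE_space by eventually_elim (auto simp: a False)
          then have "K.prob a = 0" by (simp add: K.prob_eq_0)
          moreover have "K.prob (a \<inter> b) = 0" using ae by (subst K.prob_eq_0) (auto elim: AE_mp)
          ultimately show ?thesis by simp
        qed
      qed
      show "AE w in k x. \<forall>t\<in>{-T..T}. w t = w (-T) - integral {-T..t} (\<lambda>s. grad (U s) (w s)) + driving_noise T U w t"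
        by (rule AE_I2) (simp add: driving_noise_def)
    qed
    moreover have "k x = distr (k x) (path_space T) (\<lambda>\<omega>. \<omega>)"
      using distr_cong[of "k x" "k x" "path_space T" "k x" "\<lambda>\<omega>. \<omega>" "\<lambda>\<omega>. \<omega>"] sk by (simp add: distr_id)
    ultimately show ?case unfolding is_langevin_law_def by blast
  qed
  then have "AE x in \<mu>. langevin_from T U x = k x"
  proof eventually_elim
    case (elim x)
    show ?case unfolding langevin_from_def
      by (rule the_equality, rule elim, rule is_langevin_law_unique[OF T U _ elim])
  qed
  then show ?thesis using that[OF k] unfolding \<mu> by blast
qed

text \<open>Fubini's theorem for null sets, read from the kernels to the joint law; it brings
  statements proved for almost every start and then almost every end point back to
  \<open>P\<close>.\<close>

lemma disintegration_AE_converse: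
  assumes P: "prob_space P" and f[measurable]: "f \<in> P \<rightarrow>\<^sub>M S" and k: "disintegration P f S k"
    and E[measurable]: "Measurable.pred (S \<Otimes>\<^sub>M P) E" and AE: "AE s in distr P S f. AE w in k s. E (s, w)"
  shows "AE w in P. E (f w, w)"
proof -
  have "(\<integral>\<^sup>+w. indicator {z\<in>space (S \<Otimes>\<^sub>M P). \<not> E z} (f w, w) \<partial>P)
    = (\<integral>\<^sup>+s. \<integral>\<^sup>+w. indicator {z\<in>space (S \<Otimes>\<^sub>M P). \<not> E z} (s, w) \<partial>k s \<partial>distr P S f)"
    by (rule disintegration_nn_integral[OF P f k]) measurable
  also have "\<dots> = (\<integral>\<^sup>+s. 0 \<partial>distr P S f)"
  proof (intro nn_integral_cong_AE, use AE in eventually_elim)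
    case (elim s)
    then have "(\<integral>\<^sup>+w. indicator {z\<in>space (S \<Otimes>\<^sub>M P). \<not> E z} (s, w) \<partial>k s) = (\<integral>\<^sup>+w. 0 \<partial>k s)"
      by (intro nn_integral_cong_AE) (auto elim!: AE_mp)
    then show ?case by simp
  qed
  also have "\<dots> = 0" by simp
  finally have "AE w in P. (indicator {z\<in>space (S \<Otimes>\<^sub>M P). \<not> E z} (f w, w) :: ennreal) = 0"
    by (subst (asm) nn_integral_0_iff_AE) auto
  then show ?thesis using AE_space
    by eventually_elim (use measurable_space[OF f] in \<open>auto simp: indicator_def space_pair_measure split: if_splits\<close>)
qed

section \<open>Bridges\<close>

text \<open>The masses involved are left-continuous in the radius, which carries the estimates from
  rational to all radii at the price of a non-strict inequality. Division by the mass of the ball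
  event turns them into convergence of conditional probabilities on \<open>\<A>\<close>, hence into
  weak convergence. The whole space is listed along with \<open>\<A>\<close> to obtain positive
  masses.\<close>

lemma bridge_eq_if_differentiates:
  fixes K R0 :: "(real \<Rightarrow> 'a::euclidean_space) measure"
  assumes T: "0 < T" and \<A>: "convergence_determining T \<A>"
    and K: "K \<in> space (prob_algebra (path_space T))" and KU: "langevin_from T U x = K"
    and R0: "R0 \<in> space (prob_algebra (path_space T))"
    and diff: "\<forall>A\<in>insert (space (path_space T)) \<A>. \<forall>k::nat. \<exists>n::nat. \<forall>r\<in>\<rat>. 0 < r \<and> r < 1/Suc n \<longrightarrow>
      \<bar>measure K {\<omega>\<in>A. \<omega> T \<in> ball y r} - measure R0 A * measure K {\<omega>\<in>space (path_space T). \<omega> T \<in> ball y r}\<bar>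
        < measure K {\<omega>\<in>space (path_space T). \<omega> T \<in> ball y r} / Suc k"
  shows "bridge T U x y = R0"
proof (rule bridge_eqI[OF R0])
  have sK[measurable_cong]: "sets K = sets (path_space T)" and "prob_space K" using K by (auto simp: space_prob_algebra)
  interpret K: prob_space K by fact
  have mT[measurable]: "(\<lambda>\<omega>. \<omega> T) \<in> path_space T \<rightarrow>\<^sub>M (borel :: 'a measure)" using T by (intro measurable_path_eval) auto
  define S where "S r = {\<omega> \<in> space (path_space T). dist (\<omega> T) y < r}" for r
  have S_ball: "S r = {\<omega>\<in>space (path_space T). \<omega> T \<in> ball y r}" for r by (auto simp: S_def dist_commute)
  have Sm[measurable]: "S r \<in> sets (path_space T)" for r unfolding S_def by measurable
  have S_mono: "S r \<subseteq> S r'" if "r \<le> r'" for r r' using that by (auto simp: S_def)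
  have A_sets: "A \<in> sets (path_space T)" if "A \<in> \<A>" for A using that \<A> by (auto simp: convergence_determining_def)
  have A_ball: "{\<omega>\<in>A. \<omega> T \<in> ball y r} = A \<inter> S r" if "A \<in> sets (path_space T)" for A r
    using sets.sets_into_space[OF that] by (auto simp: S_ball)
  have pos: "0 < measure K (S r)" if "0 < r" for r
  proof -
    obtain n :: nat where n: "\<And>r. r \<in> \<rat> \<Longrightarrow> 0 < r \<Longrightarrow> r < 1/Suc n \<Longrightarrow>
      \<bar>measure K {\<omega>\<in>space (path_space T). \<omega> T \<in> ball y r} - measure R0 (space (path_space T)) * measure K {\<omega>\<in>space (path_space T). \<omega> T \<in> ball y r}\<bar>
        < measure K {\<omega>\<in>space (path_space T). \<omega> T \<in> ball y r} / Suc 0" using diff by blast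
    have "0 < min r (1/Suc n)" using that by simp
    then obtain q where q: "q \<in> \<rat>" "0 < q" "q < min r (1/Suc n)" using Rats_dense_in_real by blast
    \<comment> \<open>The left side of the estimate is nonnegative, so its strictness forces the
      mass on the right to be positive.\<close>
    have "0 < measure K (S q)" using n[of q] q unfolding S_ball by simp
    also have "\<dots> \<le> measure K (S r)" using q by (intro K.finite_measure_mono S_mono) (auto simp: sK)
    finally show ?thesis .
  qed
  have leftlim: "(\<lambda>j. measure K (A \<inter> S (r - e j))) \<longlonglongrightarrow> measure K (A \<inter> S r)"
    if A: "A \<in> sets (path_space T)" and e: "decseq e" "e \<longlonglongrightarrow> 0" "\<And>j. 0 < e j" for A r and e :: "nat \<Rightarrow> real"
  proof -
    have "(\<lambda>j. measure K (A \<inter> S (r - e j))) \<longlonglongrightarrow> measure K (\<Union>j. A \<inter> S (r - e j))"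
    proof (rule K.finite_Lim_measure_incseq)
      show "range (\<lambda>j. A \<inter> S (r - e j)) \<subseteq> K.events" using A by (auto simp: sK)
      show "incseq (\<lambda>j. A \<inter> S (r - e j))"
        using e(1) by (intro incseq_SucI Int_mono S_mono) (auto dest: decseq_SucD)
    qed
    also have "(\<Union>j. A \<inter> S (r - e j)) = A \<inter> S r"
    proof (intro equalityI subsetI)
      fix \<omega> assume \<omega>: "\<omega> \<in> A \<inter> S r"
      then have "0 < r - dist (\<omega> T) y" by (simp add: S_def)
      then have "\<forall>\<^sub>F j in sequentially. e j < r - dist (\<omega> T) y" by (rule order_tendstoD(2)[OF e(2)])
      then obtain j where "e j < r - dist (\<omega> T) y" by (auto simp: eventually_sequentially)
      then show "\<omega> \<in> (\<Union>j. A \<inter> S (r - e j))" using \<omega> by (auto simp: S_def intro!: exI[of _ j])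
    next
      fix \<omega> assume "\<omega> \<in> (\<Union>j. A \<inter> S (r - e j))"
      then obtain j where "\<omega> \<in> A" "\<omega> \<in> S (r - e j)" by auto
      then show "\<omega> \<in> A \<inter> S r" using S_mono[of "r - e j" r] e(3)[of j] by auto
    qed
    finally show ?thesis .
  qed
  have rat_approx: "\<exists>e. decseq e \<and> e \<longlonglongrightarrow> 0 \<and> (\<forall>j::nat. 0 < e j \<and> r - e j \<in> \<rat> \<and> 0 < r - e j)" if "0 < r" for r :: real
  proof -
    \<comment> \<open>Consecutive windows are disjoint and increase to \<open>r\<close>, so
      rationals chosen from them are increasing; the first window starts at \<open>r / 2\<close>,
      which keeps the radii positive.\<close>
    have "\<exists>q\<in>\<rat>. r - r / (Suc j + 1) < q \<and> q < r - r / (Suc (Suc j) + 1)" for j :: nat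
      using that by (intro Rats_dense_in_real) (simp add: divide_strict_left_mono)
    then obtain q where q: "\<And>j. q j \<in> \<rat>" "\<And>j. r - r / (Suc j + 1) < q j" "\<And>j. q j < r - r / (Suc (Suc j) + 1)" by metis
    have "decseq (\<lambda>j. r - q j)"
    proof (rule decseq_SucI)
      show "r - q (Suc n) \<le> r - q n" for n using q(2)[of "Suc n"] q(3)[of n] by linarith
    qed
    moreover have "(\<lambda>j. r - q j) \<longlonglongrightarrow> 0"
    proof (rule tendsto_sandwich[of "\<lambda>_. 0" _ _ "\<lambda>j. r / (Suc j + 1)"])
      show "(\<lambda>j. r / real (Suc j + 1)) \<longlonglongrightarrow> 0"
        using LIMSEQ_ignore_initial_segment[OF lim_const_over_n[of r], of 2] by simp
    next
      have "0 < r / (Suc (Suc j) + 1)" for j using that by simp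
      then have "q j < r" for j using q(3)[of j] by (smt (verit))
      then show "\<forall>\<^sub>F j in sequentially. 0 \<le> r - q j" by (auto intro!: always_eventually less_imp_le)
      show "\<forall>\<^sub>F j in sequentially. r - q j \<le> r / (Suc j + 1)"
        using q(2) by (auto intro!: always_eventually simp: less_imp_le algebra_simps)
    qed auto
    moreover have "0 < r - q j \<and> r - (r - q j) \<in> \<rat> \<and> 0 < r - (r - q j)" for j
    proof -
      have "0 < r / (Suc (Suc j) + 1)" "r / (Suc j + 1) \<le> r" using that by (auto simp: divide_le_eq mult_left_le)
      then show ?thesis using q(1)[of j] q(2)[of j] q(3)[of j] by auto
    qed
    ultimately show ?thesis by (intro exI[of _ "\<lambda>j. r - q j"]) auto
  qed
  have prob: "uniform_measure K (S r) \<in> space (prob_algebra (path_space T))" if "0 < r" for r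
    using pos[OF that] by (auto simp: space_prob_algebra sK K.emeasure_eq_measure intro!: prob_space_uniform_measure)
  have um: "measure (uniform_measure K (S r)) A = measure K (A \<inter> S r) / measure K (S r)"
    if "0 < r" "A \<in> sets (path_space T)" for r A
    using pos[OF that(1)] that(2) by (subst measure_uniform_measure) (auto simp: K.emeasure_eq_measure Int_commute sK)
  have "weakly_converges T (\<lambda>\<epsilon>. uniform_measure K (S \<epsilon>)) R0 (at_right 0)"
  proof (rule weakly_converges_if_converges_on[OF \<A> R0])
    show "\<forall>\<^sub>F \<epsilon> in at_right 0. uniform_measure K (S \<epsilon>) \<in> space (prob_algebra (path_space T))"
      using prob by (auto simp: eventually_at_right_field intro!: exI[of _ 1])
    fix A assume A: "A \<in> \<A>"
    note As = A_sets[OF A]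
    show "((\<lambda>\<epsilon>. measure (uniform_measure K (S \<epsilon>)) A) \<longlongrightarrow> measure R0 A) (at_right 0)"
    proof (rule tendstoI)
      fix \<delta> :: real assume "0 < \<delta>"
      then obtain k :: nat where k: "1 / Suc k < \<delta>" using nat_approx_posE by blast
      note d = bspec[OF diff insertI2[OF A], unfolded A_ball[OF As] S_ball[symmetric]]
      obtain n :: nat where n: "\<forall>r\<in>\<rat>. 0 < r \<and> r < 1/Suc n \<longrightarrow>
        \<bar>measure K (A \<inter> S r) - measure R0 A * measure K (S r)\<bar> < measure K (S r) / Suc k"
        using spec[OF d, of k] by (elim exE)
      have "dist (measure (uniform_measure K (S r)) A) (measure R0 A) < \<delta>" if r: "0 < r" "r < 1 / Suc n" for r
      proof -
        obtain e where e: "decseq e" "e \<longlonglongrightarrow> 0" "\<And>j::nat. 0 < e j" "\<And>j. r - e j \<in> \<rat>" "\<And>j. 0 < r - e j"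
          using rat_approx[OF r(1)] by blast
        have l1: "(\<lambda>j. measure K (A \<inter> S (r - e j))) \<longlonglongrightarrow> measure K (A \<inter> S r)" by (rule leftlim[OF As e(1,2,3)])
        have "(\<lambda>j. measure K (space (path_space T) \<inter> S (r - e j))) \<longlonglongrightarrow> measure K (space (path_space T) \<inter> S r)"
          by (rule leftlim[OF _ e(1,2,3)]) auto
        moreover have "space (path_space T) \<inter> S r = S r" for r by (auto simp: S_def)
        ultimately have l2: "(\<lambda>j. measure K (S (r - e j))) \<longlonglongrightarrow> measure K (S r)" by simp
        have "\<bar>measure K (A \<inter> S r) - measure R0 A * measure K (S r)\<bar> \<le> measure K (S r) / Suc k"
        proof (rule LIMSEQ_le)
          show "(\<lambda>j. \<bar>measure K (A \<inter> S (r - e j)) - measure R0 A * measure K (S (r - e j))\<bar>) \<longlonglongrightarrow> \<bar>measure K (A \<inter> S r) - measure R0 A * measure K (S r)\<bar>"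
            by (intro tendsto_intros l1 l2)
          show "(\<lambda>j. measure K (S (r - e j)) / Suc k) \<longlonglongrightarrow> measure K (S r) / Suc k"
            by (intro tendsto_intros l2) auto
          have "\<bar>measure K (A \<inter> S (r - e j)) - measure R0 A * measure K (S (r - e j))\<bar> \<le> measure K (S (r - e j)) / Suc k" for j
            using e(3)[of j] r by (intro less_imp_le bspec[OF n, rule_format] e(4) conjI e(5)) linarith
          then show "\<exists>N. \<forall>j\<ge>N. \<bar>measure K (A \<inter> S (r - e j)) - measure R0 A * measure K (S (r - e j))\<bar> \<le> measure K (S (r - e j)) / Suc k" by blast
        qed
        moreover have "measure K (A \<inter> S r) - measure R0 A * measure K (S r) = (measure K (A \<inter> S r) / measure K (S r) - measure R0 A) * measure K (S r)"
          using pos[OF r(1)] by (simp add: field_simps)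
        ultimately have "\<bar>measure K (A \<inter> S r) / measure K (S r) - measure R0 A\<bar> * measure K (S r) \<le> 1 / Suc k * measure K (S r)"
          using pos[OF r(1)] by (simp add: abs_mult)
        then have "\<bar>measure K (A \<inter> S r) / measure K (S r) - measure R0 A\<bar> \<le> 1 / Suc k"
          using pos[OF r(1)] by (rule mult_right_le_imp_le)
        then show ?thesis using k by (simp add: um[OF r(1) As] dist_real_def)
      qed
      then show "\<forall>\<^sub>F \<epsilon> in at_right 0. dist (measure (uniform_measure K (S \<epsilon>)) A) (measure R0 A) < \<delta>"
        by (auto simp: eventually_at_right_field intro!: exI[of _ "1 / Suc n"])
    qed
  qed
  then show "weakly_converges T (\<lambda>\<epsilon>. uniform_measure (langevin_from T U x) {\<omega> \<in> space (path_space T). dist (\<omega> T) y < \<epsilon>}) R0 (at_right 0)"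
    unfolding KU S_def .
qed

text \<open>Conditioning on the start and then on the end agrees with conditioning on both:
  \<open>K2 x = k x\<close> for almost every \<open>x\<close>. Hence, for an event \<open>A\<close>,
  the mass of \<open>A\<close> under \<open>\<kappa> (x, y)\<close> is as a function of
  \<open>y\<close> the density, with respect to the end point law \<open>m x\<close>, of the law of
  \<open>\<omega> T\<close> under \<open>k x\<close> restricted to \<open>A\<close>; differentiation
  along small balls recovers it.\<close>

theorem AE_bridge_eq_disintegration:
  fixes P :: "(real \<Rightarrow> 'a::euclidean_space) measure"
  assumes T: "0 < T" and U: "admissible_potential T U" and P: "is_langevin_law T U \<mu> P"
    and \<kappa>: "disintegration P (\<lambda>\<omega>. (\<omega> (-T), \<omega> T)) borel \<kappa>"
  shows "AE z in distr P borel (\<lambda>\<omega>. (\<omega> (-T), \<omega> T)). bridge T U (fst z) (snd z) = \<kappa> z"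
proof -
  define e where "e \<omega> = (\<omega> (-T), \<omega> T)" for \<omega> :: "real \<Rightarrow> 'a"
  note \<kappa>' = \<kappa>[folded e_def]
  obtain k where k: "disintegration P (\<lambda>\<omega>. \<omega> (-T)) borel k"
    and kU: "AE x in distr P borel (\<lambda>\<omega>. \<omega> (-T)). langevin_from T U x = k x"
    using langevin_disintegration[OF T U P] by blast
  have mi[measurable]: "(\<lambda>\<omega>. \<omega> (-T)) \<in> path_space T \<rightarrow>\<^sub>M (borel :: 'a measure)"
    and mT[measurable]: "(\<lambda>\<omega>. \<omega> T) \<in> path_space T \<rightarrow>\<^sub>M (borel :: 'a measure)"
    using T by (auto intro!: measurable_path_eval)
  have e[measurable]: "e \<in> path_space T \<rightarrow>\<^sub>M (borel :: ('a \<times> 'a) measure)"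
    unfolding e_def[abs_def] borel_prod[symmetric] by measurable
  have "P \<in> space (prob_algebra (path_space T))"
    using P langevin_solution_law_in_space unfolding is_langevin_law_def by blast
  then have sP[measurable_cong]: "sets P = sets (path_space T)" and pP: "prob_space P" by (auto simp: space_prob_algebra)
  interpret P: prob_space P by fact
  have miP: "(\<lambda>\<omega>. \<omega> (-T)) \<in> P \<rightarrow>\<^sub>M (borel :: 'a measure)" and eP: "e \<in> P \<rightarrow>\<^sub>M borel" by measurable
  have k1[measurable]: "k \<in> borel \<rightarrow>\<^sub>M prob_algebra (path_space T)" using k prob_algebra_cong[OF sP] by (simp add: disintegration_def)
  have \<kappa>1[measurable]: "\<kappa> \<in> borel \<rightarrow>\<^sub>M prob_algebra (path_space T)" using \<kappa> prob_algebra_cong[OF sP] by (simp add: disintegration_def)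
  have \<kappa>2[measurable]: "\<kappa> \<in> borel \<Otimes>\<^sub>M borel \<rightarrow>\<^sub>M prob_algebra (path_space T)" unfolding borel_prod by (rule \<kappa>1)
  have kp: "prob_space (k x)" "sets (k x) = sets (path_space T)" for x
    using measurable_space[OF k1, of x] by (auto simp: space_prob_algebra)
  have \<kappa>p: "prob_space (\<kappa> z)" "sets (\<kappa> z) = sets (path_space T)" for z
    using measurable_space[OF \<kappa>1, of z] by (auto simp: space_prob_algebra)
  have spk: "space (k x) = space (path_space T)" "space (\<kappa> z) = space (path_space T)" for x z
    using kp(2)[of x] \<kappa>p(2)[of z] by (auto dest: sets_eq_imp_space_eq)
  define m where "m x = distr (k x) borel (\<lambda>\<omega>. \<omega> T)" for x
  have m1[measurable]: "m \<in> borel \<rightarrow>\<^sub>M prob_algebra borel"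
    unfolding m_def[abs_def] by (rule measurable_compose[OF k1 measurable_distr_prob_space[OF mT]])
  have mTk: "(\<lambda>\<omega>. \<omega> T) \<in> k x \<rightarrow>\<^sub>M (borel :: 'a measure)" for x using mT by (simp cong: measurable_cong_sets add: kp)
  have mp: "prob_space (m x)" and sm: "sets (m x) = sets borel" for x
    unfolding m_def using prob_space.prob_space_distr[OF kp(1) mTk] by auto
  have spm: "space (m x) = UNIV" for x unfolding m_def by simp
  define K2 where "K2 x = m x \<bind> (\<lambda>y. \<kappa> (x, y))" for x
  have \<kappa>x: "(\<lambda>y. \<kappa> (x, y)) \<in> m x \<rightarrow>\<^sub>M prob_algebra (path_space T)" for x
  proof -
    have "(\<lambda>y. \<kappa> (x, y)) \<in> borel \<rightarrow>\<^sub>M prob_algebra (path_space T)"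
      by (rule measurable_compose[OF _ \<kappa>2]) measurable
    then show ?thesis by (simp cong: measurable_cong_sets add: sm)
  qed
  have K2: "K2 \<in> borel \<rightarrow>\<^sub>M prob_algebra (path_space T)"
    unfolding K2_def[abs_def] using \<kappa>2 by (intro measurable_bind_prob_space2[OF m1]) simp
  have eK2: "emeasure (K2 x) A = (\<integral>\<^sup>+y. emeasure (\<kappa> (x, y)) A \<partial>m x)" if "A \<in> sets (path_space T)" for x A
    unfolding K2_def by (rule emeasure_bind[OF _ measurable_prob_algebraD[OF \<kappa>x] that]) (simp add: spm)
  have meas\<kappa>: "(\<lambda>z. emeasure (\<kappa> z) A) \<in> borel_measurable borel" if "A \<in> sets (path_space T)" for A
    using measurable_emeasure_kernel[OF measurable_prob_algebraD[OF \<kappa>1] that] .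
  have "AE x in distr P borel (\<lambda>\<omega>. \<omega> (-T)). K2 x = k x"
  proof (rule kernels_AE_eq[OF retract_path_space[OF T]])
    show "finite_measure (distr P borel (\<lambda>\<omega>. \<omega> (-T)))" using P.prob_space_distr[OF miP] by (simp add: prob_space_def)
    show "K2 \<in> distr P borel (\<lambda>\<omega>. \<omega> (-T)) \<rightarrow>\<^sub>M prob_algebra (path_space T)"
      "k \<in> distr P borel (\<lambda>\<omega>. \<omega> (-T)) \<rightarrow>\<^sub>M prob_algebra (path_space T)"
      using K2 k1 by (simp_all cong: measurable_cong_sets)
    fix A :: "(real \<Rightarrow> 'a) set" and C assume A[measurable]: "A \<in> sets (path_space T)" and "C \<in> sets (distr P borel (\<lambda>\<omega>. \<omega> (-T)))"
    then have C[measurable]: "C \<in> sets borel" by simp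
    note [measurable] = meas\<kappa>[OF A]
    define h where "h p = emeasure (\<kappa> (fst p, snd p T)) A * indicator C (fst p)" for p :: "'a \<times> (real \<Rightarrow> 'a)"
    have "(\<lambda>p. (fst p, snd p T)) \<in> borel \<Otimes>\<^sub>M P \<rightarrow>\<^sub>M (borel :: ('a \<times> 'a) measure)"
      unfolding borel_prod[symmetric] by measurable
    from measurable_compose[OF this meas\<kappa>[OF A]]
    have h[measurable]: "h \<in> borel_measurable (borel \<Otimes>\<^sub>M P)" unfolding h_def by measurable
    have "(\<integral>\<^sup>+x. emeasure (K2 x) A * indicator C x \<partial>distr P borel (\<lambda>\<omega>. \<omega> (-T)))
        = (\<integral>\<^sup>+x. \<integral>\<^sup>+\<omega>. h (x, \<omega>) \<partial>k x \<partial>distr P borel (\<lambda>\<omega>. \<omega> (-T)))"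
    proof (intro nn_integral_cong)
      fix x
      have [measurable]: "(\<lambda>y. emeasure (\<kappa> (x, y)) A) \<in> borel_measurable borel"
        by (rule measurable_compose[OF _ meas\<kappa>[OF A]]) (simp add: borel_prod[symmetric])
      have "emeasure (K2 x) A = (\<integral>\<^sup>+\<omega>. emeasure (\<kappa> (x, \<omega> T)) A \<partial>k x)"
        unfolding eK2[OF A] unfolding m_def by (subst nn_integral_distr[OF mTk]) auto
      then show "emeasure (K2 x) A * indicator C x = (\<integral>\<^sup>+\<omega>. h (x, \<omega>) \<partial>k x)"
        by (auto simp: h_def indicator_def)
    qed
    also have "\<dots> = (\<integral>\<^sup>+\<omega>. h (\<omega> (-T), \<omega>) \<partial>P)"
      by (rule disintegration_nn_integral[OF pP miP k h, symmetric])
    also have "\<dots> = (\<integral>\<^sup>+\<omega>. (\<lambda>z. emeasure (\<kappa> z) A * indicator (C \<times> UNIV) z) (e \<omega>) \<partial>P)"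
      by (intro nn_integral_cong) (auto simp: h_def e_def indicator_def)
    also have "\<dots> = (\<integral>\<^sup>+z. emeasure (\<kappa> z) A * indicator (C \<times> UNIV) z \<partial>distr P borel e)"
    proof -
      have "C \<times> UNIV \<in> sets (borel :: ('a \<times> 'a) measure)" unfolding borel_prod[symmetric] by measurable
      then have "(\<lambda>z. emeasure (\<kappa> z) A * indicator (C \<times> UNIV) z) \<in> borel_measurable borel"
        by (intro borel_measurable_times_ennreal meas\<kappa>[OF A] borel_measurable_indicator)
      then show ?thesis by (subst nn_integral_distr[OF eP]) simp_all
    qed
    also have "\<dots> = emeasure P {w\<in>space P. w \<in> A \<and> e w \<in> C \<times> UNIV}"
    proof (rule disintegrationD[OF \<kappa>', symmetric])
      show "A \<in> sets P" by (simp add: sP)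
      show "C \<times> UNIV \<in> sets (borel :: ('a \<times> 'a) measure)" unfolding borel_prod[symmetric] by measurable
    qed
    also have "\<dots> = emeasure P {w\<in>space P. w \<in> A \<and> w (-T) \<in> C}" by (simp add: e_def)
    also have "\<dots> = (\<integral>\<^sup>+x. emeasure (k x) A * indicator C x \<partial>distr P borel (\<lambda>\<omega>. \<omega> (-T)))"
      by (rule disintegrationD[OF k]) (simp_all add: sP)
    finally show "(\<integral>\<^sup>+x. emeasure (K2 x) A * indicator C x \<partial>distr P borel (\<lambda>\<omega>. \<omega> (-T)))
      = (\<integral>\<^sup>+x. emeasure (k x) A * indicator C x \<partial>distr P borel (\<lambda>\<omega>. \<omega> (-T)))" .
  qed
  moreover
  \<comment> \<open>Concentration of \<open>\<kappa> z\<close> on paths that end at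
    \<open>snd z\<close>, put as a null measure so that it is measurable in \<open>z\<close> and can
    be moved from the joint end point law to \<open>m x\<close> for almost every
    \<open>x\<close>.\<close>
  define Q where "Q z \<longleftrightarrow> emeasure (\<kappa> z) {\<omega>\<in>space (path_space T). \<not> (\<omega> T = snd z)} = 0" for z
  have Q[measurable]: "Measurable.pred borel Q"
  proof -
    have "(SIGMA z:space borel. {\<omega>\<in>space (path_space T). \<not> (\<omega> T = snd z)}) = {p\<in>space (borel \<Otimes>\<^sub>M path_space T). \<not> (snd p T = snd (fst p :: 'a \<times> 'a))}"
      by (auto simp: space_pair_measure)
    also have "\<dots> \<in> sets (borel \<Otimes>\<^sub>M path_space T)"
    proof -
      have [measurable]: "(\<lambda>p. snd (fst p)) \<in> (borel :: ('a \<times> 'a) measure) \<Otimes>\<^sub>M path_space T \<rightarrow>\<^sub>M (borel :: 'a measure)"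
        unfolding borel_prod[symmetric] by measurable
      have [measurable]: "(\<lambda>p. snd p T) \<in> (borel :: ('a \<times> 'a) measure) \<Otimes>\<^sub>M path_space T \<rightarrow>\<^sub>M (borel :: 'a measure)"
        by (rule measurable_compose[OF measurable_snd mT])
      have "{p\<in>space ((borel :: ('a \<times> 'a) measure) \<Otimes>\<^sub>M path_space T). 0 < dist (snd p T) (snd (fst p))} \<in> sets (borel \<Otimes>\<^sub>M path_space T)"
        by measurable
      then show ?thesis by (simp only: zero_less_dist_iff)
    qed
    finally have "(\<lambda>z. emeasure (\<kappa> z) {\<omega>\<in>space (path_space T). \<not> (\<omega> T = snd z)}) \<in> borel_measurable borel"
      by (rule emeasure_measurable_subprob_algebra2[OF _ measurable_prob_algebraD[OF \<kappa>1]])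
    then show ?thesis unfolding Q_def by measurable
  qed
  have "AE x in distr P borel (\<lambda>\<omega>. \<omega> (-T)). AE y in m x. Q (x, y)"
  proof -
    have pr: "Measurable.pred (borel \<Otimes>\<^sub>M P) (\<lambda>p. e (snd p) = fst p)"
      by measurable
    have "AE z in distr P borel e. AE \<omega> in \<kappa> z. e \<omega> = z"
      using disintegration_AE[OF pP eP \<kappa>' pr] by simp
    then have "AE z in distr P borel e. Q z"
    proof eventually_elim
      case (elim z)
      then have "AE \<omega> in \<kappa> z. \<omega> T = snd z" by eventually_elim (auto simp: e_def)
      then show ?case unfolding Q_def
        by (subst (asm) AE_iff_measurable[where N="{\<omega>\<in>space (path_space T). \<not> (\<omega> T = snd z)}"]) (auto simp: spk \<kappa>p)
    qed
    then have "AE \<omega> in P. Q (e \<omega>)" by (subst (asm) AE_distr_iff[OF eP]) auto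
    then have "AE \<omega> in P. Q (fst (\<omega> (-T), \<omega>), snd (\<omega> (-T), \<omega>) T)" by (simp add: e_def)
    moreover have "Measurable.pred (borel \<Otimes>\<^sub>M P) (\<lambda>p. Q (fst p, snd p T))"
      by (rule measurable_compose[OF _ Q]) (unfold borel_prod[symmetric], measurable)
    ultimately have "AE x in distr P borel (\<lambda>\<omega>. \<omega> (-T)). AE \<omega> in k x. Q (fst (x, \<omega>), snd (x, \<omega>) T)"
      by (intro disintegration_AE[OF pP miP k])
    then show ?thesis
    proof eventually_elim
      case (elim x)
      have [measurable]: "Measurable.pred borel (\<lambda>y. Q (x, y))"
        by (rule measurable_compose[OF _ Q]) (simp add: borel_prod[symmetric])
      show ?case unfolding m_def using elim by (subst AE_distr_iff[OF mTk]) auto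
    qed
  qed
  moreover
  obtain \<A> :: "(real \<Rightarrow> 'a) set set" where \<A>: "convergence_determining T \<A>"
    using exists_convergence_determining[OF T] by blast
  define \<A>' where "\<A>' = insert (space (path_space T)) \<A>"
  have c\<A>': "countable \<A>'" and s\<A>': "\<And>A. A \<in> \<A>' \<Longrightarrow> A \<in> sets (path_space T)"
    using \<A> by (auto simp: \<A>'_def convergence_determining_def)
  \<comment> \<open>All differentiation estimates for the countable family \<open>\<A>'\<close> in
    one predicate. Its measurability permits the passage from \<open>m x\<close>-almost every
    \<open>y\<close>, for almost every \<open>x\<close>, to almost every pair.\<close>
  define G where "G z \<longleftrightarrow> (\<forall>A\<in>\<A>'. \<forall>j::nat. \<exists>n::nat. \<forall>r\<in>\<rat>. 0 < r \<and> r < 1/Suc n \<longrightarrow>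
      \<bar>measure (k (fst z)) {\<omega>\<in>A. \<omega> T \<in> ball (snd z) r} - measure (\<kappa> z) A * measure (k (fst z)) {\<omega>\<in>space (path_space T). \<omega> T \<in> ball (snd z) r}\<bar>
        < measure (k (fst z)) {\<omega>\<in>space (path_space T). \<omega> T \<in> ball (snd z) r} / Suc j)" for z
  have G[measurable]: "Measurable.pred borel G"
  proof -
    define gA where "gA A r z = measure (k (fst z)) {\<omega>\<in>A. \<omega> T \<in> ball (snd z) r}" for A r z
    have gA: "gA A r \<in> borel_measurable borel" if A[measurable]: "A \<in> sets (path_space T)" for A r
      unfolding gA_def[abs_def]
    proof (rule measure_measurable_prob_algebra2)
      have [measurable]: "(\<lambda>p. snd (fst p)) \<in> (borel :: ('a \<times> 'a) measure) \<Otimes>\<^sub>M path_space T \<rightarrow>\<^sub>M (borel :: 'a measure)"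
        unfolding borel_prod[symmetric] by measurable
      have [measurable]: "(\<lambda>p. snd p T) \<in> (borel :: ('a \<times> 'a) measure) \<Otimes>\<^sub>M path_space T \<rightarrow>\<^sub>M (borel :: 'a measure)"
        by (rule measurable_compose[OF measurable_snd mT])
      have "(SIGMA z:space borel. {\<omega>\<in>A. \<omega> T \<in> ball (snd z) r}) = {p\<in>space (borel \<Otimes>\<^sub>M path_space T). snd p \<in> A \<and> dist (snd (fst p :: 'a \<times> 'a)) (snd p T) < r}"
        using sets.sets_into_space[OF A] by (auto simp: space_pair_measure)
      also have "\<dots> \<in> sets (borel \<Otimes>\<^sub>M path_space T)" by measurable
      finally show "(SIGMA z:space borel. {\<omega>\<in>A. \<omega> T \<in> ball (snd z :: 'a) r}) \<in> sets ((borel :: ('a \<times> 'a) measure) \<Otimes>\<^sub>M path_space T)" .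
      show "(\<lambda>z. k (fst z)) \<in> (borel :: ('a \<times> 'a) measure) \<rightarrow>\<^sub>M prob_algebra (path_space T)"
        unfolding borel_prod[symmetric] by measurable
    qed
    have g\<kappa>: "(\<lambda>z. measure (\<kappa> z) A) \<in> borel_measurable borel" if "A \<in> sets (path_space T)" for A
      using meas\<kappa>[OF that] unfolding measure_def by measurable
    have "{z\<in>space borel. \<bar>gA A r z - measure (\<kappa> z) A * gA (space (path_space T)) r z\<bar> < gA (space (path_space T)) r z / real (Suc j)} \<in> sets borel"
      if "A \<in> \<A>'" for A r and j :: nat
      by (intro borel_measurable_less borel_measurable_abs borel_measurable_diff borel_measurable_times borel_measurable_divide
        borel_measurable_const gA[OF s\<A>'[OF that]] gA[OF sets.top] g\<kappa>[OF s\<A>'[OF that]])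
    then have "{z\<in>space borel. \<forall>A\<in>\<A>'. \<forall>j::nat. \<exists>n::nat. \<forall>r\<in>\<rat>. 0 < r \<and> r < 1/Suc n \<longrightarrow>
       \<bar>gA A r z - measure (\<kappa> z) A * gA (space (path_space T)) r z\<bar> < gA (space (path_space T)) r z / real (Suc j)} \<in> sets borel"
      by (intro sets.sets_Collect_countable_All'[OF _ c\<A>'] sets.sets_Collect_countable_All sets.sets_Collect_countable_Ex
        sets.sets_Collect_countable_All'[OF _ countable_rat] sets.sets_Collect_imp sets.sets_Collect_const)
    then show ?thesis unfolding G_def gA_def pred_def .
  qed
  have "AE x in distr P borel (\<lambda>\<omega>. \<omega> (-T)). AE y in m x. G (x, y)"
    if *: "AE x in distr P borel (\<lambda>\<omega>. \<omega> (-T)). K2 x = k x" "AE x in distr P borel (\<lambda>\<omega>. \<omega> (-T)). AE y in m x. Q (x, y)"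
    using *
  proof eventually_elim
    case (elim x)
    interpret kx: prob_space "k x" by (rule kp)
    interpret mx: prob_space "m x" by (rule mp)
    \<comment> \<open>Under \<open>\<kappa> (x, y)\<close> the path ends at \<open>y\<close>, so the
      restriction to \<open>\<omega> T \<in> C\<close> becomes the indicator of \<open>C\<close> at
      \<open>y\<close>. Only this turns the tower property into a statement about densities.\<close>
    have key: "measure (k x) {\<omega>\<in>A. \<omega> T \<in> C} = (LINT y:C|m x. measure (\<kappa> (x, y)) A)"
      if A[measurable]: "A \<in> sets (path_space T)" and C[measurable]: "C \<in> sets borel" for A C
    proof -
      have AC: "{\<omega>\<in>A. \<omega> T \<in> C} \<in> sets (path_space T)"
      proof -
        have "{\<omega>\<in>A. \<omega> T \<in> C} = A \<inter> {\<omega>\<in>space (path_space T). \<omega> T \<in> C}" using sets.sets_into_space[OF A] by auto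
        then show ?thesis by simp
      qed
      have [measurable]: "(\<lambda>y. emeasure (\<kappa> (x, y)) A) \<in> borel_measurable borel"
        by (rule measurable_compose[OF _ meas\<kappa>[OF A]]) (simp add: borel_prod[symmetric])
      have [measurable]: "(\<lambda>y. measure (\<kappa> (x, y)) A) \<in> borel_measurable (m x)"
        unfolding measure_def by (simp cong: measurable_cong_sets add: sm)
      have "emeasure (k x) {\<omega>\<in>A. \<omega> T \<in> C} = (\<integral>\<^sup>+y. emeasure (\<kappa> (x, y)) {\<omega>\<in>A. \<omega> T \<in> C} \<partial>m x)"
        using eK2[OF AC, of x] elim(1) by simp
      also have "\<dots> = (\<integral>\<^sup>+y. ennreal (indicator C y * measure (\<kappa> (x, y)) A) \<partial>m x)"
      proof (rule nn_integral_cong_AE, use elim(2) in eventually_elim)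
        case (elim y)
        interpret \<kappa>xy: prob_space "\<kappa> (x, y)" by (rule \<kappa>p)
        have "AE \<omega> in \<kappa> (x, y). \<omega> T = y"
          using elim unfolding Q_def
          by (subst AE_iff_measurable[where N="{\<omega>\<in>space (path_space T). \<not> (\<omega> T = snd (x, y))}"]) (auto simp: spk \<kappa>p)
        then have "emeasure (\<kappa> (x, y)) {\<omega>\<in>A. \<omega> T \<in> C} = emeasure (\<kappa> (x, y)) (if y \<in> C then A else {})"
          by (intro emeasure_eq_AE) (auto simp: \<kappa>p AC elim!: AE_mp)
        then show ?case by (auto simp: \<kappa>xy.emeasure_eq_measure indicator_def)
      qed
      finally have "ennreal (measure (k x) {\<omega>\<in>A. \<omega> T \<in> C}) = (\<integral>\<^sup>+y. ennreal (indicator C y * measure (\<kappa> (x, y)) A) \<partial>m x)"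
        by (simp add: kx.emeasure_eq_measure)
      also have "\<dots> = ennreal (\<integral>y. indicator C y * measure (\<kappa> (x, y)) A \<partial>m x)"
      proof (rule nn_integral_eq_integral)
        show "integrable (m x) (\<lambda>y. indicator C y * measure (\<kappa> (x, y)) A)"
        proof (rule mx.integrable_const_bound[where B=1])
          show "AE y in m x. norm (indicator C y * measure (\<kappa> (x, y)) A) \<le> 1"
            by (rule AE_I2) (auto simp: indicator_def prob_space.prob_le_1[OF \<kappa>p(1)])
          show "(\<lambda>y. indicator C y * measure (\<kappa> (x, y)) A) \<in> borel_measurable (m x)"
            by (intro borel_measurable_times borel_measurable_indicator) (auto simp: sm)
        qed
      qed simp
      finally have "measure (k x) {\<omega>\<in>A. \<omega> T \<in> C} = (\<integral>y. indicator C y * measure (\<kappa> (x, y)) A \<partial>m x)"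
        by (subst (asm) ennreal_inj) (auto intro!: Bochner_Integration.integral_nonneg)
      then show ?thesis by (simp add: set_lebesgue_integral_def)
    qed
    have mball: "measure (m x) (ball y r) = measure (k x) {\<omega>\<in>space (path_space T). \<omega> T \<in> ball y r}" for y r
      unfolding m_def by (subst measure_distr[OF mTk]) (auto simp: spk intro!: arg_cong[where f="measure (k x)"])
    have "AE y in m x. \<forall>A\<in>\<A>'. \<forall>j::nat. \<exists>n::nat. \<forall>r\<in>\<rat>. 0 < r \<and> r < 1/Suc n \<longrightarrow>
      \<bar>(LINT z:ball y r|m x. measure (\<kappa> (x, z)) A) - measure (\<kappa> (x, y)) A * measure (m x) (ball y r)\<bar> < measure (m x) (ball y r) / Suc j"
      unfolding AE_ball_countable[OF c\<A>']
    proof (intro ballI AE_differentiation[of "m x"] sm)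
      fix A assume "A \<in> \<A>'"
      note A = s\<A>'[OF this]
      show "finite_measure (m x)" by unfold_locales
      have "(\<lambda>y. emeasure (\<kappa> (x, y)) A) \<in> borel_measurable borel"
        by (rule measurable_compose[OF _ meas\<kappa>[OF A]]) (simp add: borel_prod[symmetric])
      then show "(\<lambda>z. measure (\<kappa> (x, z)) A) \<in> borel_measurable borel" unfolding measure_def by measurable
      show "0 \<le> measure (\<kappa> (x, y)) A \<and> measure (\<kappa> (x, y)) A \<le> 1" for y
        using prob_space.prob_le_1[OF \<kappa>p(1)] by simp
    qed
    then show ?case
    proof eventually_elim
      case (elim y)
      have keyb: "(LINT z:ball y r|m x. measure (\<kappa> (x, z)) A) = measure (k x) {\<omega>\<in>A. \<omega> T \<in> ball y r}" if "A \<in> \<A>'" for A r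
        by (rule key[OF s\<A>'[OF that], symmetric]) simp
      show ?case unfolding G_def fst_conv snd_conv
        by (rule ballI, insert elim, drule (1) bspec, simp only: keyb mball simp_thms)
    qed
  qed
  ultimately have "AE x in distr P borel (\<lambda>\<omega>. \<omega> (-T)). AE y in m x. G (x, y)" by blast
  with kU have "AE x in distr P borel (\<lambda>\<omega>. \<omega> (-T)). AE \<omega> in k x. langevin_from T U x = k x \<and> G (x, \<omega> T)"
  proof eventually_elim
    case (elim x)
    have [measurable]: "Measurable.pred borel (\<lambda>y. G (x, y))"
      by (rule measurable_compose[OF _ G]) (simp add: borel_prod[symmetric])
    have "AE \<omega> in k x. G (x, \<omega> T)"
      using elim(2) unfolding m_def by (subst (asm) AE_distr_iff[OF mTk]) auto
    then show ?case using elim(1) by simp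
  qed
  then have "AE x in distr P borel (\<lambda>\<omega>. \<omega> (-T)). AE \<omega> in k x. G (fst (x, \<omega>), snd (x, \<omega>) T)"
    by eventually_elim (auto elim: AE_mp)
  moreover have "Measurable.pred (borel \<Otimes>\<^sub>M P) (\<lambda>p. G (fst p, snd p T))"
    by (rule measurable_compose[OF _ G]) (unfold borel_prod[symmetric], measurable)
  ultimately have "AE \<omega> in P. G (fst (\<omega> (-T), \<omega>), snd (\<omega> (-T), \<omega>) T)"
    by (intro disintegration_AE_converse[OF pP miP k])
  then have "AE \<omega> in P. G (e \<omega>)" by (simp add: e_def)
  then have "AE z in distr P borel e. G z" by (subst AE_distr_iff[OF eP]) auto
  moreover have "AE z in distr P borel e. langevin_from T U (fst z) = k (fst z)"
  proof -
    have mf: "fst \<in> distr P borel e \<rightarrow>\<^sub>M (borel :: 'a measure)"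
      unfolding borel_prod[symmetric] by (simp cong: measurable_cong_sets)
    have "distr (distr P borel e) borel fst = distr P borel (\<lambda>\<omega>. \<omega> (-T))"
      using mf by (subst distr_distr[OF _ eP]) (auto simp: o_def e_def)
    then show ?thesis using kU by (intro AE_distrD[OF mf]) (simp only:)
  qed
  ultimately have "AE z in distr P borel e. bridge T U (fst z) (snd z) = \<kappa> z"
  proof eventually_elim
    case (elim z)
    show ?case
    proof (rule bridge_eq_if_differentiates[OF T \<A> _ elim(2)])
      show "k (fst z) \<in> space (prob_algebra (path_space T))" "\<kappa> z \<in> space (prob_algebra (path_space T))"
        using measurable_space[OF k1, of "fst z"] measurable_space[OF \<kappa>1, of z] by auto
    qed (rule elim(1)[unfolded G_def \<A>'_def])
  qed
  then show ?thesis unfolding e_def[abs_def] .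
qed

section \<open>The minimization problem\<close>

lemma strictly_convexD:
  assumes "strictly_convex c" "x \<noteq> y"
  shows "c ((x + y) / 2) < (c x + c y) / 2"
  using assms(1)[unfolded strictly_convex_def, rule_format, of x y "1/2"] assms(2) by (simp add: field_simps)

lemma strictly_convex_imp_convex_on:
  assumes "strictly_convex c"
  shows "convex_on UNIV c"
proof (rule convex_onI)
  fix t x y :: real assume t: "0 < t" "t < 1"
  show "c ((1 - t) *\<^sub>R x + t *\<^sub>R y) \<le> (1 - t) * c x + t * c y"
  proof (cases "x = y")
    case True
    have "(1 - t) * y + t * y = y" "(1 - t) * c y + t * c y = c y" by (simp_all add: algebra_simps)
    then show ?thesis using True by simp
  next
    case False
    then show ?thesis using assms t unfolding strictly_convex_def by (auto intro: less_imp_le)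
  qed
qed simp

lemma borel_measurable_strictly_convex:
  assumes "strictly_convex c"
  shows "c \<in> borel_measurable borel"
  using convex_on_continuous[OF open_UNIV strictly_convex_imp_convex_on[OF assms]]
  by (rule borel_measurable_continuous_onI)

text \<open>The Radon-Nikodym derivative is a fixed but unspecified version of the density; it
  agrees with \<open>f\<close> almost everywhere, and the integral sees no more.\<close>

lemma cost_density:
  assumes P: "prob_space P" and f[measurable]: "f \<in> borel_measurable P" and f0: "\<And>x. 0 \<le> f x"
  shows "cost c (density P (\<lambda>x. ennreal (f x))) P = (\<integral>\<^sup>+x. ennreal (c (f x)) \<partial>P)"
proof -
  interpret prob_space P by fact
  have RN: "AE x in P. ennreal (f x) = RN_deriv P (density P (\<lambda>x. ennreal (f x))) x"
    by (rule RN_deriv_unique) auto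
  have "(\<integral>\<^sup>+x. ennreal (c (enn2real (RN_deriv P (density P (\<lambda>x. ennreal (f x))) x))) \<partial>P) = (\<integral>\<^sup>+x. ennreal (c (f x)) \<partial>P)"
  proof (rule nn_integral_cong_AE, use RN in eventually_elim)
    case (elim x)
    show ?case by (simp add: f0 elim[symmetric])
  qed
  moreover have "absolutely_continuous P (density P (\<lambda>x. ennreal (f x)))"
    by (rule absolutely_continuousI_density) measurable
  ultimately show ?thesis by (simp add: cost_def)
qed

lemma density_RN_deriv_real:
  assumes P: "prob_space P" and Q: "prob_space Q" and sQ: "sets Q = sets P" and ac: "absolutely_continuous P Q"
  shows "Q = density P (\<lambda>x. ennreal (enn2real (RN_deriv P Q x)))"
proof -
  interpret P: prob_space P by fact
  interpret Q: prob_space Q by fact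
  have "AE x in P. RN_deriv P Q x = ennreal (enn2real (RN_deriv P Q x))"
    using P.RN_deriv_finite[OF Q.sigma_finite_measure_axioms ac sQ] by eventually_elim (simp add: less_top)
  then have "density P (RN_deriv P Q) = density P (\<lambda>x. ennreal (enn2real (RN_deriv P Q x)))"
    by (intro density_cong) auto
  then show ?thesis using P.density_RN_deriv[OF ac sQ] by simp
qed

text \<open>Competitors give \<open>e\<close> the law that it has under \<open>Q\<close>. The
  midpoint of \<open>h = dQ/dP\<close> and its conditional expectation \<open>G\<close> is one; its
  cost is at most the average of the costs of \<open>h\<close> and \<open>G\<close>, and by Jensen's
  inequality \<open>G\<close> costs no more than \<open>h\<close>. Minimality turns these
  inequalities into equalities, and strict convexity at the midpoint leaves \<open>h = G\<close>
  almost everywhere.\<close>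

theorem minimizer_density_factors:
  fixes P Q :: "'w measure" and S :: "'s measure"
  assumes c0: "\<And>x. 0 \<le> c x" and c: "strictly_convex c"
    and P: "prob_space P" and e[measurable]: "e \<in> P \<rightarrow>\<^sub>M S"
    and Q: "prob_space Q" and sQ: "sets Q = sets P" and fin: "cost c Q P < \<infinity>"
    and min: "\<And>Q'. prob_space Q' \<Longrightarrow> sets Q' = sets P \<Longrightarrow> distr Q' S e = distr Q S e \<Longrightarrow> cost c Q P \<le> cost c Q' P"
  obtains g :: "'s \<Rightarrow> real" where "g \<in> borel_measurable S" "\<And>s. 0 \<le> g s" "Q = density P (\<lambda>w. ennreal (g (e w)))"
proof -
  interpret P: prob_space P by fact
  interpret Q: prob_space Q by fact
  note cm[measurable] = borel_measurable_strictly_convex[OF c]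
  have spQ: "space Q = space P" by (rule sets_eq_imp_space_eq[OF sQ])
  have ac: "absolutely_continuous P Q" using fin by (auto simp: cost_def split: if_splits)
  define h where "h x = enn2real (RN_deriv P Q x)" for x
  have h[measurable]: "h \<in> borel_measurable P" unfolding h_def by measurable
  have h0: "0 \<le> h x" for x by (simp add: h_def)
  have Qh: "Q = density P (\<lambda>x. ennreal (h x))" unfolding h_def by (rule density_RN_deriv_real[OF P Q sQ ac])
  define \<rho> where "\<rho> = distr P S e"
  define \<pi> where "\<pi> = distr Q S e"
  have eQ[measurable]: "e \<in> Q \<rightarrow>\<^sub>M S" using e by (simp cong: measurable_cong_sets add: sQ)
  have p\<rho>: "prob_space \<rho>" unfolding \<rho>_def by (rule P.prob_space_distr) measurable
  have p\<pi>: "prob_space \<pi>" unfolding \<pi>_def by (rule Q.prob_space_distr) measurable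
  have s\<rho>[measurable_cong]: "sets \<rho> = sets S" by (simp add: \<rho>_def)
  have s\<pi>: "sets \<pi> = sets \<rho>" and s\<pi>S: "sets \<pi> = sets S" by (simp_all add: \<pi>_def \<rho>_def)
  have ac': "absolutely_continuous \<rho> \<pi>"
    unfolding absolutely_continuous_def
  proof
    fix N assume "N \<in> null_sets \<rho>"
    then have N: "N \<in> sets S" "e -` N \<inter> space P \<in> null_sets P"
      by (auto simp: \<rho>_def null_sets_distr_iff)
    then have "e -` N \<inter> space P \<in> null_sets Q" using ac by (auto simp: absolutely_continuous_def)
    then show "N \<in> null_sets \<pi>" using N by (auto simp: \<pi>_def null_sets_distr_iff spQ)
  qed
  \<comment> \<open>The density of the law of \<open>e\<close> under \<open>Q\<close> with respect
    to that under \<open>P\<close>. Composed with \<open>e\<close> it is the conditional expectation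
    of \<open>h\<close>, already in the form of a function of \<open>e\<close>.\<close>
  define g where "g s = enn2real (RN_deriv \<rho> \<pi> s)" for s
  have g[measurable]: "g \<in> borel_measurable S"
    unfolding g_def by (subst measurable_cong_sets[OF s\<rho>[symmetric] refl]) simp
  have g0: "0 \<le> g s" for s by (simp add: g_def)
  have \<pi>g: "\<pi> = density \<rho> (\<lambda>s. ennreal (g s))" unfolding g_def by (rule density_RN_deriv_real[OF p\<rho> p\<pi> s\<pi> ac'])
  have law_e: "emeasure (density P (\<lambda>w. ennreal (g (e w)))) (e -` C \<inter> space P) = emeasure \<pi> C" if C[measurable]: "C \<in> sets S" for C
  proof -
    have "emeasure (density P (\<lambda>w. ennreal (g (e w)))) (e -` C \<inter> space P) = (\<integral>\<^sup>+w. ennreal (g (e w)) * indicator C (e w) \<partial>P)"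
      by (subst emeasure_density) (auto intro!: nn_integral_cong simp: indicator_def)
    also have "\<dots> = (\<integral>\<^sup>+s. ennreal (g s) * indicator C s \<partial>\<rho>)"
      unfolding \<rho>_def by (subst nn_integral_distr) auto
    also have "\<dots> = emeasure \<pi> C" unfolding \<pi>g by (subst emeasure_density) auto
    finally show ?thesis .
  qed
  have feasible: "prob_space (density P (\<lambda>w. ennreal (f w))) \<and> distr (density P (\<lambda>w. ennreal (f w))) S e = \<pi>"
    if f: "\<And>C. C \<in> sets S \<Longrightarrow> emeasure (density P (\<lambda>w. ennreal (f w))) (e -` C \<inter> space P) = emeasure \<pi> C" for f
  proof
    have "e -` space S \<inter> space P = space P" using measurable_space[OF e] by auto
    then have "emeasure (density P (\<lambda>w. ennreal (f w))) (space P) = emeasure \<pi> (space \<pi>)"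
      using f[of "space S"] by (simp add: \<pi>_def)
    then show "prob_space (density P (\<lambda>w. ennreal (f w)))"
      using prob_space.emeasure_space_1[OF p\<pi>] by (intro prob_spaceI) simp
    show "distr (density P (\<lambda>w. ennreal (f w))) S e = \<pi>"
      by (rule measure_eqI) (simp_all add: s\<pi>S emeasure_distr f)
  qed
  have law_h: "emeasure (density P (\<lambda>w. ennreal (h w))) (e -` C \<inter> space P) = emeasure \<pi> C" if C: "C \<in> sets S" for C
    unfolding Qh[symmetric] \<pi>_def using C by (simp add: emeasure_distr spQ)
  define G where "G w = g (e w)" for w
  have G[measurable]: "G \<in> borel_measurable P" unfolding G_def by measurable
  have G0: "0 \<le> G w" for w by (simp add: G_def g0)
  have integrable: "integrable P f" if "prob_space (density P (\<lambda>w. ennreal (f w)))" "f \<in> borel_measurable P" "\<And>w. 0 \<le> f w" for f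
  proof -
    have "(\<integral>\<^sup>+w. ennreal (f w) \<partial>P) = 1"
      using prob_space.emeasure_space_1[OF that(1)] that(2) by (simp add: emeasure_density cong: nn_integral_cong)
    then show ?thesis using that by (intro integrableI_nonneg) auto
  qed
  have ih: "integrable P h" using Qh Q h h0 by (intro integrable) auto
  have iG: "integrable P G" using feasible[OF law_e] G G0 by (intro integrable) (auto simp: G_def)
  define F where "F = vimage_algebra (space P) e S"
  have eF: "e \<in> space P \<rightarrow> space S" using measurable_space[OF e] by auto
  have subF: "subalgebra P F"
    unfolding subalgebra_def F_def
  proof
    show "sets (vimage_algebra (space P) e S) \<subseteq> sets P"
      by (auto simp: sets_vimage_algebra2[OF eF])
  qed simp
  interpret F: finite_measure_subalgebra P F by unfold_locales (rule subF)
  \<comment> \<open>The events of \<open>F\<close> are those of the form \<open>e w \<in> C\<close>.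
    On them the integrals of \<open>h\<close> and \<open>G\<close> agree, as both densities give
    \<open>e\<close> the law \<pi>.\<close>
  have "AE w in P. real_cond_exp P F h w = G w"
  proof (rule F.real_cond_exp_charact[OF _ ih iG])
    show "G \<in> borel_measurable F"
      unfolding G_def F_def
      by (rule measurable_compose[OF measurable_vimage_algebra1 g]) (use measurable_space[OF e] in auto)
    fix A assume "A \<in> sets F"
    then obtain C where C: "C \<in> sets S" "A = e -` C \<inter> space P"
      by (auto simp: F_def sets_vimage_algebra2[OF eF])
    have A[measurable]: "A \<in> sets P" unfolding C(2) using C(1) by measurable
    have eq: "ennreal (LINT w:A|P. f w) = emeasure (density P (\<lambda>w. ennreal (f w))) A"
      if "integrable P f" "\<And>w. 0 \<le> f w" for f
    proof -
      have [measurable]: "f \<in> borel_measurable P" using that(1) by auto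
      have "emeasure (density P (\<lambda>w. ennreal (f w))) A = (\<integral>\<^sup>+w. ennreal (indicator A w *\<^sub>R f w) \<partial>P)"
        by (subst emeasure_density) (auto intro!: nn_integral_cong simp: indicator_def)
      also have "\<dots> = ennreal (LINT w:A|P. f w)"
        unfolding set_lebesgue_integral_def using that
        by (intro nn_integral_eq_integral integrable_mult_indicator) auto
      finally show ?thesis by simp
    qed
    have "ennreal (LINT w:A|P. h w) = ennreal (LINT w:A|P. G w)"
      unfolding eq[OF ih h0] eq[OF iG G0] unfolding C(2) law_h[OF C(1)] G_def law_e[OF C(1)] ..
    then show "(LINT w:A|P. h w) = (LINT w:A|P. G w)"
      by (subst (asm) ennreal_inj) (auto simp: set_lebesgue_integral_def h0 G0 intro!: Bochner_Integration.integral_nonneg)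
  qed
  note condG = this
  have cost_h: "cost c Q P = (\<integral>\<^sup>+w. ennreal (c (h w)) \<partial>P)"
    using cost_density[OF P h h0, of c] unfolding Qh[symmetric] .
  have ich: "integrable P (\<lambda>w. c (h w))"
    using fin c0 unfolding cost_h by (intro integrableI_nonneg) auto
  have "AE w in P. c (real_cond_exp P F h w) \<le> real_cond_exp P F (\<lambda>w. c (h w)) w"
    by (rule F.real_cond_exp_jensens_inequality(2)[OF ih _ _ ich]) (use strictly_convex_imp_convex_on[OF c] in auto)
  then have Jensen: "AE w in P. c (G w) \<le> real_cond_exp P F (\<lambda>w. c (h w)) w"
    using condG by eventually_elim simp
  have icond: "integrable P (real_cond_exp P F (\<lambda>w. c (h w)))" "(\<integral>w. real_cond_exp P F (\<lambda>w. c (h w)) w \<partial>P) = (\<integral>w. c (h w) \<partial>P)"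
    using F.real_cond_exp_int[OF ich] by auto
  \<comment> \<open>Jensen's bound also gives finite cost to \<open>G\<close>, without which the
    integrals below could not be subtracted.\<close>
  have icG: "integrable P (\<lambda>w. c (G w))"
  proof (rule Bochner_Integration.integrable_bound[OF icond(1)])
    show "AE w in P. norm (c (G w)) \<le> norm (real_cond_exp P F (\<lambda>w. c (h w)) w)"
      using Jensen by eventually_elim (simp add: c0 order_trans[OF _ abs_ge_self])
  qed measurable
  have leG: "(\<integral>w. c (G w) \<partial>P) \<le> (\<integral>w. c (h w) \<partial>P)"
    using integral_mono_AE[OF icG icond(1) Jensen] icond(2) by simp
  define m where "m w = (h w + G w) / 2" for w
  have m[measurable]: "m \<in> borel_measurable P" and m0: "0 \<le> m w" for w unfolding m_def using h0 G0 by (auto intro: add_nonneg_nonneg)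
  have cm_le: "c (m w) \<le> (c (h w) + c (G w)) / 2" for w
    using strictly_convexD[OF c, of "h w" "G w"] by (cases "h w = G w") (auto simp: m_def intro: less_imp_le)
  have icm: "integrable P (\<lambda>w. c (m w))"
    by (rule Bochner_Integration.integrable_bound[of _ "\<lambda>w. (c (h w) + c (G w)) / 2"])
      (use ich icG c0 cm_le in \<open>auto intro!: order_trans[OF cm_le]\<close>)
  have law_m: "emeasure (density P (\<lambda>w. ennreal (m w))) (e -` C \<inter> space P) = emeasure \<pi> C" if C[measurable]: "C \<in> sets S" for C
  proof -
    have "ennreal (m w) = ennreal (1/2) * (ennreal (h w) + ennreal (G w))" for w
    proof -
      have "ennreal (m w) = ennreal (1/2 * (h w + G w))" by (simp add: m_def)
      also have "\<dots> = ennreal (1/2) * ennreal (h w + G w)" by (rule ennreal_mult) (use h0 G0 in \<open>auto intro: add_nonneg_nonneg\<close>)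
      also have "ennreal (h w + G w) = ennreal (h w) + ennreal (G w)" by (rule ennreal_plus[OF h0 G0])
      finally show ?thesis .
    qed
    then have "emeasure (density P (\<lambda>w. ennreal (m w))) (e -` C \<inter> space P)
      = (\<integral>\<^sup>+w. ennreal (1/2) * (ennreal (h w) * indicator (e -` C \<inter> space P) w + ennreal (G w) * indicator (e -` C \<inter> space P) w) \<partial>P)"
      by (subst emeasure_density) (auto intro!: nn_integral_cong simp: algebra_simps)
    also have "\<dots> = ennreal (1/2) * (emeasure \<pi> C + emeasure \<pi> C)"
      using law_h[OF C] law_e[OF C]
      by (subst nn_integral_cmult) (simp_all add: nn_integral_add emeasure_density G_def)
    also have "\<dots> = emeasure \<pi> C"
    proof -
      interpret \<pi>: prob_space \<pi> by fact
      show ?thesis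
      proof -
        let ?p = "measure \<pi> C"
        have "ennreal ?p + ennreal ?p = ennreal (?p + ?p)" by (rule ennreal_plus[symmetric]) auto
        moreover have "ennreal (1/2) * ennreal (?p + ?p) = ennreal (1/2 * (?p + ?p))" by (rule ennreal_mult[symmetric]) auto
        ultimately show ?thesis unfolding \<pi>.emeasure_eq_measure by (simp only:) simp
      qed
    qed
    finally show ?thesis .
  qed
  have "cost c Q P \<le> cost c (density P (\<lambda>w. ennreal (m w))) P"
    using feasible[OF law_m] by (intro min) (auto simp: \<pi>_def)
  then have "ennreal (\<integral>w. c (h w) \<partial>P) \<le> ennreal (\<integral>w. c (m w) \<partial>P)"
    unfolding cost_h cost_density[OF P m m0]
    by (subst (asm) (1 2) nn_integral_eq_integral) (use ich icm c0 in auto)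
  then have le: "(\<integral>w. c (h w) \<partial>P) \<le> (\<integral>w. c (m w) \<partial>P)"
    by (subst (asm) ennreal_le_iff) (auto intro!: Bochner_Integration.integral_nonneg c0)
  \<comment> \<open>The integrand is the convexity gap at the midpoint. It is nonnegative, so an
    integral of at most 0 makes it vanish almost everywhere.\<close>
  have "(\<integral>w. (c (h w) + c (G w)) / 2 - c (m w) \<partial>P) = ((\<integral>w. c (h w) \<partial>P) + (\<integral>w. c (G w) \<partial>P)) / 2 - (\<integral>w. c (m w) \<partial>P)"
    using ich icG icm by simp
  also have "\<dots> \<le> 0" using le leG by simp
  finally have "(\<integral>w. (c (h w) + c (G w)) / 2 - c (m w) \<partial>P) = 0"
    using cm_le by (intro antisym Bochner_Integration.integral_nonneg) auto
  then have "AE w in P. (c (h w) + c (G w)) / 2 - c (m w) = 0"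
    using ich icG icm cm_le by (subst (asm) integral_nonneg_eq_0_iff_AE) auto
  then have "AE w in P. h w = G w"
    by eventually_elim (use strictly_convexD[OF c] in \<open>force simp: m_def\<close>)
  then have "Q = density P (\<lambda>w. ennreal (G w))"
    unfolding Qh by (intro density_cong) (auto elim!: AE_mp)
  then show ?thesis using that[OF g g0] by (simp add: G_def)
qed

text \<open>The end point law of \<open>Q\<close> has density \<open>g\<close> with respect to that
  of \<open>P\<close>, so the almost sure identification of the bridges remains valid for it; mixing
  the kernels \<open>\<kappa> z\<close> with weight \<open>g z\<close> then reproduces
  \<open>Q\<close> by the disintegration formula.\<close>

lemma bridge_mixture_eq_density:
  fixes P :: "(real \<Rightarrow> 'a::euclidean_space) measure" and g :: "'a \<times> 'a \<Rightarrow> real"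
  assumes T: "0 < T" and U: "admissible_potential T U" and P: "is_langevin_law T U \<mu> P"
    and g[measurable]: "g \<in> borel_measurable borel"
    and Q: "Q = density P (\<lambda>\<omega>. ennreal (g (\<omega> (-T), \<omega> T)))"
  shows "bridge_mixture T U (distr Q borel (\<lambda>\<omega>. (\<omega> (-T), \<omega> T))) = Q"
proof -
  define e where "e \<omega> = (\<omega> (-T), \<omega> T)" for \<omega> :: "real \<Rightarrow> 'a"
  have Ps: "P \<in> space (prob_algebra (path_space T))"
    using P langevin_solution_law_in_space unfolding is_langevin_law_def by blast
  then have sP[measurable_cong]: "sets P = sets (path_space T)" and pP: "prob_space P" by (auto simp: space_prob_algebra)
  have spP: "space P = space (path_space T)" by (rule sets_eq_imp_space_eq[OF sP])
  have sQ[measurable_cong]: "sets Q = sets (path_space T)" by (simp add: Q sP)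
  have spQ: "space Q = space (path_space T)" by (rule sets_eq_imp_space_eq[OF sQ])
  have mi[measurable]: "(\<lambda>\<omega>. \<omega> (-T)) \<in> path_space T \<rightarrow>\<^sub>M (borel :: 'a measure)"
    and mT[measurable]: "(\<lambda>\<omega>. \<omega> T) \<in> path_space T \<rightarrow>\<^sub>M (borel :: 'a measure)"
    using T by (auto intro!: measurable_path_eval)
  have e[measurable]: "e \<in> path_space T \<rightarrow>\<^sub>M (borel :: ('a \<times> 'a) measure)"
    unfolding e_def[abs_def] borel_prod[symmetric] by measurable
  have eP: "e \<in> P \<rightarrow>\<^sub>M borel" and eQ: "e \<in> Q \<rightarrow>\<^sub>M borel" by measurable
  obtain \<kappa> where \<kappa>: "disintegration P e borel \<kappa>"
    using exists_disintegration[OF retract_path_space[OF T] Ps e] by blast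
  have \<kappa>1: "\<kappa> \<in> borel \<rightarrow>\<^sub>M prob_algebra (path_space T)" using \<kappa> prob_algebra_cong[OF sP] by (simp add: disintegration_def)
  have \<kappa>p: "prob_space (\<kappa> z)" "sets (\<kappa> z) = sets (path_space T)" for z
    using measurable_space[OF \<kappa>1, of z] by (auto simp: space_prob_algebra)
  have sp\<kappa>: "space (\<kappa> z) = space (path_space T)" for z by (rule sets_eq_imp_space_eq[OF \<kappa>p(2)])
  define \<rho> where "\<rho> = distr P borel e"
  define \<pi> where "\<pi> = distr Q borel e"
  have \<pi>g: "\<pi> = density \<rho> (\<lambda>z. ennreal (g z))"
  proof (rule measure_eqI)
    fix C assume "C \<in> sets \<pi>"
    then have C[measurable]: "C \<in> sets borel" by (simp add: \<pi>_def)
    have "emeasure \<pi> C = emeasure Q (e -` C \<inter> space P)" unfolding \<pi>_def by (simp add: emeasure_distr[OF eQ] spQ spP)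
    also have "\<dots> = (\<integral>\<^sup>+w. ennreal (g (e w)) * indicator C (e w) \<partial>P)"
      unfolding Q e_def[symmetric] by (subst emeasure_density) (auto intro!: nn_integral_cong simp: indicator_def)
    also have "\<dots> = (\<integral>\<^sup>+z. ennreal (g z) * indicator C z \<partial>\<rho>)"
      unfolding \<rho>_def by (subst nn_integral_distr[OF eP]) auto
    also have "\<dots> = emeasure (density \<rho> (\<lambda>z. ennreal (g z))) C"
      by (subst emeasure_density) (auto simp: \<rho>_def)
    finally show "emeasure \<pi> C = emeasure (density \<rho> (\<lambda>z. ennreal (g z))) C" .
  qed (simp add: \<pi>_def \<rho>_def)
  have ac: "absolutely_continuous \<rho> \<pi>" unfolding \<pi>g by (rule absolutely_continuousI_density) (simp add: \<rho>_def)
  have s\<pi>: "sets \<pi> = sets \<rho>" by (simp add: \<pi>_def \<rho>_def)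
  have pr: "Measurable.pred (borel \<Otimes>\<^sub>M P) (\<lambda>p. e (snd p) = fst p)" by measurable
  have "AE z in \<rho>. AE \<omega> in \<kappa> z. e \<omega> = z"
    unfolding \<rho>_def using disintegration_AE[OF pP eP \<kappa> pr] by simp
  moreover have "AE z in \<rho>. bridge T U (fst z) (snd z) = \<kappa> z"
    using AE_bridge_eq_disintegration[OF T U P, folded e_def] \<kappa> unfolding \<rho>_def by (simp add: e_def[abs_def])
  ultimately have "AE z in \<rho>. bridge T U (fst z) (snd z) = \<kappa> z \<and> (AE \<omega> in \<kappa> z. e \<omega> = z)"
    by eventually_elim simp
  then have AE\<pi>: "AE z in \<pi>. bridge T U (fst z) (snd z) = \<kappa> z \<and> (AE \<omega> in \<kappa> z. e \<omega> = z)"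
    by (rule absolutely_continuous_AE[OF s\<pi> ac])
  have mix: "(\<integral>\<^sup>+(x, y). emeasure (bridge T U x y) (A \<inter> {\<omega> \<in> space (path_space T). \<omega> (-T) = x \<and> \<omega> T = y}) \<partial>\<pi>) = emeasure Q A"
    if A[measurable]: "A \<in> sets (path_space T)" for A
  proof -
    have meas\<kappa>: "(\<lambda>z. emeasure (\<kappa> z) A) \<in> borel_measurable borel"
      using measurable_emeasure_kernel[OF measurable_prob_algebraD[OF \<kappa>1] A] .
    have "(\<integral>\<^sup>+(x, y). emeasure (bridge T U x y) (A \<inter> {\<omega> \<in> space (path_space T). \<omega> (-T) = x \<and> \<omega> T = y}) \<partial>\<pi>)
        = (\<integral>\<^sup>+z. emeasure (\<kappa> z) A \<partial>\<pi>)"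
    proof (rule nn_integral_cong_AE, use AE\<pi> in eventually_elim)
      case (elim z)
      obtain x y where z: "z = (x, y)" by (cases z)
      have s: "{\<omega> \<in> space (path_space T). \<omega> (-T) = x \<and> \<omega> T = y} \<in> sets (path_space T)" by measurable
      \<comment> \<open>\<open>\<kappa> z\<close> is carried by the paths with end points
        \<open>z\<close>, so the end point constraint in \<open>bridge_mixture\<close> removes no
        mass.\<close>
      have "emeasure (\<kappa> z) (A \<inter> {\<omega> \<in> space (path_space T). \<omega> (-T) = x \<and> \<omega> T = y}) = emeasure (\<kappa> z) A"
      proof (rule emeasure_eq_AE)
        show "AE \<omega> in \<kappa> z. (\<omega> \<in> A \<inter> {\<omega> \<in> space (path_space T). \<omega> (-T) = x \<and> \<omega> T = y}) = (\<omega> \<in> A)"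
          using elim[THEN conjunct2] AE_space by eventually_elim (auto simp: e_def z sp\<kappa>)
      qed (use s A in \<open>auto simp: \<kappa>p\<close>)
      then show ?case using elim by (simp add: z)
    qed
    also have "\<dots> = (\<integral>\<^sup>+z. ennreal (g z) * emeasure (\<kappa> z) A \<partial>\<rho>)"
      unfolding \<pi>g using meas\<kappa> by (subst nn_integral_density) (auto simp: \<rho>_def)
    also have "\<dots> = (\<integral>\<^sup>+z. \<integral>\<^sup>+\<omega>. (\<lambda>p. ennreal (g (fst p)) * indicator A (snd p)) (z, \<omega>) \<partial>\<kappa> z \<partial>\<rho>)"
      by (intro nn_integral_cong) (simp add: nn_integral_cmult_indicator \<kappa>p)
    also have "\<dots> = (\<integral>\<^sup>+\<omega>. (\<lambda>p. ennreal (g (fst p)) * indicator A (snd p)) (e \<omega>, \<omega>) \<partial>P)"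
      unfolding \<rho>_def by (rule disintegration_nn_integral[OF pP eP \<kappa>, symmetric]) measurable
    also have "\<dots> = emeasure Q A"
      unfolding Q e_def[symmetric] by (subst emeasure_density) (auto simp: sP)
    finally show ?thesis .
  qed
  \<comment> \<open>The set function in \<open>bridge_mixture\<close> becomes known as a measure
    only through its agreement with \<open>emeasure Q\<close> on all events.\<close>
  have "bridge_mixture T U \<pi> = measure_of (space (path_space T)) (sets (path_space T)) (emeasure Q)"
    unfolding bridge_mixture_def
    by (rule measure_of_eq) (auto simp: sets.space_closed sets.sigma_sets_eq mix)
  also have "\<dots> = Q"
    using measure_of_of_measure[of Q] by (simp add: sQ spQ)
  finally show ?thesis unfolding \<pi>_def e_def[abs_def] .
qed

theorem proposition1p1:
  fixes T :: real and U :: "real \<Rightarrow> 'a::euclidean_space \<Rightarrow> real" and c :: "real \<Rightarrow> real"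
    and \<mu> \<nu> :: "'a measure" and P Q :: "(real \<Rightarrow> 'a) measure"
  assumes "0 < T"
    and "admissible_potential T U"
    and "\<And>x. 0 \<le> c x"
    and "strictly_convex c"
    and "\<mu> \<in> space (prob_algebra borel)"
    and "\<nu> \<in> space (prob_algebra borel)"
    and "is_langevin_law T U \<mu> P"
    and "is_solution T c \<mu> \<nu> P Q"
  shows "Q \<in> reciprocal_class T U"
proof -
  define e where "e \<omega> = (\<omega> (-T), \<omega> T)" for \<omega> :: "real \<Rightarrow> 'a"
  have "P \<in> space (prob_algebra (path_space T))"
    using assms(7) langevin_solution_law_in_space unfolding is_langevin_law_def by blast
  then have sP: "sets P = sets (path_space T)" and pP: "prob_space P" by (auto simp: space_prob_algebra)
  have Qs: "Q \<in> space (prob_algebra (path_space T))" and Q\<mu>: "distr Q borel (\<lambda>\<omega>. \<omega> (-T)) = \<mu>" and Q\<nu>: "distr Q borel (\<lambda>\<omega>. \<omega> T) = \<nu>"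
    and fin: "cost c Q P < \<infinity>" and min: "\<And>Q'. Q' \<in> feasible T \<mu> \<nu> \<Longrightarrow> cost c Q P \<le> cost c Q' P"
    using assms(8) by (auto simp: is_solution_def feasible_def)
  have sQ: "sets Q = sets (path_space T)" and pQ: "prob_space Q" using Qs by (auto simp: space_prob_algebra)
  have mi[measurable]: "(\<lambda>\<omega>. \<omega> (-T)) \<in> path_space T \<rightarrow>\<^sub>M (borel :: 'a measure)"
    and mT[measurable]: "(\<lambda>\<omega>. \<omega> T) \<in> path_space T \<rightarrow>\<^sub>M (borel :: 'a measure)"
    using assms(1) by (auto intro!: measurable_path_eval)
  have e: "e \<in> path_space T \<rightarrow>\<^sub>M (borel :: ('a \<times> 'a) measure)"
    unfolding e_def[abs_def] borel_prod[symmetric] by measurable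
  have eM: "e \<in> M \<rightarrow>\<^sub>M (borel :: ('a \<times> 'a) measure)" if "sets M = sets (path_space T)" for M
    using e by (simp cong: measurable_cong_sets add: that)
  \<comment> \<open>Both constraints depend on the joint end point law alone, so every competitor
    with the joint law of \<open>Q\<close> is feasible.\<close>
  have marginals: "distr M borel (\<lambda>\<omega>. \<omega> (-T)) = distr (distr M borel e) borel fst"
    "distr M borel (\<lambda>\<omega>. \<omega> T) = distr (distr M borel e) borel snd" if "sets M = sets (path_space T)" for M
  proof -
    have f: "fst \<in> (borel :: ('a \<times> 'a) measure) \<rightarrow>\<^sub>M (borel :: 'a measure)" "snd \<in> (borel :: ('a \<times> 'a) measure) \<rightarrow>\<^sub>M (borel :: 'a measure)"
      unfolding borel_prod[symmetric] by (rule measurable_fst, rule measurable_snd)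
    show "distr M borel (\<lambda>\<omega>. \<omega> (-T)) = distr (distr M borel e) borel fst"
      "distr M borel (\<lambda>\<omega>. \<omega> T) = distr (distr M borel e) borel snd"
      unfolding distr_distr[OF f(1) eM[OF that]] distr_distr[OF f(2) eM[OF that]] by (simp_all add: o_def e_def)
  qed
  obtain g where g: "g \<in> borel_measurable borel" "Q = density P (\<lambda>\<omega>. ennreal (g (e \<omega>)))"
  proof (rule minimizer_density_factors[OF assms(3,4) pP eM[OF sP] pQ _ fin])
    show "sets Q = sets P" by (simp add: sP sQ)
    fix Q' assume Q': "prob_space Q'" "sets Q' = sets P" "distr Q' borel e = distr Q borel e"
    then have sQ': "sets Q' = sets (path_space T)" by (simp add: sP)
    have "Q' \<in> feasible T \<mu> \<nu>"
      unfolding feasible_def using Q' sQ' Q\<mu> Q\<nu> marginals[OF sQ] marginals[OF sQ'] by (simp add: space_prob_algebra)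
    then show "cost c Q P \<le> cost c Q' P" by (rule min)
  qed blast
  have "distr Q borel e \<in> space (prob_algebra borel)"
    using prob_space.prob_space_distr[OF pQ eM[OF sQ]] by (simp add: space_prob_algebra)
  moreover have "Q = bridge_mixture T U (distr Q borel e)"
    using bridge_mixture_eq_density[OF assms(1,2,7) g(1) g(2)[unfolded e_def]] by (simp add: e_def[abs_def])
  ultimately show ?thesis using Qs unfolding reciprocal_class_def by blast
qed

end
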